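(* Let $\varepsilon_n\gg\sqrt{\delta_n}$ (with $\varepsilon_n\to0$), $p>d$, and $0<\alpha<\frac{p-d}{p-1}$. There is a constant $C>0$, independent of $n$, such that for all sufficiently large $n$, if $u_n:\Omega_n\to\mathbb{R}$ is a solution of $$L^{H_n}_{p,\varepsilon_n}u_n(x_i)=0\ \text{ for } x_i\in\Omega_n\setminus\mathcal{O},\qquad u_n(x_i)=y_i\ \text{ for } x_i\in\mathcal{O},$$ then $$|u_n(x_i)-u_n(x_j)|\le C|x_i-x_j|^\alpha+C\varepsilon_n^\alpha\qquad\text{for any } x_i,x_j\in\Omega_n .$$
   Context: Setting. $\Omega\subset\mathbb{R}^d$ ($d\ge2$) is a bounded, connected, open domain with $C^1$ boundary. $N\ge1$ is fixed, $\mathcal{O}=\{x_1,\dots,x_N\}\subset\Omega$ is a fixed set of labeled points (away from $\partial\Omega$) with labels $y_i\in\mathbb{R}$, $1\le i\le N$. The points $x_{N+1},x_{N+2},\dots$ are i.i.d. samples of a probability measure $\mu$ on $\Omega$ with Lebesgue density $\rho\in C^2(\overline\Omega)$, $\rho>0$ on $\overline\Omega$. For $n>N$, $\Omega_n=\{x_i\}_{i=1}^n$ and $\mu_n=\frac1n\sum_{i=1}^n\delta_{x_i}$. Here $a_n\gg b_n$ means $b_n/a_n\to0$, and $$\delta_n=\frac{(\ln n)^{3/4}}{\sqrt n}\ \text{ if } d=2,\qquad \delta_n=\frac{(\ln n)^{1/d}}{n^{1/d}}\ \text{ if } d\ge3.$$ The problem is considered deterministically for a realization of the samples for which there are transportation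 maps $T_n:\Omega\to\Omega_n$ with $T_{n\sharp}\mu=\mu_n$ and $c\le\liminf_n\|Id-T_n\|_{L^\infty(\Omega)}/\delta_n\le\limsup_n\|Id-T_n\|_{L^\infty(\Omega)}/\delta_n\le C$ for some constants $c,C>0$ (this holds almost surely); in particular $\|Id-T_n\|_{L^\infty(\Omega)}/\varepsilon_n^2\to0$. Kernel. $\eta:[0,\infty)\to[0,\infty)$ is nonincreasing and Lipschitz with $\eta(0)\le2$, $\eta(1)\ge1$; $\eta_{\varepsilon}(s)=\varepsilon^{-d}\eta(s/\varepsilon)$ and $\eta^\chi_{\varepsilon}(s)=\chi_{\{|s|<\varepsilon\}}\eta_\varepsilon(s)$. Put $$\sigma_{\eta,1}=\tfrac12\int_{B(0,1)}\eta(|y|)|y_1|^2dy,\quad \sigma_{\eta,2}=\tfrac12\int_{B(0,1)}\eta(|y|)dy,\quad k=k(p)=\sqrt{\frac{(p-2)\sigma_{\eta,1}}{\sigma_{\eta,2}}} .$$ Discrete operator. For $w:\Omega_n\to\mathbb{R}$ and $r\ge0$, $M^rw(x_i)=\max_{x_j\in\overline B(x_i,r)\cap\Omega_n}w(x_j)$ and $M_rw(x_i)=\min_{x_j\in\overline B(x_i,r)\cap\Omega_n}w(x_j)$, and $$L^{H_n}_{p,\varepsilon_n}w(x_i)=\frac1{2n\varepsilon_n^2}\sum_{j=1}^n\eta^\chi_{\varepsilon_n}(|x_i-x_j|)\bigl(M^{k\varepsilon_n}w(x_j)+M_{k\varepsilon_n}w(x_j)-2w(x_i)\bigr).$$ 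*)

theory Defs
  imports "HOL-Probability.Probability"
begin

text \<open>
  The space \<open>\<real>\<^sup>d\<close> is a type \<open>'a :: euclidean_space\<close> with \<open>d = DIM('a)\<close>.
  Sample points are a sequence \<open>x :: nat \<Rightarrow> 'a\<close> indexed from 1, so the point cloud
  \<open>\<Omega>\<^sub>n\<close> is \<open>x ` {1..n}\<close> and the labeled set is \<open>x ` {1..N}\<close>. A function on \<open>\<Omega>\<^sub>n\<close> is
  represented by a total function of which only the values on \<open>\<Omega>\<^sub>n\<close> are ever used.
\<close>

subsection \<open>Domain and density\<close>

definition C1_function :: "('a::euclidean_space \<Rightarrow> real) \<Rightarrow> bool" where
  "C1_function f \<longleftrightarrow>
     (\<exists>g. (\<forall>x. GDERIV f x :> g x) \<and> continuous_on UNIV g)"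

text \<open>
  The boundary is locally the graph of a \<open>C\<^sup>1\<close> function over a hyperplane
  \<open>{y. y \<bullet> e = 0}\<close>, with \<open>\<Omega>\<close> lying on one side. The vector \<open>y - (y \<bullet> e) *\<^sub>R e\<close> is the
  projection of \<open>y\<close> to the hyperplane, so only the restriction of \<open>f\<close> to it matters.
\<close>

definition C1_boundary :: "'a::euclidean_space set \<Rightarrow> bool" where
  "C1_boundary \<Omega> \<longleftrightarrow>
     (\<forall>z \<in> frontier \<Omega>. \<exists>r > 0. \<exists>e f. norm e = 1 \<and> C1_function f \<and>
        \<Omega> \<inter> ball z r = {y \<in> ball z r. f (y - (y \<bullet> e) *\<^sub>R e) < y \<bullet> e})"

text \<open>
  Membership in \<open>C\<^sup>2\<close> of the closure: the derivatives up to order two exist in \<open>\<Omega>\<close>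
  and have continuous extensions (\<open>g\<close> and \<open>H\<close>) to the closure.
\<close>

definition C2_on_closure :: "'a::euclidean_space set \<Rightarrow> ('a \<Rightarrow> real) \<Rightarrow> bool" where
  "C2_on_closure \<Omega> f \<longleftrightarrow>
     (\<exists>(g :: 'a \<Rightarrow> 'a) (H :: 'a \<Rightarrow> 'a \<Rightarrow>\<^sub>L 'a).
        (\<forall>z \<in> \<Omega>. GDERIV f z :> g z) \<and>
        (\<forall>z \<in> \<Omega>. (g has_derivative blinfun_apply (H z)) (at z)) \<and>
        continuous_on (closure \<Omega>) f \<and>
        continuous_on (closure \<Omega>) g \<and>
        continuous_on (closure \<Omega>) H)"

definition density_measure :: "'a::euclidean_space set \<Rightarrow> ('a \<Rightarrow> real) \<Rightarrow> 'a measure" where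
  "density_measure \<Omega> \<rho> = density (restrict_space lborel \<Omega>) (\<lambda>z. ennreal (\<rho> z))"

subsection \<open>Empirical measure and transport maps\<close>

text \<open>
  The image of the uniform distribution on the index set is \<open>(1/n) \<Sum>i=1..n. \<delta>\<^bsub>x i\<^esub>\<close>,
  counting repeated points with multiplicity.
\<close>

definition empirical_measure :: "(nat \<Rightarrow> 'a::euclidean_space) \<Rightarrow> nat \<Rightarrow> 'a measure" where
  "empirical_measure x n = distr (uniform_count_measure {1..n}) borel x"

lemma emeasure_empirical_measure:
  assumes "A \<in> sets borel"
  shows "emeasure (empirical_measure x n) A = ennreal (card {i \<in> {1..n}. x i \<in> A} / n)"
proof -
  have "emeasure (empirical_measure x n) A
      = emeasure (uniform_count_measure {1..n}) (x -` A \<inter> {1..n})"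
    unfolding empirical_measure_def
    using assms
    by (subst emeasure_distr)
       (auto simp: measurable_def space_uniform_count_measure sets_uniform_count_measure)
  also have "\<dots> = ennreal (card (x -` A \<inter> {1..n}) / card {1..n})"
    by (rule emeasure_uniform_count_measure) auto
  also have "x -` A \<inter> {1..n} = {i \<in> {1..n}. x i \<in> A}"
    by auto
  finally show ?thesis
    by simp
qed

definition transport_map ::
  "'a::euclidean_space set \<Rightarrow> ('a \<Rightarrow> real) \<Rightarrow> (nat \<Rightarrow> 'a) \<Rightarrow> nat \<Rightarrow> ('a \<Rightarrow> 'a) \<Rightarrow> bool" where
  "transport_map \<Omega> \<rho> x n T \<longleftrightarrow>
     T ` \<Omega> \<subseteq> x ` {1..n} \<and>
     T \<in> measurable (density_measure \<Omega> \<rho>) borel \<and>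
     distr (density_measure \<Omega> \<rho>) borel T = empirical_measure x n"

definition Linf_displacement :: "'a::euclidean_space set \<Rightarrow> ('a \<Rightarrow> 'a) \<Rightarrow> ereal" where
  "Linf_displacement \<Omega> T = esssup (restrict_space lborel \<Omega>) (\<lambda>z. ereal (norm (z - T z)))"

definition transport_rate :: "nat \<Rightarrow> nat \<Rightarrow> real" where
  "transport_rate d n =
     (if d = 2 then ln n powr (3/4) / sqrt n
      else ln n powr (1 / d) / n powr (1 / d))"

subsection \<open>Kernel\<close>

text \<open>The kernel is a function on \<open>[0,\<infinity>)\<close>; its values at negative arguments are irrelevant.\<close>

definition admissible_kernel :: "(real \<Rightarrow> real) \<Rightarrow> bool" where
  "admissible_kernel \<eta> \<longleftrightarrow>
     (\<forall>s \<ge> 0. 0 \<le> \<eta> s) \<and> antimono_on {0..} \<eta> \<and> (\<exists>L. L-lipschitz_on {0..} \<eta>) \<and>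
     \<eta> 0 \<le> 2 \<and> 1 \<le> \<eta> 1"

definition scaled_kernel :: "nat \<Rightarrow> (real \<Rightarrow> real) \<Rightarrow> real \<Rightarrow> real \<Rightarrow> real" where
  "scaled_kernel d \<eta> \<epsilon> s = \<eta> (s / \<epsilon>) / \<epsilon> ^ d"

definition cutoff_kernel :: "nat \<Rightarrow> (real \<Rightarrow> real) \<Rightarrow> real \<Rightarrow> real \<Rightarrow> real" where
  "cutoff_kernel d \<eta> \<epsilon> s = (if \<bar>s\<bar> < \<epsilon> then scaled_kernel d \<eta> \<epsilon> s else 0)"

text \<open>
  The first coordinate is the one along an arbitrarily chosen basis vector; the integral
  does not depend on the choice, by rotational symmetry.
\<close>

definition sigma1 :: "'a::euclidean_space itself \<Rightarrow> (real \<Rightarrow> real) \<Rightarrow> real" where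
  "sigma1 _ \<eta> =
     (let e = (SOME e. e \<in> (Basis :: 'a set))
      in 1/2 * (LINT y:ball 0 1|lborel. \<eta> (norm y) * \<bar>y \<bullet> e\<bar>\<^sup>2))"

definition sigma2 :: "'a::euclidean_space itself \<Rightarrow> (real \<Rightarrow> real) \<Rightarrow> real" where
  "sigma2 _ \<eta> = 1/2 * (LINT y:ball (0::'a) 1|lborel. \<eta> (norm y))"

definition radius_factor :: "'a::euclidean_space itself \<Rightarrow> (real \<Rightarrow> real) \<Rightarrow> real \<Rightarrow> real" where
  "radius_factor t \<eta> p = sqrt ((p - 2) * sigma1 t \<eta> / sigma2 t \<eta>)"

subsection \<open>Discrete operator\<close>

definition max_op ::
  "(nat \<Rightarrow> 'a::euclidean_space) \<Rightarrow> nat \<Rightarrow> real \<Rightarrow> ('a \<Rightarrow> real) \<Rightarrow> 'a \<Rightarrow> real" where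
  "max_op x n r w z = Max (w ` (cball z r \<inter> x ` {1..n}))"

definition min_op ::
  "(nat \<Rightarrow> 'a::euclidean_space) \<Rightarrow> nat \<Rightarrow> real \<Rightarrow> ('a \<Rightarrow> real) \<Rightarrow> 'a \<Rightarrow> real" where
  "min_op x n r w z = Min (w ` (cball z r \<inter> x ` {1..n}))"

definition hypergraph_op ::
  "(real \<Rightarrow> real) \<Rightarrow> real \<Rightarrow> real \<Rightarrow> (nat \<Rightarrow> 'a::euclidean_space) \<Rightarrow> nat \<Rightarrow> ('a \<Rightarrow> real) \<Rightarrow> 'a \<Rightarrow> real"
where
  "hypergraph_op \<eta> p \<epsilon> x n w z =
     (let k = radius_factor TYPE('a) \<eta> p
      in 1 / (2 * n * \<epsilon>\<^sup>2) *
         (\<Sum>j=1..n. cutoff_kernel DIM('a) \<eta> \<epsilon> (norm (z - x j)) *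
            (max_op x n (k * \<epsilon>) w (x j) + min_op x n (k * \<epsilon>) w (x j) - 2 * w z)))"

definition is_solution ::
  "(real \<Rightarrow> real) \<Rightarrow> real \<Rightarrow> real \<Rightarrow> (nat \<Rightarrow> 'a::euclidean_space) \<Rightarrow> nat \<Rightarrow> (nat \<Rightarrow> real) \<Rightarrow> nat
     \<Rightarrow> ('a \<Rightarrow> real) \<Rightarrow> bool"
where
  "is_solution \<eta> p \<epsilon> x N y n u \<longleftrightarrow>
     (\<forall>z \<in> x ` {1..n} - x ` {1..N}. hypergraph_op \<eta> p \<epsilon> x n u z = 0) \<and>
     (\<forall>i \<in> {1..N}. u (x i) = y i)"

end

theory Submission
  imports Defs
begin

text \<open>
  Proof idea. At a point where \<open>u - W\<close> is maximal over the cloud, max and min of \<open>u\<close> over balls are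
  dominated by those of \<open>W\<close>, so a strict supersolution \<open>W\<close> admits no such point outside the labels.
  With pole \<open>x\<^sub>0\<close> we take \<open>W = F \<circ> N\<close>, where \<open>F\<close> is increasing and \<open>N v = |v| - s (v \<bullet> e)\<close> is a tilted
  norm of \<open>v = x - x\<^sub>0\<close>; since \<open>F\<close> is increasing, max and min of \<open>W\<close> are \<open>F\<close> of max and min of \<open>N\<close>, and
  the contributions of the summands of \<open>F\<close> just add up.

  The main summand \<open>t\<^sup>\<alpha>\<close> of \<open>F\<close> is a strict supersolution at distance at least \<open>K \<epsilon>\<close> because
  \<open>\<alpha> < (p - d) / (p - 1)\<close>. The tilt, along an approximate inner normal \<open>e\<close>, makes the gradient point
  out of the domain near the boundary: the first order term contributed by the missing part of the
  averaging ball then has the right sign. For \<open>\<delta> \<lless> \<epsilon>\<^sup>2\<close> the error of replacing sums by integrals is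
  of lower order. At distance below \<open>K \<epsilon>\<close> a summand of size \<open>\<epsilon>\<^sup>\<alpha>\<close>, exponential with a jump at the pole,
  takes over.

  Comparison with poles at the labels bounds \<open>|u - y\<^sub>i|\<close>; this is the boundary information needed for
  comparison with a pole at an arbitrary point of the cloud, which is the claim.
\<close>

subsection \<open>Lebesgue measure and orthogonal maps\<close>

text \<open>The condition on \<open>\<alpha>\<close> is a moment identity. For
  \<open>norm v powr \<alpha>\<close> the second order part of an averaged step is a positive
  multiple of \<open>(d - 2 + \<alpha>) * \<sigma>1 - (1 - \<alpha>) * k^2 * \<sigma>2\<close>, and
  \<open>k^2 * \<sigma>2 = (p - 2) * \<sigma>1\<close> turns this into
  \<open>- \<sigma>1 * (p - d - \<alpha> * (p - 1))\<close>. The obstacle is the boundary, where no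
  data are prescribed. At distance \<open>R\<close> from the pole second order terms have size
  \<open>\<epsilon>^2 * R powr (\<alpha> - 2)\<close>, but an averaging ball cut by the boundary
  leaves a first order term of size \<open>\<epsilon> * R powr (\<alpha> - 1)\<close>. It is larger
  by the factor \<open>R / \<epsilon>\<close>, so it cannot be an error and must have a sign. In a
  non-convex domain the untilted gradient may point slightly inwards at the boundary; a tilt
  \<open>s\<close> larger than the flatness defect \<open>\<delta>0\<close> rules this out, and its
  cost \<open>s * \<epsilon>^2\<close> is absorbed by strictness. The tilt axis belongs to the pole,
  so a barrier works only within the radius of flatness; farther away the maximum principle bounds
  \<open>u\<close>. The demand on \<open>\<delta>\<close> has the same origin: moving mass by
  \<open>\<delta>\<close> changes the first order term in proportion to \<open>\<delta>\<close>, not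
  to \<open>\<delta> * \<epsilon>\<close>.\<close>

lemma nn_integral_lborel_translate:
  fixes f :: "'a::euclidean_space \<Rightarrow> ennreal"
  assumes "f \<in> borel_measurable borel"
  shows "(\<integral>\<^sup>+x. f (c + x) \<partial>lborel) = (\<integral>\<^sup>+x. f x \<partial>lborel)"
  by (subst lborel_distr_plus[symmetric, of c]) (use assms in \<open>simp add: nn_integral_distr\<close>)

text \<open>Uniqueness of Haar measure, by the classical Fubini argument.\<close>

lemma lborel_distr_orthogonal:
  fixes f :: "'a::euclidean_space \<Rightarrow> 'a"
  assumes f: "orthogonal_transformation f"
  shows "distr lborel borel f = lborel"
proof -
  define M where "M = distr lborel borel f"
  have lin: "linear f" and iso: "\<And>v. norm (f v) = norm v"
    using f by (auto simp: orthogonal_transformation)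
  have fm [measurable]: "f \<in> borel_measurable borel"
    using lin by (intro borel_measurable_continuous_onI linear_continuous_on)
      (simp add: linear_conv_bounded_linear)
  have surj: "surj f"
    using f by (rule orthogonal_transformation_surj)
  have sM [measurable_cong]: "sets M = sets borel"
    by (simp add: M_def)
  \<comment> \<open>Since \<open>f\<close> is onto and additive, a shift by \<open>c = f b\<close>
    after \<open>f\<close> is a shift by \<open>b\<close> before it.\<close>
  have trans: "(\<integral>\<^sup>+x. g (c + x) \<partial>M) = (\<integral>\<^sup>+x. g x \<partial>M)"
    if [measurable]: "g \<in> borel_measurable borel" for g c
  proof -
    obtain b where b: "c = f b"
      using surj by (metis surjD)
    have "(\<integral>\<^sup>+x. g (c + x) \<partial>M) = (\<integral>\<^sup>+x. g (f (b + x)) \<partial>lborel)"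
      unfolding M_def by (subst nn_integral_distr) (simp_all add: b linear_add[OF lin])
    also have "\<dots> = (\<integral>\<^sup>+x. g (f x) \<partial>lborel)"
      by (rule nn_integral_lborel_translate) measurable
    also have "\<dots> = (\<integral>\<^sup>+x. g x \<partial>M)"
      unfolding M_def by (subst nn_integral_distr) simp_all
    finally show ?thesis .
  qed
  have ball: "emeasure M (ball 0 r) = emeasure lborel (ball (0::'a) r)" for r
  proof -
    have "f -` ball 0 r = ball (0::'a) r"
      using iso by (auto simp: dist_norm)
    then show ?thesis
      unfolding M_def by (subst emeasure_distr) simp_all
  qed
  have sf: "sigma_finite_measure M"
  proof
    show "\<exists>A. countable A \<and> A \<subseteq> sets M \<and> \<Union>A = space M \<and> (\<forall>a\<in>A. emeasure M a \<noteq> \<infinity>)"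
    proof (intro exI[of _ "range (\<lambda>n::nat. ball 0 (real n))"] conjI)
      show "\<Union> (range (\<lambda>n::nat. ball (0::'a) (real n))) = space M"
        by (auto simp: M_def intro: reals_Archimedean2)
    qed (use emeasure_lborel_ball_finite in \<open>auto simp: sM ball less_top\<close>)
  qed
  interpret pair_sigma_finite M lborel
    using sf by (simp add: pair_sigma_finite_def lborel.sigma_finite_measure_axioms)
  \<comment> \<open>The double integral of \<open>indicator A x * indicator B y\<close> is
    transformed into one with the roles of the two measures exchanged; each shift uses the
    invariance of one measure only, with Fubini in between.\<close>
  have "emeasure M A = emeasure lborel A" if A [measurable]: "A \<in> sets borel" for A
  proof -
    define B where "B = ball (0::'a) 1"
    have B [measurable]: "B \<in> sets borel"
      by (simp add: B_def)
    have "emeasure M A * emeasure lborel B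
        = (\<integral>\<^sup>+y. (\<integral>\<^sup>+x. indicator A x * indicator B y \<partial>M) \<partial>lborel)"
      by (simp add: nn_integral_multc nn_integral_cmult)
    also have "\<dots> = (\<integral>\<^sup>+y. (\<integral>\<^sup>+x. indicator A (y + x) * indicator B y \<partial>M) \<partial>lborel)"
    proof (rule nn_integral_cong)
      fix y :: 'a
      show "(\<integral>\<^sup>+x. indicator A x * indicator B y \<partial>M) = (\<integral>\<^sup>+x. indicator A (y + x) * indicator B y \<partial>M)"
        by (rule trans[of "\<lambda>x. indicator A x * indicator B y" y, symmetric]) measurable
    qed
    also have "\<dots> = (\<integral>\<^sup>+x. (\<integral>\<^sup>+y. indicator A (y + x) * indicator B y \<partial>lborel) \<partial>M)"
      by (rule Fubini') measurable
    also have "\<dots> = (\<integral>\<^sup>+x. (\<integral>\<^sup>+y. indicator A y * indicator B (y - x) \<partial>lborel) \<partial>M)"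
    proof (rule nn_integral_cong)
      fix x
      show "(\<integral>\<^sup>+y. indicator A (y + x) * indicator B y \<partial>lborel)
          = (\<integral>\<^sup>+y. indicator A y * indicator B (y - x) \<partial>lborel)"
        using nn_integral_lborel_translate[of "\<lambda>y. indicator A y * indicator B (y - x)" x]
        by (simp add: add.commute)
    qed
    also have "\<dots> = (\<integral>\<^sup>+y. (\<integral>\<^sup>+x. indicator A y * indicator B (y - x) \<partial>M) \<partial>lborel)"
      by (rule Fubini'[symmetric]) measurable
    also have "\<dots> = (\<integral>\<^sup>+y. indicator A y * emeasure lborel B \<partial>lborel)"
    proof (rule nn_integral_cong)
      fix y
      have "(\<integral>\<^sup>+x. indicator A y * indicator B (y - x) \<partial>M)
          = indicator A y * (\<integral>\<^sup>+x. indicator B (y - x) \<partial>M)"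
        by (rule nn_integral_cmult) measurable
      also have "(\<integral>\<^sup>+x. indicator B (y - x) \<partial>M) = (\<integral>\<^sup>+x. indicator B (y - (y + x)) \<partial>M)"
        by (rule trans[symmetric]) measurable
      \<comment> \<open>After the shift the argument of \<open>B\<close> is \<open>- x\<close>, and
        a ball around the origin is symmetric.\<close>
      also have "\<dots> = (\<integral>\<^sup>+x. indicator B x \<partial>M)"
        by (intro nn_integral_cong) (simp add: B_def indicator_def)
      also have "\<dots> = emeasure lborel B"
        using ball[of 1] by (simp add: B_def)
      finally show "(\<integral>\<^sup>+x. indicator A y * indicator B (y - x) \<partial>M) = indicator A y * emeasure lborel B" .
    qed
    also have "\<dots> = emeasure lborel A * emeasure lborel B"
      by (simp add: nn_integral_multc)
    finally have "emeasure M A * emeasure lborel B = emeasure lborel A * emeasure lborel B" .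
    moreover have "0 < emeasure lborel B"
      unfolding B_def by (subst emeasure_ball) (simp_all add: unit_ball_vol_pos)
    moreover have "emeasure lborel B < \<infinity>"
      unfolding B_def by (rule emeasure_lborel_ball_finite)
    ultimately show ?thesis
      by (metis ennreal_mult_divide_eq infinity_ennreal_def not_gr_zero less_irrefl)
  qed
  then show ?thesis
    by (intro measure_eqI) (auto simp: M_def)
qed


section \<open>Reflections and integrals of radial weights times a function of one
  coordinate\<close>

lemma integral_orthogonal:
  fixes f :: "'a::euclidean_space \<Rightarrow> 'a" and g :: "'a \<Rightarrow> real"
  assumes f: "orthogonal_transformation f" and g [measurable]: "g \<in> borel_measurable borel"
  shows "(LINT x|lborel. g (f x)) = (LINT x|lborel. g x)"
proof -
  have [measurable]: "f \<in> borel_measurable borel"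
    using f by (intro borel_measurable_continuous_onI linear_continuous_on)
      (simp add: linear_conv_bounded_linear orthogonal_transformation)
  show ?thesis
    by (subst (2) lborel_distr_orthogonal[OF f, symmetric]) (simp add: integral_distr)
qed

text \<open>Householder reflection. The vector \<open>w\<close> need not be normalised, and division
  by zero makes \<open>w = 0\<close> give the identity, so degenerate reflections are still
  isometries.\<close>

definition reflect :: "'a::real_inner \<Rightarrow> 'a \<Rightarrow> 'a" where
  "reflect w v = v - (2 * (v \<bullet> w) / (w \<bullet> w)) *\<^sub>R w"

lemma orthogonal_transformation_reflect: "orthogonal_transformation (reflect w)"
proof -
  have "linear (reflect w)"
    by (rule linearI) (simp_all add: reflect_def inner_simps algebra_simps add_divide_distrib)
  moreover have "reflect w v \<bullet> reflect w v = v \<bullet> v" for v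
    by (cases "w = 0") (simp_all add: reflect_def inner_simps inner_commute field_simps)
  ultimately show ?thesis
    by (simp add: orthogonal_transformation norm_eq_sqrt_inner)
qed

lemma norm_reflect [simp]: "norm (reflect w v) = norm v"
  using orthogonal_transformation_reflect[of w] by (simp add: orthogonal_transformation)

text \<open>For unit vectors the reflection along \<open>e - b\<close> exchanges \<open>e\<close>
  and \<open>b\<close>, and a reflection is its own adjoint.\<close>

lemma inner_reflect_unit_difference:
  assumes "norm e = 1" "norm b = 1"
  shows "reflect (e - b) v \<bullet> b = v \<bullet> e"
proof (cases "e = b")
  case False
  have "(e - b) \<bullet> (e - b) = 2 * (1 - e \<bullet> b)"
    using assms by (simp add: inner_simps inner_commute norm_eq_1)
  moreover have "(e - b) \<bullet> (e - b) \<noteq> 0"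
    using False by simp
  ultimately have h: "(e - b) \<bullet> (e - b) = 2 * (1 - e \<bullet> b)" "1 - e \<bullet> b \<noteq> 0"
    by auto
  have eb: "(e - b) \<bullet> b = - (1 - e \<bullet> b)"
    using assms by (simp add: inner_simps norm_eq_1)
  have "reflect (e - b) v \<bullet> b = v \<bullet> b - 2 * (v \<bullet> (e - b)) / ((e - b) \<bullet> (e - b)) * ((e - b) \<bullet> b)"
    by (simp add: reflect_def inner_diff_left[of v])
  also have "\<dots> = v \<bullet> b + v \<bullet> (e - b)"
    unfolding h(1) eb using h(2) by (simp add: field_simps)
  finally show ?thesis
    by (simp add: inner_diff_right)
qed (simp add: reflect_def)

text \<open>The only form of rotational symmetry that is needed: it replaces an arbitrary unit
  direction by a basis vector, both for slabs and for second moments.\<close>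

lemma integral_radial_inner:
  fixes e b :: "'a::euclidean_space" and w :: "real \<Rightarrow> real" and g :: "real \<Rightarrow> real"
  assumes [measurable]: "w \<in> borel_measurable borel" "g \<in> borel_measurable borel"
    and "norm e = 1" "norm b = 1"
  shows "(LINT v|lborel. w (norm v) * g (v \<bullet> e)) = (LINT v|lborel. w (norm v) * g (v \<bullet> b))"
  using integral_orthogonal[OF orthogonal_transformation_reflect, of "\<lambda>v. w (norm v) * g (v \<bullet> b)" "e - b"]
  by (simp add: inner_reflect_unit_difference assms)

text \<open>Once \<open>e\<close> is rotated to a basis vector, the slab fits into a box with one
  side \<open>b - a\<close> and all other sides 2.\<close>

lemma measure_slab_le:
  fixes e :: "'a::euclidean_space"
  assumes e: "norm e = 1" and ab: "a \<le> b"
  shows "measure lborel {v. norm v < 1 \<and> a \<le> v \<bullet> e \<and> v \<bullet> e \<le> b} \<le> 2 ^ DIM('a) * (b - a)"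
proof -
  obtain i :: 'a where i: "i \<in> Basis"
    using nonempty_Basis by blast
  define S where "S u = {v::'a. norm v < 1 \<and> a \<le> v \<bullet> u \<and> v \<bullet> u \<le> b}" for u
  have S [measurable]: "S u \<in> sets borel" for u
    unfolding S_def by measurable
  have S_int: "measure lborel (S u) = (LINT v|lborel. indicator {..<1} (norm v) * indicator {a..b} (v \<bullet> u))" for u
  proof -
    have "measure lborel (S u) = (LINT v|lborel. indicator (S u) v)"
      by simp
    also have "\<dots> = (LINT v|lborel. indicator {..<1} (norm v) * indicator {a..b} (v \<bullet> u))"
      by (intro Bochner_Integration.integral_cong) (auto simp: S_def indicator_def)
    finally show ?thesis .
  qed
  have "measure lborel (S e) = (LINT v|lborel. indicator {..<1} (norm v) * indicator {a..b} (v \<bullet> e))"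
    by (rule S_int)
  also have "\<dots> = (LINT v|lborel. indicator {..<1} (norm v) * indicator {a..b} (v \<bullet> i))"
    using e i by (intro integral_radial_inner) auto
  also have "\<dots> = measure lborel (S i)"
    by (rule S_int[symmetric])
  also have "\<dots> \<le> measure lborel (cbox (\<Sum>j\<in>Basis. (if j = i then a else -1) *\<^sub>R j)
      (\<Sum>j\<in>Basis. (if j = i then b else 1) *\<^sub>R j))"
  proof (rule measure_mono_fmeasurable)
    show "S i \<subseteq> cbox (\<Sum>j\<in>Basis. (if j = i then a else -1) *\<^sub>R j)
      (\<Sum>j\<in>Basis. (if j = i then b else 1) *\<^sub>R j)"
    proof
      fix v assume v: "v \<in> S i"
      have "\<bar>v \<bullet> j\<bar> \<le> 1" if "j \<in> Basis" for j
        using Basis_le_norm[OF that, of v] v by (auto simp: S_def)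
      then show "v \<in> cbox (\<Sum>j\<in>Basis. (if j = i then a else -1) *\<^sub>R j)
          (\<Sum>j\<in>Basis. (if j = i then b else 1) *\<^sub>R j)"
        using v by (auto simp: mem_box S_def abs_le_iff)
    qed
  qed auto
  also have "\<dots> = (\<Prod>j\<in>Basis. if j = i then b - a else 2)"
    using ab by (subst measure_lborel_cbox_eq) (auto simp: inner_diff_left intro!: prod.cong)
  also have "\<dots> = (b - a) * 2 ^ (DIM('a) - 1)"
    using i by (simp add: prod.remove[of _ i])
  also have "\<dots> \<le> (b - a) * 2 ^ DIM('a)"
    using ab by (intro mult_left_mono power_increasing) auto
  finally show ?thesis
    by (simp add: S_def mult.commute)
qed

subsection \<open>Powers of a tilted norm\<close>

text \<open>The gap \<open>g\<close> vanishes at 0 together with its derivative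
  \<open>a * h\<close>, and the derivative of \<open>h\<close> is nonnegative by AM-GM, since
  \<open>(1 - t) powr (a - 2)\<close> and \<open>(1 + t) powr (a - 2)\<close> have product at least
  1. No remainder appears, even for \<open>x\<close> close to 1.\<close>

lemma powr_symmetric_sum_one:
  fixes a x :: real
  assumes a: "0 < a" "a < 1" and x: "0 \<le> x" "x < 1"
  shows "(1 + x) powr a + (1 - x) powr a \<le> 2 - a * (1 - a) * x\<^sup>2"
proof -
  define h where "h t = (1 - t) powr (a - 1) - (1 + t) powr (a - 1) - 2 * (1 - a) * t" for t
  define g where "g t = 2 - a * (1 - a) * t\<^sup>2 - (1 + t) powr a - (1 - t) powr a" for t
  have h_deriv: "(h has_real_derivative
      (1 - a) * ((1 - t) powr (a - 2) + (1 + t) powr (a - 2) - 2)) (at t)"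
    if "0 \<le> t" "t < 1" for t
    unfolding h_def using that by (auto intro!: derivative_eq_intros simp: algebra_simps)
  have h_mono: "0 \<le> (1 - a) * ((1 - t) powr (a - 2) + (1 + t) powr (a - 2) - 2)"
    if t: "0 \<le> t" "t < 1" for t
  proof -
    define p q where "p = (1 - t) powr (a - 2)" and "q = (1 + t) powr (a - 2)"
    have pos: "0 < p" "0 < q"
      using t by (auto simp: p_def q_def)
    have "p * q = (1 - t\<^sup>2) powr (a - 2)"
      using t by (simp add: p_def q_def powr_mult[symmetric] algebra_simps power2_eq_square)
    moreover have "0 < 1 - t\<^sup>2"
      using t by (simp add: power_less_one_iff abs_square_less_1)
    ultimately have pq: "1 \<le> p * q"
      using a powr_mono2'[of "a - 2" "1 - t\<^sup>2" 1] by simp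
    have "2 \<le> p + q"
    proof (rule power2_le_imp_le)
      show "2\<^sup>2 \<le> (p + q)\<^sup>2"
        using pq sum_squares_bound[of p q] by (simp add: power2_sum)
    qed (use pos in simp)
    then show ?thesis
      using a by (simp add: p_def q_def)
  qed
  have h_nonneg: "0 \<le> h t" if "0 \<le> t" "t < 1" for t
  proof -
    have "h 0 \<le> h t"
    proof (rule DERIV_nonneg_imp_nondecreasing[of 0 t h])
      fix y assume "0 \<le> y" "y \<le> t"
      then show "\<exists>D. (h has_real_derivative D) (at y) \<and> 0 \<le> D"
        using that h_deriv[of y] h_mono[of y] by auto
    qed (use that in auto)
    then show ?thesis
      by (simp add: h_def)
  qed
  have g_deriv: "(g has_real_derivative a * h t) (at t)" if "0 \<le> t" "t < 1" for t
    unfolding g_def h_def using that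
    by (auto intro!: derivative_eq_intros simp: algebra_simps)
  have "g 0 \<le> g x"
  proof (rule DERIV_nonneg_imp_nondecreasing[of 0 x g])
    fix y assume "0 \<le> y" "y \<le> x"
    then have "(g has_real_derivative a * h y) (at y)" "0 \<le> a * h y"
      using x a h_nonneg[of y] g_deriv[of y] by auto
    then show "\<exists>D. (g has_real_derivative D) (at y) \<and> 0 \<le> D"
      by blast
  qed (use x in auto)
  then show ?thesis
    by (simp add: g_def)
qed

text \<open>Here \<open>y + x\<close> and \<open>y - x\<close> are meant as bounds for the maximum
  and the minimum of the tilted norm over a ball; the quadratic term is the gain of the max-min
  average from strict concavity.\<close>

lemma powr_symmetric_sum:
  fixes a x y :: real
  assumes a: "0 < a" "a < 1" and x: "0 \<le> x" "x < y"
  shows "(y + x) powr a + (y - x) powr a \<le> 2 * y powr a - a * (1 - a) * y powr (a - 2) * x\<^sup>2"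
proof -
  have y: "0 < y"
    using x by simp
  have "(1 + x / y) powr a + (1 - x / y) powr a \<le> 2 - a * (1 - a) * (x / y)\<^sup>2"
    using x y by (intro powr_symmetric_sum_one a) auto
  then have "y powr a * ((1 + x / y) powr a + (1 - x / y) powr a)
      \<le> y powr a * (2 - a * (1 - a) * (x / y)\<^sup>2)"
    by (intro mult_left_mono) auto
  moreover have "y powr a * (1 + x / y) powr a = (y + x) powr a"
    using x y by (subst powr_mult[symmetric]) (simp_all add: distrib_left right_diff_distrib)
  moreover have "y powr a * (1 - x / y) powr a = (y - x) powr a"
    using x y by (subst powr_mult[symmetric]) (simp_all add: distrib_left right_diff_distrib)
  moreover have "y powr a * (x / y)\<^sup>2 = y powr (a - 2) * x\<^sup>2"
    using y by (simp add: powr_diff power_divide powr_numeral)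
  ultimately show ?thesis
    by (simp add: algebra_simps)
qed

text \<open>Taylor formula with Lagrange remainder. For \<open>t\<close> at least
  \<open>-1/2\<close> one has \<open>(1 + t) powr (a - 3) \<le> 8\<close>, so the cubic coefficient
  is at most \<open>a * 2 * 8 / 6\<close>, which is below \<open>3 * a\<close>.\<close>

lemma powr_one_plus_le_cubic:
  fixes a x :: real
  assumes a: "0 < a" "a < 1" and x: "\<bar>x\<bar> \<le> 1/2"
  shows "(1 + x) powr a \<le> 1 + a * x - a * (1 - a) / 2 * x\<^sup>2 + 3 * a * \<bar>x\<bar> ^ 3"
proof (cases "x = 0")
  case False
  \<comment> \<open>The successive derivatives as one family indexed by order, in the form that
    \<open>Taylor\<close> expects; the last branch matters only for \<open>m = 3\<close>.\<close>
  define d where "d = (\<lambda>m::nat. \<lambda>t::real. if m = 0 then (1 + t) powr a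
     else if m = 1 then a * (1 + t) powr (a - 1)
     else if m = 2 then a * (a - 1) * (1 + t) powr (a - 2)
     else a * (a - 1) * (a - 2) * (1 + t) powr (a - 3))"
  have pd: "((\<lambda>t. c * (1 + t) powr b) has_real_derivative c * b * (1 + t) powr (b - 1)) (at t)"
    if "- (1/2) \<le> t" for c b t :: real
  proof -
    have "((\<lambda>t. (1 + t) powr b) has_real_derivative b * (1 + t) powr (b - 1)) (at t)"
      using that by (auto intro!: derivative_eq_intros)
    from DERIV_cmult[OF this, of c] show ?thesis
      by (simp add: mult.assoc)
  qed
  have d0: "d 0 = (\<lambda>t. (1 + t) powr a)" and d1: "d (Suc 0) = (\<lambda>t. a * (1 + t) powr (a - 1))"
    and d2: "d 2 = (\<lambda>t. a * (a - 1) * (1 + t) powr (a - 2))"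
    and d3: "d 3 = (\<lambda>t. a * (a - 1) * (a - 2) * (1 + t) powr (a - 3))"
    by (simp_all add: d_def)
  have der: "\<forall>m t. m < 3 \<and> - (1/2) \<le> t \<and> t \<le> 1/2 \<longrightarrow>
      (d m has_real_derivative d (Suc m) t) (at t)"
  proof (intro allI impI)
    fix m :: nat and t :: real
    assume m: "m < 3 \<and> - (1/2) \<le> t \<and> t \<le> 1/2"
    then have t: "- (1/2) \<le> t" by simp
    from m consider "m = 0" | "m = 1" | "m = 2" by linarith
    then show "(d m has_real_derivative d (Suc m) t) (at t)"
    proof cases
      case 1
      show ?thesis using pd[OF t, of 1 a] by (simp only: 1 d0 d1 mult_1)
    next
      case 2
      have "d (Suc m) = (\<lambda>t. a * (a - 1) * (1 + t) powr (a - 1 - 1))"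
        using 2 d2 by (simp add: numeral_2_eq_2)
      then show ?thesis using pd[OF t, of a "a - 1"] by (simp only: 2 One_nat_def d1)
    next
      case 3
      have "d (Suc m) = (\<lambda>t. a * (a - 1) * (a - 2) * (1 + t) powr (a - 2 - 1))"
        using 3 d3 by simp
      then show ?thesis using pd[OF t, of "a * (a - 1)" "a - 2"] by (simp only: 3 d2)
    qed
  qed
  have "\<exists>t. (if x < 0 then x < t \<and> t < 0 else 0 < t \<and> t < x) \<and>
      (1 + x) powr a = (\<Sum>m<3. d m 0 / fact m * (x - 0) ^ m) + d 3 t / fact 3 * (x - 0) ^ 3"
    by (rule Taylor[OF _ d0 der]) (use x False in \<open>simp_all add: abs_le_iff\<close>)
  then obtain t where t: "if x < 0 then x < t \<and> t < 0 else 0 < t \<and> t < x"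
    and eq: "(1 + x) powr a = (\<Sum>m<3. d m 0 / fact m * (x - 0) ^ m) + d 3 t / fact 3 * (x - 0) ^ 3"
    by blast
  have tb: "1/2 \<le> 1 + t"
    using t x by (auto split: if_splits)
  have "(1 + t) powr (a - 3) \<le> (1/2) powr (a - 3)"
    using tb a by (intro powr_mono2') auto
  also have "\<dots> \<le> (1/2) powr (-3)"
    using a by (intro powr_mono') auto
  also have "\<dots> = (8::real)"
    by (simp add: powr_minus powr_numeral power_divide)
  finally have p8: "(1 + t) powr (a - 3) \<le> 8" .
  have "d 3 t / fact 3 * x ^ 3 = (a * ((1 - a) * (2 - a)) * (1 + t) powr (a - 3) / 6) * x ^ 3"
    by (simp add: d3 fact_numeral algebra_simps)
  also have "\<dots> \<le> (a * ((1 - a) * (2 - a)) * (1 + t) powr (a - 3) / 6) * \<bar>x\<bar> ^ 3"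
    using a by (intro mult_left_mono) (auto simp: power_abs[symmetric])
  also have "\<dots> \<le> a * (1 * 2) * 8 / 6 * \<bar>x\<bar> ^ 3"
    using a p8 by (intro mult_right_mono divide_right_mono mult_mono) auto
  also have "\<dots> \<le> 3 * a * \<bar>x\<bar> ^ 3"
    using a by (intro mult_right_mono) auto
  finally have "d 3 t / fact 3 * x ^ 3 \<le> 3 * a * \<bar>x\<bar> ^ 3" .
  moreover have "(\<Sum>m<3. d m 0 / fact m * (x - 0) ^ m) = d 0 0 + d (Suc 0) 0 * x + d 2 0 / 2 * x\<^sup>2"
    by (simp add: lessThan_Suc numeral_3_eq_3 numeral_2_eq_2)
  moreover have "\<dots> = 1 + a * x - a * (1 - a) / 2 * x\<^sup>2"
    by (simp add: d0 d1 d2 field_simps)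
  ultimately show ?thesis
    using eq by simp
qed simp

text \<open>A Randers norm for \<open>s < 1\<close>: the Euclidean norm plus a linear form of length
  below 1. It is convex and positively homogeneous but not even, and its gradient at a nonzero
  \<open>v\<close> is \<open>sgn v - s *\<^sub>R e\<close>.\<close>

definition tilted_norm :: "real \<Rightarrow> 'a::real_inner \<Rightarrow> 'a \<Rightarrow> real" where
  "tilted_norm s e v = norm v - s * (v \<bullet> e)"

text \<open>Convexity: \<open>sgn z\<close> is a subgradient of the norm at \<open>z\<close>,
  including \<open>z = 0\<close> because \<open>sgn 0 = 0\<close>.\<close>

lemma norm_add_ge_inner:
  fixes z v :: "'a::real_inner"
  shows "norm z + sgn z \<bullet> v \<le> norm (z + v)"
proof (cases "z = 0")
  case False
  have "sgn z \<bullet> (z + v) \<le> norm (sgn z) * norm (z + v)"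
    by (rule norm_cauchy_schwarz)
  moreover have "sgn z \<bullet> z = norm z"
    using False by (simp add: sgn_div_norm dot_square_norm power2_eq_square)
  ultimately show ?thesis
    using False by (simp add: inner_add_right norm_sgn)
qed simp

lemma inner_square_le_norm_square:
  fixes z v :: "'a::real_inner"
  shows "(sgn z \<bullet> v)\<^sup>2 \<le> (norm v)\<^sup>2"
proof -
  have "\<bar>sgn z \<bullet> v\<bar> \<le> norm (sgn z) * norm v"
    by (rule Cauchy_Schwarz_ineq2)
  also have "\<dots> \<le> 1 * norm v"
    by (intro mult_right_mono) (auto simp: norm_sgn)
  finally show ?thesis
    by (simp add: abs_le_square_iff[symmetric])
qed

text \<open>Pythagoras splits \<open>norm (z + v)\<close> into the radial part \<open>c\<close> and
  the squared tangential part \<open>b\<close> of \<open>v\<close>; then the square root of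
  \<open>c^2 + b\<close> is at most \<open>c + b / (2 * c)\<close>. Only tangential displacements
  see the curvature of the norm.\<close>

lemma norm_add_le_expansion:
  fixes z v :: "'a::real_inner"
  assumes "norm v < norm z"
  shows "norm (z + v) \<le> norm z + sgn z \<bullet> v
      + ((norm v)\<^sup>2 - (sgn z \<bullet> v)\<^sup>2) / (2 * (norm z - norm v))"
proof -
  define c b where "c = norm z + sgn z \<bullet> v" and "b = (norm v)\<^sup>2 - (sgn z \<bullet> v)\<^sup>2"
  have z: "z \<noteq> 0"
    using assms by auto
  have b: "0 \<le> b"
    using inner_square_le_norm_square[of z v] by (simp add: b_def)
  have "\<bar>sgn z \<bullet> v\<bar> \<le> norm v"
    using inner_square_le_norm_square[of z v] by (simp add: abs_le_square_iff[symmetric])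
  then have c: "0 < norm z - norm v" "norm z - norm v \<le> c"
    using assms by (auto simp: c_def)
  have zv: "z \<bullet> v = norm z * (sgn z \<bullet> v)"
    using z by (simp add: sgn_div_norm)
  have "(norm (z + v))\<^sup>2 = (norm z)\<^sup>2 + 2 * (z \<bullet> v) + (norm v)\<^sup>2"
    unfolding power2_norm_eq_inner by (simp add: inner_simps inner_commute)
  also have "\<dots> = c\<^sup>2 + b"
    by (simp add: c_def b_def zv power2_sum)
  finally have "(norm (z + v))\<^sup>2 = c\<^sup>2 + b" .
  also have "\<dots> \<le> (c + b / (2 * c))\<^sup>2"
  proof -
    have "(c + b / (2 * c))\<^sup>2 = c\<^sup>2 + b + (b / (2 * c))\<^sup>2"
      using c by (simp add: power2_sum)
    then show ?thesis
      by simp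
  qed
  finally have "norm (z + v) \<le> c + b / (2 * c)"
    by (rule power2_le_imp_le) (use c b in auto)
  also have "b / (2 * c) \<le> b / (2 * (norm z - norm v))"
    using c b by (intro divide_left_mono) auto
  finally show ?thesis
    by (simp add: c_def b_def)
qed

lemma tilted_norm_bounds:
  assumes "0 \<le> s" "s \<le> 1" "norm e = 1"
  shows "(1 - s) * norm v \<le> tilted_norm s e v" "tilted_norm s e v \<le> (1 + s) * norm v"
    "0 \<le> tilted_norm s e v"
proof -
  have "\<bar>v \<bullet> e\<bar> \<le> norm v"
    using Cauchy_Schwarz_ineq2[of v e] assms by simp
  then have *: "\<bar>s * (v \<bullet> e)\<bar> \<le> s * norm v"
    using assms by (simp add: abs_mult mult_left_mono)
  then show "(1 - s) * norm v \<le> tilted_norm s e v" "tilted_norm s e v \<le> (1 + s) * norm v"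
    unfolding tilted_norm_def left_diff_distrib distrib_right by linarith+
  moreover have "0 \<le> (1 - s) * norm v"
    using assms by simp
  ultimately show "0 \<le> tilted_norm s e v"
    by linarith
qed

lemma tilted_norm_lipschitz:
  assumes "0 \<le> s" "s \<le> 1" "norm e = 1"
  shows "tilted_norm s e (v + w) \<le> tilted_norm s e v + 2 * norm w"
proof -
  have "\<bar>s * (w \<bullet> e)\<bar> \<le> 1 * norm w"
    using Cauchy_Schwarz_ineq2[of w e] assms unfolding abs_mult by (intro mult_mono) auto
  then show ?thesis
    using norm_triangle_ineq[of v w] by (simp add: tilted_norm_def inner_add_left algebra_simps)
qed

lemma tilted_norm_scaleR:
  assumes "0 \<le> c"
  shows "tilted_norm s e (c *\<^sub>R v) = c * tilted_norm s e v"
  using assms by (simp add: tilted_norm_def algebra_simps)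

lemma norm_tilted_gradient:
  fixes z e :: "'a::real_inner"
  assumes "0 \<le> s" "norm e = 1" "z \<noteq> 0"
  shows "1 - s \<le> norm (sgn z - s *\<^sub>R e)" "norm (sgn z - s *\<^sub>R e) \<le> 1 + s"
proof -
  show "1 - s \<le> norm (sgn z - s *\<^sub>R e)"
    using norm_triangle_ineq2[of "sgn z" "s *\<^sub>R e"] assms by (simp add: norm_sgn)
  show "norm (sgn z - s *\<^sub>R e) \<le> 1 + s"
    using norm_triangle_ineq4[of "sgn z" "s *\<^sub>R e"] assms by (simp add: norm_sgn)
qed

lemma tilted_norm_add_le:
  fixes z u :: "'a::real_inner"
  assumes "norm u < norm z"
  shows "tilted_norm s e (z + u) \<le> tilted_norm s e z + (sgn z - s *\<^sub>R e) \<bullet> u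
      + ((norm u)\<^sup>2 - (sgn z \<bullet> u)\<^sup>2) / (2 * (norm z - norm u))"
  using norm_add_le_expansion[OF assms]
  by (simp add: tilted_norm_def inner_simps inner_commute algebra_simps)

lemma tilted_norm_add_ge:
  fixes z u :: "'a::real_inner"
  shows "tilted_norm s e z + (sgn z - s *\<^sub>R e) \<bullet> u \<le> tilted_norm s e (z + u)"
  using norm_add_ge_inner[of z u]
  by (simp add: tilted_norm_def inner_simps inner_commute algebra_simps)

lemma norm_square_perp:
  fixes z u :: "'a::real_inner"
  assumes "norm z = 1"
  shows "(norm u)\<^sup>2 - (z \<bullet> u)\<^sup>2 = (norm (u - (z \<bullet> u) *\<^sub>R z))\<^sup>2"
  using assms unfolding power2_norm_eq_inner
  by (simp add: inner_simps inner_commute power2_eq_square norm_eq_1)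

lemma norm_perp_le:
  fixes z u :: "'a::real_inner"
  assumes "norm z = 1"
  shows "(norm (u - (z \<bullet> u) *\<^sub>R z))\<^sup>2 \<le> (norm u)\<^sup>2"
  using norm_square_perp[OF assms, of u] zero_le_power2[of "z \<bullet> u"] by linarith

text \<open>The tangential part of the gradient comes from the tilt alone and has length at most
  \<open>s\<close>, while the gradient has length at least 1/2. So the steepest direction is radial
  up to \<open>2 * s\<close>, and the curvature met along it is of order \<open>s^2\<close>.\<close>

lemma perp_square_steepest:
  fixes z e :: "'a::real_inner"
  assumes s: "0 \<le> s" "s \<le> 1/2" and e: "norm e = 1" and z: "z \<noteq> 0"
    and \<nu>: "\<nu> = sgn (sgn z - s *\<^sub>R e)"
  shows "(norm (\<nu> - (sgn z \<bullet> \<nu>) *\<^sub>R sgn z))\<^sup>2 \<le> 4 * s\<^sup>2"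
proof -
  define n where "n = sgn z - s *\<^sub>R e"
  define P where "P u = u - (sgn z \<bullet> u) *\<^sub>R sgn z" for u
  have z1: "norm (sgn z) = 1"
    using z by (simp add: norm_sgn)
  have n: "1/2 \<le> norm n"
    using norm_tilted_gradient(1)[of s e z] s e z by (simp add: n_def)
  have "P n = - (s *\<^sub>R P e)"
    using z1 by (simp add: P_def n_def inner_simps norm_eq_1 algebra_simps)
  moreover have "(norm (P e))\<^sup>2 \<le> 1"
    using norm_perp_le[OF z1, of e] e by (simp add: P_def)
  ultimately have Pn: "(norm (P n))\<^sup>2 \<le> s\<^sup>2"
    by (simp add: power_mult_distrib mult_left_le)
  have "\<nu> = (1 / norm n) *\<^sub>R n"
    unfolding \<nu> n_def[symmetric] by (simp add: sgn_div_norm divide_inverse)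
  then have "P \<nu> = (1 / norm n) *\<^sub>R P n"
    by (simp add: P_def algebra_simps)
  then have "(norm (P \<nu>))\<^sup>2 = (norm (P n))\<^sup>2 / (norm n)\<^sup>2"
    by (simp add: power_divide)
  also have "\<dots> \<le> s\<^sup>2 / (1/2)\<^sup>2"
    by (rule frac_le[OF _ Pn _ power_mono[OF n]]) auto
  finally show ?thesis
    by (simp add: P_def power_divide)
qed

text \<open>Write \<open>u\<close> as the steepest step plus a deviation \<open>t\<close>. The
  constraint \<open>norm u \<le> r\<close> makes the deviation cost at least
  \<open>2 * (norm t)^2\<close> in the linear term, where \<open>r \<le> 1/8\<close> enters, and
  this pays for the curvature caused by \<open>t\<close>. What remains is the curvature along the
  steepest direction.\<close>

lemma tilted_norm_max:
  fixes z u e :: "'a::real_inner"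
  assumes s: "0 \<le> s" "s \<le> 1/2" and e: "norm e = 1"
    and z: "3/4 \<le> norm z" and r: "0 < r" "r \<le> 1/8" and u: "norm u \<le> r"
  shows "tilted_norm s e (z + u) \<le> tilted_norm s e z + r * norm (sgn z - s *\<^sub>R e) + 8 * s\<^sup>2 * r\<^sup>2"
proof -
  define n where "n = sgn z - s *\<^sub>R e"
  define \<nu> where "\<nu> = sgn n"
  define t where "t = u - r *\<^sub>R \<nu>"
  define P where "P x = x - (sgn z \<bullet> x) *\<^sub>R sgn z" for x
  have z0: "z \<noteq> 0" using z by auto
  then have z1: "norm (sgn z) = 1"
    by (simp add: norm_sgn)
  have n: "1/2 \<le> norm n"
    using norm_tilted_gradient(1)[of s e z] s e z0 by (simp add: n_def)
  then have n0: "norm n \<noteq> 0"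
    by linarith
  then have \<nu>1: "norm \<nu> = 1" and n_eq: "n = norm n *\<^sub>R \<nu>"
    by (simp_all add: \<nu>_def norm_sgn sgn_div_norm)
  have "(norm t)\<^sup>2 = (norm u)\<^sup>2 - 2 * r * (\<nu> \<bullet> u) + r\<^sup>2"
    using \<nu>1 unfolding power2_norm_eq_inner
    by (simp add: t_def inner_simps inner_commute norm_eq_1 power2_eq_square)
  also have "\<dots> \<le> r\<^sup>2 - 2 * r * (\<nu> \<bullet> u) + r\<^sup>2"
    using u by (simp add: power_mono)
  finally have "\<nu> \<bullet> u \<le> r - (norm t)\<^sup>2 / (2 * r)"
    using r by (simp add: field_simps power2_eq_square)
  then have "norm n * (\<nu> \<bullet> u) \<le> norm n * (r - (norm t)\<^sup>2 / (2 * r))"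
    by (intro mult_left_mono) auto
  also have "\<dots> = r * norm n - norm n * ((norm t)\<^sup>2 / (2 * r))"
    by (simp add: algebra_simps)
  also have "\<dots> \<le> r * norm n - (1/2) * ((norm t)\<^sup>2 / (2 * (1/8)))"
    using n r by (intro diff_left_mono mult_mono divide_left_mono) auto
  finally have nu: "n \<bullet> u \<le> r * norm n - 2 * (norm t)\<^sup>2"
    by (subst n_eq) simp
  have u_eq: "P u = P t + r *\<^sub>R P \<nu>"
    by (simp add: P_def t_def algebra_simps)
  have "(norm (P u))\<^sup>2 \<le> (norm (P t) + norm (r *\<^sub>R P \<nu>))\<^sup>2"
    unfolding u_eq by (intro power_mono norm_triangle_ineq) auto
  also have "\<dots> \<le> 2 * (norm (P t))\<^sup>2 + 2 * (norm (r *\<^sub>R P \<nu>))\<^sup>2"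
    using sum_squares_bound[of "norm (P t)" "norm (r *\<^sub>R P \<nu>)"] by (simp add: power2_sum)
  also have "\<dots> \<le> 2 * (norm t)\<^sup>2 + 2 * (r\<^sup>2 * (4 * s\<^sup>2))"
    using norm_perp_le[OF z1, of t]
      perp_square_steepest[OF s e z0, of \<nu>]
    by (intro add_mono mult_left_mono)
       (auto simp: P_def \<nu>_def n_def power_mult_distrib intro!: mult_left_mono)
  finally have Pu: "(norm u)\<^sup>2 - (sgn z \<bullet> u)\<^sup>2 \<le> 2 * (norm t)\<^sup>2 + 8 * s\<^sup>2 * r\<^sup>2"
    using norm_square_perp[OF z1, of u] by (simp add: P_def mult_ac)
  have uz: "norm u < norm z" "1 \<le> 2 * (norm z - norm u)"
    using u r z by auto
  have "((norm u)\<^sup>2 - (sgn z \<bullet> u)\<^sup>2) / (2 * (norm z - norm u)) \<le> ((norm u)\<^sup>2 - (sgn z \<bullet> u)\<^sup>2) / 1"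
    using uz inner_square_le_norm_square[of z u] by (intro divide_left_mono) auto
  then show ?thesis
    using tilted_norm_add_le[OF uz(1), of s e] nu Pu by (simp add: n_def)
qed

text \<open>The counterpart for the minimum, with the same slope and the same error as for the
  maximum, so that the two bounds lie symmetrically around one centre.\<close>

lemma tilted_norm_steepest_descent:
  fixes z e :: "'a::real_inner"
  assumes s: "0 \<le> s" "s \<le> 1/2" and e: "norm e = 1"
    and z: "3/4 \<le> norm z" and r: "0 < r" "r \<le> 1/8"
  shows "tilted_norm s e (z - r *\<^sub>R sgn (sgn z - s *\<^sub>R e))
     \<le> tilted_norm s e z - r * norm (sgn z - s *\<^sub>R e) + 8 * s\<^sup>2 * r\<^sup>2"
proof -
  define n where "n = sgn z - s *\<^sub>R e"
  define \<nu> where "\<nu> = sgn n"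
  define u where "u = - (r *\<^sub>R \<nu>)"
  have z0: "z \<noteq> 0" using z by auto
  then have z1: "norm (sgn z) = 1"
    by (simp add: norm_sgn)
  have n: "1/2 \<le> norm n"
    using norm_tilted_gradient(1)[of s e z] s e z0 by (simp add: n_def)
  then have n0: "norm n \<noteq> 0"
    by linarith
  then have \<nu>1: "norm \<nu> = 1" and n_eq: "n = norm n *\<^sub>R \<nu>"
    by (simp_all add: \<nu>_def norm_sgn sgn_div_norm)
  have ur: "norm u = r"
    using \<nu>1 r by (simp add: u_def)
  have "\<nu> \<bullet> \<nu> = 1"
    using \<nu>1 by (simp add: norm_eq_1)
  then have "n \<bullet> u = - (r * norm n)"
    by (subst n_eq) (simp add: u_def)
  have "u - (sgn z \<bullet> u) *\<^sub>R sgn z = - (r *\<^sub>R (\<nu> - (sgn z \<bullet> \<nu>) *\<^sub>R sgn z))"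
    by (simp add: u_def algebra_simps)
  then have "(norm u)\<^sup>2 - (sgn z \<bullet> u)\<^sup>2 = r\<^sup>2 * (norm (\<nu> - (sgn z \<bullet> \<nu>) *\<^sub>R sgn z))\<^sup>2"
    unfolding norm_square_perp[OF z1] by (simp add: power_mult_distrib)
  also have "\<dots> \<le> r\<^sup>2 * (4 * s\<^sup>2)"
    using perp_square_steepest[OF s e z0, of \<nu>] by (intro mult_left_mono) (auto simp: \<nu>_def n_def)
  finally have Pu: "(norm u)\<^sup>2 - (sgn z \<bullet> u)\<^sup>2 \<le> 4 * s\<^sup>2 * r\<^sup>2"
    by (simp add: mult_ac)
  have uz: "norm u < norm z" "1 \<le> 2 * (norm z - norm u)"
    using ur r z by auto
  have "((norm u)\<^sup>2 - (sgn z \<bullet> u)\<^sup>2) / (2 * (norm z - norm u)) \<le> ((norm u)\<^sup>2 - (sgn z \<bullet> u)\<^sup>2) / 1"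
    using uz inner_square_le_norm_square[of z u] by (intro divide_left_mono) auto
  then have "tilted_norm s e (z + u) \<le> tilted_norm s e z - r * norm n + 4 * s\<^sup>2 * r\<^sup>2"
    using tilted_norm_add_le[OF uz(1), of s e] \<open>n \<bullet> u = _\<close> Pu by (simp add: n_def)
  moreover have "4 * s\<^sup>2 * r\<^sup>2 \<le> 8 * s\<^sup>2 * r\<^sup>2"
    by (intro mult_right_mono) auto
  ultimately have "tilted_norm s e (z + u) \<le> tilted_norm s e z - r * norm n + 8 * s\<^sup>2 * r\<^sup>2"
    by linarith
  then show ?thesis
    by (simp add: u_def \<nu>_def n_def)
qed


text \<open>The coefficient of the linear term is kept exact, since that term has size
  \<open>\<epsilon>\<close> and an error \<open>s * \<epsilon>\<close> would be too large. All
  second order coefficients are replaced by their values at \<open>s = 0\<close>; this costs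
  \<open>s * \<epsilon>^2\<close>, as does the cubic remainder because
  \<open>\<epsilon> \<le> s\<close>.\<close>

lemma tilted_norm_powr_taylor:
  fixes z v e :: "'a::real_inner"
  assumes a: "0 < a" "a < 1" and s: "0 < s" "s \<le> 1/8" and e: "norm e = 1"
    and z: "norm z = 1" and v: "norm v \<le> \<epsilon>" "\<epsilon> \<le> s"
  shows "tilted_norm s e (z + v) powr a
    \<le> tilted_norm s e z powr a + a * (tilted_norm s e z powr (a - 1) * ((z - s *\<^sub>R e) \<bullet> v)
        + ((norm v)\<^sup>2 - (2 - a) * (z \<bullet> v)\<^sup>2) / 2 + 100 * s * \<epsilon>\<^sup>2)"
proof -
  define N where "N = tilted_norm s e z"
  define D where "D = tilted_norm s e (z + v) - N"
  define l where "l = (z - s *\<^sub>R e) \<bullet> v"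
  define q where "q = (norm v)\<^sup>2 - (z \<bullet> v)\<^sup>2"
  define x where "x = z \<bullet> v"
  have \<epsilon>: "0 \<le> \<epsilon>" "\<epsilon> \<le> 1/8"
    using v s norm_ge_zero[of v] by linarith+
  have sz: "sgn z = z"
    using z by (simp add: sgn_div_norm)
  have N: "1 - s \<le> N" "N \<le> 1 + s"
    using tilted_norm_bounds[of s e z] s e z by (simp_all add: N_def)
  have q: "0 \<le> q" "q \<le> \<epsilon>\<^sup>2"
    using inner_square_le_norm_square[of z v] power_mono[OF v(1), of 2] zero_le_power2[of "z \<bullet> v"]
    unfolding q_def sz by (simp, metis norm_ge_zero diff_le_eq le_add_same_cancel1 order_trans)
  have x: "\<bar>x\<bar> \<le> \<epsilon>"
    using Cauchy_Schwarz_ineq2[of z v] z v by (simp add: x_def)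
  have lx: "\<bar>l - x\<bar> \<le> s * \<epsilon>"
  proof -
    have "\<bar>e \<bullet> v\<bar> \<le> \<epsilon>"
      using Cauchy_Schwarz_ineq2[of e v] e v by simp
    then show ?thesis
      using s by (simp add: l_def x_def inner_simps abs_mult mult_left_mono)
  qed
  have D1: "l \<le> D"
    using tilted_norm_add_ge[of s e z v] by (simp add: D_def N_def l_def sz)
  have vz: "norm v < norm z" "0 < norm z - norm v" "1 - \<epsilon> \<le> norm z - norm v"
    using v \<epsilon> z by auto
  have "D \<le> l + q / (2 * (norm z - norm v))"
    using tilted_norm_add_le[OF vz(1), of s e] by (simp add: D_def N_def l_def sz q_def)
  also have "q / (2 * (norm z - norm v)) \<le> q / (2 * (1 - \<epsilon>))"
    using vz \<epsilon> q by (intro divide_left_mono) auto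
  finally have D2: "D \<le> l + q / (2 * (1 - \<epsilon>))"
    by simp
  have "q / (2 * (1 - \<epsilon>)) \<le> \<epsilon>\<^sup>2 / 1"
    using q \<epsilon> by (intro frac_le) auto
  also have "\<dots> \<le> s * \<epsilon>"
    using v \<epsilon> by (simp add: power2_eq_square mult_right_mono)
  finally have Dx: "\<bar>D - x\<bar> \<le> 2 * s * \<epsilon>"
    using D1 D2 lx by linarith
  have "2 * s * \<epsilon> \<le> 2 * (1/8) * \<epsilon>"
    using s \<epsilon> by (intro mult_right_mono mult_left_mono) auto
  then have D\<epsilon>: "\<bar>D\<bar> \<le> 2 * \<epsilon>"
    using Dx x \<epsilon> by linarith
  have N0: "0 < N" "7/8 \<le> N" "N \<le> 9/8"
    using N s by auto
  have DN: "\<bar>D / N\<bar> \<le> 1/2"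
    using D\<epsilon> \<epsilon> N0 by (simp add: divide_le_eq)
  have D2x: "x\<^sup>2 - 4 * s * \<epsilon>\<^sup>2 \<le> D\<^sup>2"
  proof -
    have "2 * x * (D - x) \<ge> - (2 * \<epsilon> * (2 * s * \<epsilon>))"
    proof -
      have "\<bar>2 * x * (D - x)\<bar> \<le> 2 * \<epsilon> * (2 * s * \<epsilon>)"
        unfolding abs_mult using x Dx \<epsilon> by (intro mult_mono) auto
      then show ?thesis by linarith
    qed
    moreover have "D\<^sup>2 = x\<^sup>2 + 2 * x * (D - x) + (D - x)\<^sup>2"
      by (simp add: power2_eq_square algebra_simps)
    moreover have "2 * \<epsilon> * (2 * s * \<epsilon>) = 4 * s * \<epsilon>\<^sup>2"
      by (simp add: power2_eq_square)
    ultimately show ?thesis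
      using zero_le_power2[of "D - x"] by linarith
  qed
  have D2b: "D\<^sup>2 \<le> 4 * \<epsilon>\<^sup>2"
    using power_mono[OF D\<epsilon>, of 2] by (simp add: power_mult_distrib)
  have Npow: "N powr (a - 1) \<le> 1 + 2 * s" "1 - 2 * s \<le> N powr (a - 2)" "N powr (a - 3) \<le> 2"
  proof -
    have "N powr (a - 1) \<le> (1 - s) powr (a - 1)"
      using N s a by (intro powr_mono2') auto
    also have "\<dots> \<le> (1 - s) powr (-1)"
      using s a by (intro powr_mono') auto
    also have "\<dots> = 1 / (1 - s)"
      using s by (simp add: powr_minus_divide)
    also have "\<dots> \<le> 1 + 2 * s"
      using s by (simp add: divide_le_eq algebra_simps)
    finally show "N powr (a - 1) \<le> 1 + 2 * s" .
    have "1 - 2 * s \<le> 1 / (1 + s)\<^sup>2"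
    proof -
      have "(1 - 2 * s) * (1 + s)\<^sup>2 = 1 - (3 * s\<^sup>2 + 2 * s ^ 3)"
        by (simp add: power2_eq_square power3_eq_cube algebra_simps)
      moreover have "0 \<le> 3 * s\<^sup>2 + 2 * s ^ 3"
        using s by simp
      ultimately show ?thesis
        using s by (subst pos_le_divide_eq) (simp, linarith)
    qed
    also have "\<dots> = (1 + s) powr (-2)"
      using s by (simp add: powr_minus_divide powr_numeral)
    also have "\<dots> \<le> (1 + s) powr (a - 2)"
      using s a by (intro powr_mono) auto
    also have "\<dots> \<le> N powr (a - 2)"
      using N N0 s a by (intro powr_mono2') auto
    finally show "1 - 2 * s \<le> N powr (a - 2)" .
    have "N powr (a - 3) \<le> (7/8) powr (a - 3)"
      using N0 a by (intro powr_mono2') auto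
    also have "\<dots> \<le> (7/8) powr (-3)"
      using a by (intro powr_mono') auto
    also have "\<dots> \<le> (2::real)"
      by (simp add: powr_minus_divide powr_numeral power_divide)
    finally show "N powr (a - 3) \<le> 2" .
  qed
  have "tilted_norm s e (z + v) powr a = (N * (1 + D / N)) powr a"
    using N0 by (simp add: D_def distrib_left)
  also have "\<dots> = N powr a * (1 + D / N) powr a"
    using N0 DN by (subst powr_mult) auto
  also have "\<dots> \<le> N powr a * (1 + a * (D / N) - a * (1 - a) / 2 * (D / N)\<^sup>2 + 3 * a * \<bar>D / N\<bar> ^ 3)"
    using powr_one_plus_le_cubic[OF a DN] by (intro mult_left_mono) auto
  also have "\<dots> = N powr a + a * (N powr (a - 1) * D - (1 - a) / 2 * (N powr (a - 2) * D\<^sup>2)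
      + 3 * (N powr (a - 3) * \<bar>D\<bar> ^ 3))"
    using N0 by (simp add: powr_diff powr_numeral power_divide algebra_simps)
  also have "\<dots> \<le> N powr a + a * (N powr (a - 1) * l + (q / 2 + 4 * s * \<epsilon>\<^sup>2)
      - (1 - a) / 2 * (x\<^sup>2 - 12 * s * \<epsilon>\<^sup>2) + 48 * s * \<epsilon>\<^sup>2)"
  proof -
    have "N powr (a - 1) * D \<le> N powr (a - 1) * (l + q / (2 * (1 - \<epsilon>)))"
      using D2 by (intro mult_left_mono) auto
    also have "\<dots> = N powr (a - 1) * l + N powr (a - 1) * (q / (2 * (1 - \<epsilon>)))"
      by (simp add: distrib_left)
    also have "N powr (a - 1) * (q / (2 * (1 - \<epsilon>))) \<le> (1 + 2 * s) * ((1 + 2 * s) * q / 2)"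
    proof (intro mult_mono Npow)
      have "1 / (1 - \<epsilon>) \<le> 1 + 2 * \<epsilon>"
      proof -
        have "\<epsilon> * (2 * \<epsilon>) \<le> \<epsilon> * 1"
          using \<epsilon> by (intro mult_left_mono) auto
        then show ?thesis
          using \<epsilon> by (simp add: divide_le_eq algebra_simps)
      qed
      then have "q / 2 * (1 / (1 - \<epsilon>)) \<le> q / 2 * (1 + 2 * s)"
        using q v by (intro mult_left_mono) auto
      then show "q / (2 * (1 - \<epsilon>)) \<le> (1 + 2 * s) * q / 2"
        by (simp add: mult_ac)
    qed (use q s \<epsilon> in auto)
    also have "\<dots> = q / 2 + (2 * s + 2 * s * s) * q"
      by (simp add: algebra_simps)
    also have "\<dots> \<le> q / 2 + (4 * s) * \<epsilon>\<^sup>2"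
    proof -
      have "2 * s * s \<le> 2 * s * 1"
        using s by (intro mult_left_mono) auto
      then show ?thesis
        using q s by (intro add_left_mono mult_mono) auto
    qed
    finally have A: "N powr (a - 1) * D \<le> N powr (a - 1) * l + (q / 2 + 4 * s * \<epsilon>\<^sup>2)"
      by simp
    have "(1 - 2 * s) * D\<^sup>2 \<le> N powr (a - 2) * D\<^sup>2"
      using Npow by (intro mult_right_mono) auto
    moreover have "(1 - 2 * s) * D\<^sup>2 = D\<^sup>2 - 2 * s * D\<^sup>2"
      by (simp add: algebra_simps)
    moreover have "2 * s * D\<^sup>2 \<le> 2 * s * (4 * \<epsilon>\<^sup>2)"
      using D2b s by (intro mult_left_mono) auto
    ultimately have "x\<^sup>2 - 12 * s * \<epsilon>\<^sup>2 \<le> N powr (a - 2) * D\<^sup>2"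
      using D2x by simp
    then have B: "(1 - a) / 2 * (x\<^sup>2 - 12 * s * \<epsilon>\<^sup>2) \<le> (1 - a) / 2 * (N powr (a - 2) * D\<^sup>2)"
      using a by (intro mult_left_mono) auto
    have "\<bar>D\<bar> ^ 3 \<le> (2 * \<epsilon>) ^ 3"
      using D\<epsilon> by (intro power_mono) auto
    also have "\<dots> = 8 * \<epsilon> * \<epsilon>\<^sup>2"
      by (simp add: power3_eq_cube power2_eq_square)
    also have "\<dots> \<le> 8 * s * \<epsilon>\<^sup>2"
      using v by (intro mult_right_mono) auto
    finally have "N powr (a - 3) * \<bar>D\<bar> ^ 3 \<le> 2 * (8 * s * \<epsilon>\<^sup>2)"
      using Npow by (intro mult_mono) auto
    then have C: "3 * (N powr (a - 3) * \<bar>D\<bar> ^ 3) \<le> 48 * s * \<epsilon>\<^sup>2"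
      by linarith
    show ?thesis
      using A B C a by (intro add_left_mono mult_left_mono) linarith+
  qed
  also have "\<dots> \<le> N powr a + a * (N powr (a - 1) * l
        + ((norm v)\<^sup>2 - (2 - a) * x\<^sup>2) / 2 + 100 * s * \<epsilon>\<^sup>2)"
  proof -
    have "(1 - a) / 2 * (12 * s * \<epsilon>\<^sup>2) \<le> 1 / 2 * (12 * s * \<epsilon>\<^sup>2)"
      using a s by (intro mult_right_mono) auto
    moreover have "0 \<le> s * \<epsilon>\<^sup>2"
      using s by simp
    moreover have "q / 2 - (1 - a) / 2 * (x\<^sup>2 - 12 * s * \<epsilon>\<^sup>2)
        = ((norm v)\<^sup>2 - (2 - a) * x\<^sup>2) / 2 + (1 - a) / 2 * (12 * s * \<epsilon>\<^sup>2)"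
      by (simp add: q_def x_def field_simps)
    ultimately show ?thesis
      using a by (intro add_left_mono mult_left_mono) linarith+
  qed
  finally show ?thesis
    by (simp add: N_def l_def x_def)
qed

lemma powr_add_le_tangent:
  fixes a x y :: real
  assumes "0 < a" "a < 1" "0 < x" "0 \<le> y"
  shows "(x + y) powr a \<le> x powr a + a * y * x powr (a - 1)"
proof -
  \<comment> \<open>Concavity in the form of Young's inequality with second factor 1.\<close>
  have "(1 + y / x) powr a * 1 powr (1 - a) \<le> a * (1 + y / x) + (1 - a) * 1"
    using assms by (intro Youngs_inequality_0) (auto intro!: add_pos_nonneg)
  then have "(1 + y / x) powr a \<le> 1 + a * (y / x)"
    by (simp add: algebra_simps)
  then have "x powr a * (1 + y / x) powr a \<le> x powr a * (1 + a * (y / x))"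
    by (intro mult_left_mono) auto
  moreover have "x powr a * (1 + y / x) powr a = (x + y) powr a"
    using assms by (subst powr_mult[symmetric]) (simp_all add: distrib_left)
  moreover have "x powr a * (1 + a * (y / x)) = x powr a + a * y * x powr (a - 1)"
    using assms by (simp add: powr_diff distrib_left)
  ultimately show ?thesis
    by simp
qed

text \<open>One summand of the operator, scaled so that the point has distance 1 from the pole:
  \<open>v\<close> leads to a cloud point, \<open>u\<close> from there to a maximiser, and
  \<open>m\<close> stands for the minimum. The slack \<open>s^2 * \<epsilon>^2\<close> in
  \<open>m\<close> is for discreteness, since the cloud need not contain the exact minimiser; the
  maximum over the cloud needs no such slack.\<close>

lemma tilted_norm_powr_step_unit:
  fixes z v u e :: "'a::real_inner"
  assumes a: "0 < a" "a < 1" and s: "0 < s" "s \<le> 1/8" and e: "norm e = 1"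
    and z: "norm z = 1" and v: "norm v \<le> \<epsilon>" "\<epsilon> \<le> s" and \<epsilon>0: "0 < \<epsilon>"
    and k: "0 < k" "k * \<epsilon> \<le> s" and u: "norm u \<le> k * \<epsilon>"
    and m: "0 \<le> m" "m \<le> tilted_norm s e (z + v - (k * \<epsilon>) *\<^sub>R sgn (sgn (z + v) - s *\<^sub>R e)) + s\<^sup>2 * \<epsilon>\<^sup>2"
  shows "tilted_norm s e (z + v + u) powr a + m powr a
    \<le> 2 * tilted_norm s e z powr a + a * (2 * tilted_norm s e z powr (a - 1) * ((z - s *\<^sub>R e) \<bullet> v)
        + (norm v)\<^sup>2 - (2 - a) * (z \<bullet> v)\<^sup>2 - (1 - a) * k\<^sup>2 * \<epsilon>\<^sup>2 + (204 + 50 * k\<^sup>2) * s * \<epsilon>\<^sup>2)"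
proof -
  define r where "r = k * \<epsilon>"
  define w where "w = z + v"
  define N where "N = tilted_norm s e w"
  define g where "g = norm (sgn w - s *\<^sub>R e)"
  define \<kappa> where "\<kappa> = 8 * s\<^sup>2 * r\<^sup>2 + s\<^sup>2 * \<epsilon>\<^sup>2"
  \<comment> \<open>A common centre: with \<open>\<kappa>\<close> added, maximum and minimum are at
    most \<open>y + r * g\<close> and \<open>y - r * g\<close>, which is what
    \<open>powr_symmetric_sum\<close> needs.\<close>
  define y where "y = N + \<kappa>"
  have r: "0 < r" "r \<le> 1/8"
    using k s \<epsilon>0 by (auto simp: r_def)
  have w: "7/8 \<le> norm w" "norm w \<le> 1 + s" "w \<noteq> 0"
    using norm_diff_ineq[of z v] norm_triangle_ineq[of z v] z v s
    by (auto simp: w_def)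
  have s2: "0 \<le> s" "s \<le> 1/2" "s \<le> 1"
    using s by auto
  have g: "1 - s \<le> g" "g \<le> 1 + s"
    using norm_tilted_gradient[of s e w] s e w by (auto simp: g_def)
  have "(1 - s) * norm w \<ge> (7/8) * (7/8)"
    using s w by (intro mult_mono) auto
  then have N1: "1/2 \<le> N"
    using tilted_norm_bounds(1)[of s e w] s e by (simp add: N_def)
  have "(1 + s) * norm w \<le> (1 + s) * (1 + s)"
    using s w by (intro mult_mono) auto
  also have "\<dots> \<le> 1 + 3 * s"
    using s by (simp add: algebra_simps)
  finally have N2: "N \<le> 1 + 3 * s"
    using tilted_norm_bounds(2)[of s e w] s e by (simp add: N_def)
  have \<kappa>_eq: "\<kappa> = s\<^sup>2 * (8 * r\<^sup>2 + \<epsilon>\<^sup>2)"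
    by (simp add: \<kappa>_def algebra_simps)
  have "r\<^sup>2 \<le> (1/8)\<^sup>2" "\<epsilon>\<^sup>2 \<le> (1/8)\<^sup>2"
    using r v \<epsilon>0 s by (intro power_mono; simp)+
  then have "s\<^sup>2 * (8 * r\<^sup>2 + \<epsilon>\<^sup>2) \<le> s\<^sup>2 * 1"
    by (intro mult_left_mono) (auto simp: power_divide)
  also have "\<dots> \<le> s"
    using s by (simp add: power2_eq_square mult_left_le)
  finally have \<kappa>: "0 \<le> \<kappa>" "\<kappa> \<le> s"
    unfolding \<kappa>_eq by auto
  have y: "1/2 \<le> y" "y \<le> 1 + 4 * s"
    using N1 N2 \<kappa> by (auto simp: y_def)
  have rg: "0 \<le> r * g" "r * g < y"
  proof -
    have "r * g \<le> (1/8) * 2"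
      using r g s by (intro mult_mono) auto
    then show "r * g < y"
      using y by simp
  qed (use r g s in auto)
  have "tilted_norm s e (w + u) \<le> N + r * g + 8 * s\<^sup>2 * r\<^sup>2"
    using tilted_norm_max[OF s2(1,2) e _ r, of w u] w u by (simp add: N_def g_def r_def)
  moreover have "0 \<le> s\<^sup>2 * \<epsilon>\<^sup>2"
    by simp
  ultimately have "tilted_norm s e (w + u) \<le> y + r * g"
    unfolding y_def \<kappa>_def by linarith
  then have M1: "tilted_norm s e (w + u) powr a \<le> (y + r * g) powr a"
    using a tilted_norm_bounds(3)[OF s2(1,3) e] by (intro powr_mono2) auto
  have "m \<le> y - r * g"
    using tilted_norm_steepest_descent[OF s2(1,2) e _ r, of w] w m(2)
    by (simp add: N_def g_def r_def w_def y_def \<kappa>_def)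
  then have M2: "m powr a \<le> (y - r * g) powr a"
    using a m by (intro powr_mono2) auto
  have sum: "(y + r * g) powr a + (y - r * g) powr a
      \<le> 2 * y powr a - a * (1 - a) * y powr (a - 2) * (r * g)\<^sup>2"
    by (rule powr_symmetric_sum[OF a rg])
  have "y powr a \<le> N powr a + a * \<kappa> * N powr (a - 1)"
    unfolding y_def using a N1 \<kappa> by (intro powr_add_le_tangent) auto
  moreover have "a * \<kappa> * N powr (a - 1) \<le> a * \<kappa> * 2"
  proof (intro mult_left_mono)
    have "N powr (a - 1) \<le> (1/2) powr (a - 1)"
      using N1 a by (intro powr_mono2') auto
    also have "\<dots> \<le> (1/2) powr (-1)"
      using a by (intro powr_mono') auto
    also have "\<dots> = 2"
      by (simp add: powr_minus_divide)
    finally show "N powr (a - 1) \<le> 2" .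
  qed (use a \<kappa> in auto)
  ultimately have ya: "2 * y powr a \<le> 2 * N powr a + a * (4 * \<kappa>)"
    by simp
  have "(1 - 8 * s) * (1 - 2 * s) \<le> y powr (a - 2) * g\<^sup>2"
  proof (intro mult_mono)
    have "(1 - 8 * s) * (1 + 4 * s)\<^sup>2 = 1 - (48 * s\<^sup>2 + 128 * s ^ 3)"
      by (simp add: power2_eq_square power3_eq_cube algebra_simps)
    moreover have "0 \<le> 48 * s\<^sup>2 + 128 * s ^ 3"
      using s by simp
    ultimately have "1 - 8 * s \<le> 1 / (1 + 4 * s)\<^sup>2"
      using s by (subst pos_le_divide_eq) (simp, linarith)
    also have "\<dots> = (1 + 4 * s) powr (-2)"
      using s by (simp add: powr_minus_divide powr_numeral)
    also have "\<dots> \<le> (1 + 4 * s) powr (a - 2)"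
      using s a by (intro powr_mono) auto
    also have "\<dots> \<le> y powr (a - 2)"
      using y s a by (intro powr_mono2') auto
    finally show "1 - 8 * s \<le> y powr (a - 2)" .
    have "(1 - s)\<^sup>2 \<le> g\<^sup>2"
      using g s by (intro power_mono) auto
    moreover have "(1 - s)\<^sup>2 = 1 + s\<^sup>2 - 2 * s"
      by (simp add: power2_diff)
    ultimately show "1 - 2 * s \<le> g\<^sup>2"
      using zero_le_power2[of s] by linarith
  qed (use s in auto)
  moreover have "1 - 10 * s \<le> (1 - 8 * s) * (1 - 2 * s)"
    using s by (simp add: algebra_simps)
  ultimately have "1 - 10 * s \<le> y powr (a - 2) * g\<^sup>2"
    by linarith
  then have "a * (1 - a) * r\<^sup>2 * (1 - 10 * s) \<le> a * (1 - a) * r\<^sup>2 * (y powr (a - 2) * g\<^sup>2)"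
    using a by (intro mult_left_mono) auto
  then have curv: "a * ((1 - a) * (r\<^sup>2 * (1 - 10 * s))) \<le> a * (1 - a) * y powr (a - 2) * (r * g)\<^sup>2"
    by (simp add: power_mult_distrib mult_ac)
  define T where "T = tilted_norm s e z powr (a - 1) * ((z - s *\<^sub>R e) \<bullet> v)
        + ((norm v)\<^sup>2 - (2 - a) * (z \<bullet> v)\<^sup>2) / 2"
  have Na: "N powr a \<le> tilted_norm s e z powr a + a * (T + 100 * s * \<epsilon>\<^sup>2)"
    using tilted_norm_powr_taylor[OF a s e z v] by (simp add: N_def w_def T_def)
  have "tilted_norm s e (w + u) powr a + m powr a
     \<le> 2 * tilted_norm s e z powr a + a * (2 * (T + 100 * s * \<epsilon>\<^sup>2) + 4 * \<kappa>
         - (1 - a) * (r\<^sup>2 * (1 - 10 * s)))"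
    using M1 M2 sum ya curv Na by (simp add: algebra_simps)
  also have "\<dots> \<le> 2 * tilted_norm s e z powr a + a * (2 * T - (1 - a) * k\<^sup>2 * \<epsilon>\<^sup>2 + (204 + 50 * k\<^sup>2) * s * \<epsilon>\<^sup>2)"
  proof -
    have "s\<^sup>2 \<le> s"
      using s by (simp add: power2_eq_square mult_left_le)
    then have "\<kappa> \<le> s * (8 * r\<^sup>2 + \<epsilon>\<^sup>2)"
      unfolding \<kappa>_eq by (intro mult_right_mono) auto
    then have 1: "4 * \<kappa> \<le> 4 * s * \<epsilon>\<^sup>2 + 32 * s * r\<^sup>2"
      by (simp add: algebra_simps)
    have "(1 - a) * (10 * s * r\<^sup>2) \<le> 1 * (10 * s * r\<^sup>2)"
      using a s by (intro mult_right_mono) auto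
    then have 2: "- (1 - a) * (r\<^sup>2 * (1 - 10 * s)) \<le> - (1 - a) * r\<^sup>2 + 10 * s * r\<^sup>2"
      by (simp add: algebra_simps)
    have 3: "r\<^sup>2 = k\<^sup>2 * \<epsilon>\<^sup>2"
      by (simp add: r_def power_mult_distrib)
    have "0 \<le> s * (k\<^sup>2 * \<epsilon>\<^sup>2)"
      using s by simp
    then have "2 * (T + 100 * s * \<epsilon>\<^sup>2) + 4 * \<kappa> - (1 - a) * (r\<^sup>2 * (1 - 10 * s))
        \<le> 2 * T - (1 - a) * k\<^sup>2 * \<epsilon>\<^sup>2 + (204 + 50 * k\<^sup>2) * s * \<epsilon>\<^sup>2"
      using 1 2 unfolding 3 by (simp add: algebra_simps)
    then show ?thesis
      using a by (intro add_left_mono mult_left_mono) auto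
  qed
  also have "2 * T = 2 * tilted_norm s e z powr (a - 1) * ((z - s *\<^sub>R e) \<bullet> v)
        + ((norm v)\<^sup>2 - (2 - a) * (z \<bullet> v)\<^sup>2)"
    by (simp add: T_def)
  finally show ?thesis
    by (simp add: w_def add_diff_eq)
qed

text \<open>Scaling by \<open>1 / norm z\<close>. Homogeneity of degree 1 gives second order terms
  the factor \<open>norm z powr (a - 2)\<close>, leaves one extra \<open>norm z\<close> in the
  linear term, and turns the slack \<open>s^2 * \<epsilon>^2 / norm z\<close> into its unit scale
  form.\<close>

lemma tilted_norm_powr_step:
  fixes z v u e :: "'a::real_inner"
  assumes a: "0 < a" "a < 1" and s: "0 < s" "s \<le> 1/8" and e: "norm e = 1"
    and z: "z \<noteq> 0" and v: "norm v \<le> \<epsilon>" "\<epsilon> \<le> s * norm z" and \<epsilon>0: "0 < \<epsilon>"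
    and k: "0 < k" "k * \<epsilon> \<le> s * norm z" and u: "norm u \<le> k * \<epsilon>"
    and m: "0 \<le> m" "m \<le> tilted_norm s e (z + v - (k * \<epsilon>) *\<^sub>R sgn (sgn (z + v) - s *\<^sub>R e)) + s\<^sup>2 * \<epsilon>\<^sup>2 / norm z"
  shows "tilted_norm s e (z + v + u) powr a + m powr a
    \<le> 2 * tilted_norm s e z powr a + a * norm z powr (a - 2) *
       (2 * (tilted_norm s e z / norm z) powr (a - 1) * norm z * ((sgn z - s *\<^sub>R e) \<bullet> v)
        + (norm v)\<^sup>2 - (2 - a) * (sgn z \<bullet> v)\<^sup>2 - (1 - a) * k\<^sup>2 * \<epsilon>\<^sup>2 + (204 + 50 * k\<^sup>2) * s * \<epsilon>\<^sup>2)"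
proof -
  define R where "R = norm z"
  define c where "c = 1 / R"
  have R: "0 < R"
    using z by (simp add: R_def)
  have c: "0 < c" "c * R = 1"
    using R by (simp_all add: c_def)
  have sz: "sgn z = c *\<^sub>R z"
    by (simp add: sgn_div_norm c_def R_def divide_inverse)
  have sc: "sgn (c *\<^sub>R x) = sgn x" for x :: 'a
    using c by (simp add: sgn_scaleR)
  have tn: "tilted_norm s e (c *\<^sub>R x) = c * tilted_norm s e x" for x
    using c by (simp add: tilted_norm_scaleR)
  have "tilted_norm s e (sgn z + c *\<^sub>R v + c *\<^sub>R u) powr a + (c * m) powr a
    \<le> 2 * tilted_norm s e (sgn z) powr a + a * (2 * tilted_norm s e (sgn z) powr (a - 1) * ((sgn z - s *\<^sub>R e) \<bullet> (c *\<^sub>R v))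
        + (norm (c *\<^sub>R v))\<^sup>2 - (2 - a) * (sgn z \<bullet> (c *\<^sub>R v))\<^sup>2 - (1 - a) * k\<^sup>2 * (c * \<epsilon>)\<^sup>2
        + (204 + 50 * k\<^sup>2) * s * (c * \<epsilon>)\<^sup>2)"
  proof (rule tilted_norm_powr_step_unit[OF a s e])
    show "norm (sgn z) = 1"
      using z by (simp add: norm_sgn)
    show "norm (c *\<^sub>R v) \<le> c * \<epsilon>" "0 < c * \<epsilon>" "0 \<le> c * m"
      using v \<epsilon>0 m c by auto
    have "c * \<epsilon> \<le> c * (s * R)" "c * (k * \<epsilon>) \<le> c * (s * R)" "c * norm u \<le> c * (k * \<epsilon>)"
      using v k u c by (auto simp: R_def)
    moreover have "c * (s * R) = s"
      using c by simp
    ultimately show "c * \<epsilon> \<le> s" "k * (c * \<epsilon>) \<le> s" "norm (c *\<^sub>R u) \<le> k * (c * \<epsilon>)"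
      using c by (simp_all add: mult.left_commute)
    have "c * m \<le> c * (tilted_norm s e (z + v - (k * \<epsilon>) *\<^sub>R sgn (sgn (z + v) - s *\<^sub>R e)) + s\<^sup>2 * \<epsilon>\<^sup>2 / R)"
      using m(2) c by (intro mult_left_mono) (auto simp: R_def)
    also have "\<dots> = tilted_norm s e (c *\<^sub>R (z + v - (k * \<epsilon>) *\<^sub>R sgn (sgn (c *\<^sub>R (z + v)) - s *\<^sub>R e)))
         + s\<^sup>2 * (c * \<epsilon>)\<^sup>2"
      unfolding tn sc by (simp add: distrib_left c_def power2_eq_square)
    finally show "c * m \<le> tilted_norm s e (sgn z + c *\<^sub>R v - (k * (c * \<epsilon>)) *\<^sub>R
        sgn (sgn (sgn z + c *\<^sub>R v) - s *\<^sub>R e)) + s\<^sup>2 * (c * \<epsilon>)\<^sup>2"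
      by (simp add: sz algebra_simps)
  qed (use k in auto)
  then have "R powr a * (tilted_norm s e (sgn z + c *\<^sub>R v + c *\<^sub>R u) powr a + (c * m) powr a)
    \<le> R powr a * (2 * tilted_norm s e (sgn z) powr a + a * (2 * tilted_norm s e (sgn z) powr (a - 1) * ((sgn z - s *\<^sub>R e) \<bullet> (c *\<^sub>R v))
        + (norm (c *\<^sub>R v))\<^sup>2 - (2 - a) * (sgn z \<bullet> (c *\<^sub>R v))\<^sup>2 - (1 - a) * k\<^sup>2 * (c * \<epsilon>)\<^sup>2
        + (204 + 50 * k\<^sup>2) * s * (c * \<epsilon>)\<^sup>2))"
    by (intro mult_left_mono) auto
  moreover have P: "R powr a * (c * x) powr a = x powr a" if "0 \<le> x" for x
    using that R by (subst powr_mult[symmetric]) (auto simp: c_def)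
  have N0: "0 \<le> tilted_norm s e x" for x
    using tilted_norm_bounds(3)[of s e x] s e by auto
  have "R powr a * (tilted_norm s e (sgn z + c *\<^sub>R v + c *\<^sub>R u) powr a + (c * m) powr a)
      = tilted_norm s e (z + v + u) powr a + m powr a"
  proof -
    have "sgn z + c *\<^sub>R v + c *\<^sub>R u = c *\<^sub>R (z + v + u)"
      by (simp add: sz algebra_simps)
    then show ?thesis
      by (simp add: tn distrib_left P N0 m)
  qed
  moreover have "R powr a * tilted_norm s e (sgn z) powr a = tilted_norm s e z powr a"
    by (simp add: sz tn P N0)
  moreover have "R powr a * c\<^sup>2 = R powr (a - 2)" 
    using R by (simp add: c_def power_divide powr_diff powr_numeral)
  moreover have "R powr a * (2 * tilted_norm s e (sgn z) powr a + a * (2 * tilted_norm s e (sgn z) powr (a - 1) * ((sgn z - s *\<^sub>R e) \<bullet> (c *\<^sub>R v))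
        + (norm (c *\<^sub>R v))\<^sup>2 - (2 - a) * (sgn z \<bullet> (c *\<^sub>R v))\<^sup>2 - (1 - a) * k\<^sup>2 * (c * \<epsilon>)\<^sup>2
        + (204 + 50 * k\<^sup>2) * s * (c * \<epsilon>)\<^sup>2))
     = 2 * (R powr a * tilted_norm s e (sgn z) powr a) + a * (R powr a * c\<^sup>2) *
       (2 * (tilted_norm s e z / R) powr (a - 1) * R * ((sgn z - s *\<^sub>R e) \<bullet> v)
        + (norm v)\<^sup>2 - (2 - a) * (sgn z \<bullet> v)\<^sup>2 - (1 - a) * k\<^sup>2 * \<epsilon>\<^sup>2 + (204 + 50 * k\<^sup>2) * s * \<epsilon>\<^sup>2)"
  proof -
    have t: "tilted_norm s e (sgn z) = tilted_norm s e z / R"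
      unfolding sz tn by (simp add: c_def)
    have "c\<^sup>2 * (R * ((sgn z - s *\<^sub>R e) \<bullet> v)) = c * (c * R) * ((sgn z - s *\<^sub>R e) \<bullet> v)"
      by (simp add: power2_eq_square)
    then have i: "(sgn z - s *\<^sub>R e) \<bullet> (c *\<^sub>R v) = c\<^sup>2 * (R * ((sgn z - s *\<^sub>R e) \<bullet> v))"
      unfolding c(2) inner_scaleR_right mult_1_right by (rule sym)
    show ?thesis
      unfolding i t using c(1) by (simp add: power_mult_distrib algebra_simps)
  qed
  ultimately show ?thesis
    by (simp add: R_def)
qed

subsection \<open>Kernel integrals over a ball with a missing cap\<close>

lemma set_integrable_bounded:
  fixes f :: "'a::euclidean_space \<Rightarrow> real"
  assumes f: "f \<in> borel_measurable borel" and A: "A \<in> sets borel" "bounded A"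
    and C: "\<And>x. x \<in> A \<Longrightarrow> \<bar>f x\<bar> \<le> C"
  shows "set_integrable lborel A f"
proof -
  have "set_integrable lborel A (\<lambda>_. C)"
    using A emeasure_bounded_finite[OF A(2)] unfolding set_integrable_def
    by (intro integrable_scaleR_left) (simp add: less_top)
  then show ?thesis
    unfolding set_integrable_def
    by (rule Bochner_Integration.integrable_bound)
       (use f A C in \<open>auto simp: indicator_def intro!: AE_I2 order_trans[OF C]\<close>)
qed

lemma set_integral_le_measure:
  fixes f :: "'a::euclidean_space \<Rightarrow> real"
  assumes f: "f \<in> borel_measurable borel" and A: "A \<in> sets borel" "bounded A"
    and C: "\<And>x. x \<in> A \<Longrightarrow> \<bar>f x\<bar> \<le> C"
  shows "\<bar>LINT x:A|lborel. f x\<bar> \<le> C * measure lborel A"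
proof -
  have fin: "emeasure lborel A < \<infinity>"
    using emeasure_bounded_finite[OF A(2)] by (simp add: less_top)
  have iC: "set_integrable lborel A (\<lambda>_. C)"
    using set_integrable_bounded[OF _ A, of "\<lambda>_. C" "\<bar>C\<bar>"] by simp
  have "\<bar>LINT x:A|lborel. f x\<bar> \<le> (LINT x|lborel. norm (indicator A x *\<^sub>R f x))"
    unfolding set_lebesgue_integral_def real_norm_def[symmetric] by (rule integral_norm_bound)
  also have "\<dots> \<le> (LINT x:A|lborel. C)"
    unfolding set_lebesgue_integral_def
  proof (rule integral_mono)
    show "integrable lborel (\<lambda>x. norm (indicat_real A x *\<^sub>R f x))"
      using set_integrable_bounded[OF assms] unfolding set_integrable_def by (rule integrable_norm)
  qed (use iC C in \<open>auto simp: set_integrable_def indicator_def\<close>)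
  also have "\<dots> = C * measure lborel A"
    using fin A by (simp add: set_integral_const)
  finally show ?thesis .
qed

lemma set_integral_ge_measure:
  fixes f :: "'a::euclidean_space \<Rightarrow> real"
  assumes f: "f \<in> borel_measurable borel" and A: "A \<in> sets borel" "bounded A"
    and C: "\<And>x. x \<in> A \<Longrightarrow> \<bar>f x\<bar> \<le> C" and l: "\<And>x. x \<in> A \<Longrightarrow> l \<le> f x"
  shows "l * measure lborel A \<le> (LINT x:A|lborel. f x)"
proof -
  have fin: "emeasure lborel A < \<infinity>"
    using emeasure_bounded_finite[OF A(2)] by (simp add: less_top)
  have "(LINT x:A|lborel. l) \<le> (LINT x:A|lborel. f x)"
    by (rule set_integral_mono[OF _ set_integrable_bounded[OF assms(1-4)] l])
       (use fin A in \<open>auto simp: set_integrable_def intro!: integrable_scaleR_left\<close>)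
  then show ?thesis
    using fin A by (simp add: set_integral_const mult.commute)
qed

section \<open>Bounds, measurability and moments of the kernel\<close>

lemma admissible_kernelD:
  assumes "admissible_kernel \<eta>" "0 \<le> t"
  shows "0 \<le> \<eta> t" "\<eta> t \<le> 2" "t \<le> 1 \<Longrightarrow> 1 \<le> \<eta> t"
  using assms unfolding admissible_kernel_def monotone_on_def by fastforce+

text \<open>Nothing is known about \<open>\<eta>\<close> at negative arguments, so measurability on
  the whole line is stated for its continuous extension by the value at 0.\<close>

lemma borel_measurable_kernel:
  assumes "admissible_kernel \<eta>"
  shows "(\<lambda>t. \<eta> (max 0 t)) \<in> borel_measurable borel"
proof -
  obtain L where "L-lipschitz_on {0..} \<eta>"
    using assms by (auto simp: admissible_kernel_def)
  then have "continuous_on {0..} \<eta>"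
    by (rule lipschitz_on_continuous_on)
  then have "continuous_on UNIV (\<lambda>t. \<eta> (max 0 t))"
    by (rule continuous_on_compose2) (auto intro!: continuous_intros)
  then show ?thesis
    by (rule borel_measurable_continuous_onI)
qed

lemma borel_measurable_kernel_norm [measurable]:
  assumes "admissible_kernel \<eta>"
  shows "(\<lambda>v::'a::euclidean_space. \<eta> (norm v)) \<in> borel_measurable borel"
proof -
  have "(\<lambda>v::'a. \<eta> (max 0 (norm v))) \<in> borel_measurable borel"
    by (rule measurable_compose[OF _ borel_measurable_kernel[OF assms]]) simp
  then show ?thesis
    by simp
qed

lemma unit_ball_kernel_integrable:
  fixes f :: "'a::euclidean_space \<Rightarrow> real"
  assumes \<eta>: "admissible_kernel \<eta>" and f: "f \<in> borel_measurable borel"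
    and A: "A \<in> sets borel" "A \<subseteq> ball 0 1" and C: "\<And>v. v \<in> A \<Longrightarrow> \<bar>f v\<bar> \<le> C"
  shows "set_integrable lborel A (\<lambda>v. \<eta> (norm v) * f v)"
    "\<bar>LINT v:A|lborel. \<eta> (norm v) * f v\<bar> \<le> 2 * C * measure lborel A"
proof -
  note [measurable] = borel_measurable_kernel_norm[OF \<eta>]
  have b: "\<bar>\<eta> (norm v) * f v\<bar> \<le> 2 * C" if "v \<in> A" for v
    unfolding abs_mult using admissible_kernelD[OF \<eta>, of "norm v"] C[OF that]
    by (intro mult_mono) auto
  have bA: "bounded A"
    using A bounded_ball bounded_subset by blast
  show "set_integrable lborel A (\<lambda>v. \<eta> (norm v) * f v)"
    by (rule set_integrable_bounded[OF _ A(1) bA b]) (use f in measurable)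
  show "\<bar>LINT v:A|lborel. \<eta> (norm v) * f v\<bar> \<le> 2 * C * measure lborel A"
    by (rule set_integral_le_measure[OF _ A(1) bA b]) (use f in measurable)
qed

lemma abs_inner_le_one:
  fixes v e :: "'a::real_inner"
  assumes "norm v \<le> 1" "norm e \<le> 1"
  shows "\<bar>v \<bullet> e\<bar> \<le> 1"
  using Cauchy_Schwarz_ineq2[of v e] mult_le_one[OF assms(1) _ assms(2)] by simp

lemma kernel_second_moment:
  fixes e :: "'a::euclidean_space"
  assumes \<eta>: "admissible_kernel \<eta>" and e: "norm e = 1"
  shows "(LINT v:ball 0 1|lborel. \<eta> (norm v) * (v \<bullet> e)\<^sup>2) = 2 * sigma1 TYPE('a) \<eta>"
proof -
  define b where "b = (SOME e. e \<in> (Basis :: 'a set))"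
  have "b \<in> Basis"
    unfolding b_def by (rule someI_ex) (use nonempty_Basis in blast)
  then have b: "norm b = 1"
    by simp
  note [measurable] = borel_measurable_kernel[OF \<eta>]
  have eq: "(LINT v:ball 0 1|lborel. \<eta> (norm v) * (v \<bullet> u)\<^sup>2)
      = (LINT v|lborel. (indicator {..<1} (norm v) * \<eta> (max 0 (norm v))) * (v \<bullet> u)\<^sup>2)" for u :: 'a
    unfolding set_lebesgue_integral_def
    by (intro Bochner_Integration.integral_cong) (auto simp: indicator_def)
  have "(LINT v:ball 0 1|lborel. \<eta> (norm v) * (v \<bullet> e)\<^sup>2) = (LINT v:ball 0 1|lborel. \<eta> (norm v) * (v \<bullet> b)\<^sup>2)"
    unfolding eq by (rule integral_radial_inner[where w = "\<lambda>t. indicator {..<1} t * \<eta> (max 0 t)"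
          and g = "\<lambda>t. t\<^sup>2", OF _ _ e b]) measurable
  then show ?thesis
    by (simp add: sigma1_def b_def[symmetric] Let_def)
qed

lemma kernel_norm_moment:
  assumes \<eta>: "admissible_kernel \<eta>"
  shows "(LINT v:ball (0::'a::euclidean_space) 1|lborel. \<eta> (norm v) * (norm v)\<^sup>2)
     = DIM('a) * (2 * sigma1 TYPE('a) \<eta>)"
proof -
  have "(LINT v:ball (0::'a) 1|lborel. \<eta> (norm v) * (norm v)\<^sup>2)
      = (LINT v:ball (0::'a) 1|lborel. (\<Sum>b\<in>Basis. \<eta> (norm v) * (v \<bullet> b)\<^sup>2))"
    by (intro set_lebesgue_integral_cong)
       (auto simp: sum_distrib_left[symmetric] power2_norm_eq_inner euclidean_inner[of v v for v]
          power2_eq_square[symmetric])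
  also have "\<dots> = (\<Sum>b\<in>Basis. LINT v:ball (0::'a) 1|lborel. \<eta> (norm v) * (v \<bullet> b)\<^sup>2)"
    unfolding set_lebesgue_integral_def scaleR_sum_right
    by (rule Bochner_Integration.integral_sum)
       (use unit_ball_kernel_integrable(1)[OF \<eta>, of "\<lambda>v::'a. (v \<bullet> b)\<^sup>2" "ball 0 1" 1 for b] in
         \<open>auto simp: set_integrable_def abs_square_le_1 abs_inner_le_one\<close>)
  also have "\<dots> = (\<Sum>b\<in>(Basis::'a set). 2 * sigma1 TYPE('a) \<eta>)"
    using \<eta> by (intro sum.cong kernel_second_moment) auto
  finally show ?thesis
    by simp
qed

lemma sigma2_pos:
  assumes \<eta>: "admissible_kernel \<eta>"
  shows "0 < sigma2 TYPE('a::euclidean_space) \<eta>"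
proof -
  have "1 * measure lborel (ball (0::'a) 1) \<le> (LINT v:ball (0::'a) 1|lborel. \<eta> (norm v))"
    by (rule set_integral_ge_measure[where C = 2])
       (use admissible_kernelD[OF \<eta>] borel_measurable_kernel_norm[OF \<eta>] in auto)
  then show ?thesis
    unfolding sigma2_def content_ball[OF zero_le_one]
    using unit_ball_vol_pos[of "real DIM('a)", OF of_nat_0_le_iff]
    by (simp only: power_one mult_1 mult_1_right)
qed

lemma sigma1_pos:
  assumes \<eta>: "admissible_kernel \<eta>"
  shows "0 < sigma1 TYPE('a::euclidean_space) \<eta>"
proof -
  obtain b :: 'a where b: "b \<in> Basis"
    using nonempty_Basis by blast
  note [measurable] = borel_measurable_kernel_norm[OF \<eta>]
  \<comment> \<open>A ball inside the unit ball that avoids the origin, where the weight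
    \<open>(norm v)^2\<close> degenerates.\<close>
  define B where "B = ball ((1/2) *\<^sub>R b) (1/4)"
  have B: "1/4 \<le> norm v" "norm v < 1" if "v \<in> B" for v
  proof -
    have "norm ((1/2) *\<^sub>R b - v) < 1/4"
      using that by (simp add: B_def dist_norm)
    then show "1/4 \<le> norm v" "norm v < 1"
      using norm_triangle_ineq2[of "(1/2) *\<^sub>R b" v] norm_triangle_ineq2[of v "(1/2) *\<^sub>R b"] b
      by (auto simp: norm_minus_commute)
  qed
  have int: "set_integrable lborel (ball (0::'a) 1) (\<lambda>v. \<eta> (norm v) * (norm v)\<^sup>2)"
    by (rule unit_ball_kernel_integrable(1)[OF \<eta>, where C = 1]) (auto simp: abs_square_le_1)
  have "(1/16) * measure lborel B \<le> (LINT v:B|lborel. \<eta> (norm v) * (norm v)\<^sup>2)"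
  proof (rule set_integral_ge_measure[where C = 2])
    fix v assume v: "v \<in> B"
    have "(1/4)\<^sup>2 \<le> (norm v)\<^sup>2"
      using B[OF v] by (intro power_mono) auto
    then have "1 * (1/16) \<le> \<eta> (norm v) * (norm v)\<^sup>2"
      using admissible_kernelD[OF \<eta>, of "norm v"] B[OF v]
      by (intro mult_mono) (auto simp: power2_eq_square)
    then show "1/16 \<le> \<eta> (norm v) * (norm v)\<^sup>2"
      by simp
    have "\<eta> (norm v) * (norm v)\<^sup>2 \<le> 2 * 1"
      using admissible_kernelD[OF \<eta>, of "norm v"] B[OF v]
      by (intro mult_mono) (auto simp: power_le_one)
    then show "\<bar>\<eta> (norm v) * (norm v)\<^sup>2\<bar> \<le> 2"
      using admissible_kernelD[OF \<eta>, of "norm v"] by (simp add: abs_mult)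
  qed (auto simp: B_def)
  also have "(LINT v:B|lborel. \<eta> (norm v) * (norm v)\<^sup>2) \<le> (LINT v:ball (0::'a) 1|lborel. \<eta> (norm v) * (norm v)\<^sup>2)"
    unfolding set_lebesgue_integral_def
  proof (rule integral_mono)
    show "integrable lborel (\<lambda>v. indicat_real B v *\<^sub>R (\<eta> (norm v) * (norm v)\<^sup>2))"
    proof -
      have "B \<subseteq> ball 0 1"
        using B by auto
      then have "set_integrable lborel B (\<lambda>v. \<eta> (norm v) * (norm v)\<^sup>2)"
        by (intro set_integrable_subset[OF int]) (auto simp: B_def)
      then show ?thesis
        by (simp add: set_integrable_def)
    qed
    show "indicat_real B v *\<^sub>R (\<eta> (norm v) * (norm v)\<^sup>2)
        \<le> indicat_real (ball 0 1) v *\<^sub>R (\<eta> (norm v) * (norm v)\<^sup>2)" for v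
      using B[of v] admissible_kernelD[OF \<eta>, of "norm v"] by (auto simp: indicator_def)
  qed (use int in \<open>simp add: set_integrable_def\<close>)
  finally have "0 < DIM('a) * (2 * sigma1 TYPE('a) \<eta>)"
  proof -
    assume *: "1 / 16 * measure lborel B \<le> (LINT v:ball (0::'a) 1|lborel. \<eta> (norm v) * (norm v)\<^sup>2)"
    have "0 < measure lborel B"
      unfolding B_def by (rule content_ball_pos) simp
    then show ?thesis
      using * unfolding kernel_norm_moment[OF \<eta>] by linarith
  qed
  then show ?thesis
    by (simp add: zero_less_mult_iff)
qed


text \<open>
  In the next lemmas \<open>D\<close> is the rescaled part of the averaging ball outside the domain. If \<open>D\<close> stays in
  a thin annulus it is a small cap around \<open>- e\<close>, where \<open>m \<bullet> v\<close> is pointwise nonnegative. Otherwise the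
  component of \<open>m\<close> along \<open>e\<close> contributes a fixed amount, and the tangential component cancels up to a slab,
  since \<open>D\<close> is close to a half space.
\<close>

lemma cap_far:
  fixes D :: "'a::euclidean_space set"
  assumes s: "0 < s" "s \<le> 1" and \<theta>: "\<theta> \<le> s\<^sup>2 / 64" and \<delta>: "0 < \<delta>" "\<delta> \<le> s\<^sup>2 / 128"
    and D: "D \<subseteq> ball 0 1" "0 \<notin> D" and e: "norm e = 1" and m: "norm m = 1" "m \<bullet> e \<le> - s"
    and flat: "\<And>a b. b \<in> D \<Longrightarrow> a \<in> ball 0 1 - D \<Longrightarrow> (b - a) \<bullet> e \<le> \<delta> * norm (b - a)"
    and far: "\<And>v. v \<in> D \<Longrightarrow> 1 - \<theta> \<le> norm v" and v: "v \<in> D"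
  shows "0 \<le> m \<bullet> v"
proof -
  define t w c where "t = v \<bullet> e" and "w = v - t *\<^sub>R e" and "c = t - 2 * \<delta>"
  define q where "q = \<theta> + 2 * \<delta>"
  have ee: "e \<bullet> e = 1"
    using e by (simp add: norm_eq_1)
  have "s\<^sup>2 \<le> 1"
    using s by (simp add: power_le_one)
  then have small: "\<delta> \<le> 1/128" "\<theta> \<le> 1/64" "q \<le> s\<^sup>2 / 32" "q \<le> 1/32"
    using \<theta> \<delta> by (auto simp: q_def)
  have v1: "norm v < 1"
    using D v by auto
  have \<theta>0: "0 < \<theta>"
    using far[OF v] v1 by simp
  have "(v - 0) \<bullet> e \<le> \<delta> * norm (v - 0)"
    using D v by (intro flat) auto
  also have "\<dots> \<le> \<delta> * 1"
    using v1 \<delta> by (intro mult_left_mono) auto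
  finally have t: "t \<le> \<delta>"
    by (simp add: t_def)
  have we: "w \<bullet> e = 0"
    using ee by (simp add: w_def t_def inner_simps)
  have vv: "(norm v)\<^sup>2 = t\<^sup>2 + (norm w)\<^sup>2"
    unfolding power2_norm_eq_inner
    using ee by (simp add: w_def t_def inner_simps inner_commute power2_eq_square)
  have "(norm v)\<^sup>2 < 1"
    using v1 by (simp add: abs_square_less_1)
  then have "(norm w)\<^sup>2 \<le> 1"
    using vv by (smt (verit) zero_le_power2)
  then have w1: "norm w \<le> 1"
    by (simp add: abs_square_le_1)
  \<comment> \<open>The axis point \<open>c *\<^sub>R e\<close> lies lower than \<open>v\<close> by
    \<open>2 * \<delta>\<close> and at distance below 2, so flatness forbids that it belongs to
    \<open>ball 0 1 - D\<close>. Either it is outside the ball, or it lies in \<open>D\<close> and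
    hence in the annulus. Both force \<open>v\<close> to be close to \<open>- e\<close>.\<close>
  have "1 - \<theta> \<le> norm (c *\<^sub>R e)"
  proof (cases "c *\<^sub>R e \<in> ball 0 1 - D")
    case True
    have d: "v - c *\<^sub>R e = w + (2 * \<delta>) *\<^sub>R e"
      by (simp add: w_def c_def algebra_simps)
    have "norm (v - c *\<^sub>R e) \<le> norm w + norm ((2 * \<delta>) *\<^sub>R e)"
      unfolding d by (rule norm_triangle_ineq)
    also have "\<dots> < 2"
      using w1 e \<delta> small by simp
    finally have "\<delta> * norm (v - c *\<^sub>R e) < \<delta> * 2"
      using \<delta> by (intro mult_strict_left_mono) auto
    moreover have "(v - c *\<^sub>R e) \<bullet> e = 2 * \<delta>"
      unfolding d using we ee by (simp add: inner_simps)
    ultimately show ?thesis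
      using flat[OF v True] by simp
  next
    case False
    then show ?thesis
      using far[of "c *\<^sub>R e"] \<theta>0 by (auto simp: not_less)
  qed
  then have "1 - \<theta> \<le> \<bar>c\<bar>"
    using e by simp
  then have tq: "t \<le> - (1 - q)"
    using t \<delta> small by (simp add: c_def q_def)
  have "(1 - q)\<^sup>2 \<le> (- t)\<^sup>2"
    using tq small by (intro power_mono) auto
  then have "(norm w)\<^sup>2 \<le> 1 - (1 - q)\<^sup>2"
    using vv \<open>(norm v)\<^sup>2 < 1\<close> by simp
  also have "\<dots> \<le> 2 * q"
    by (simp add: power2_diff)
  also have "\<dots> \<le> (s / 4)\<^sup>2"
    using small by (simp add: power_divide)
  finally have w: "norm w \<le> s / 4"
    using s by (intro power2_le_imp_le[of "norm w"]) auto
  have "\<bar>m \<bullet> w\<bar> \<le> s / 4"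
    using Cauchy_Schwarz_ineq2[of m w] m w by simp
  moreover have "s * (31 / 32) \<le> (- (m \<bullet> e)) * (- t)"
    using m tq small s by (intro mult_mono) auto
  moreover have "m \<bullet> v = (m \<bullet> e) * t + m \<bullet> w"
    by (simp add: w_def inner_simps)
  ultimately show ?thesis
    using s by simp
qed

lemma cap_near:
  fixes D :: "'a::euclidean_space set"
  assumes \<eta>: "admissible_kernel \<eta>"
    and s: "0 < s" "s \<le> 1" and \<theta>: "0 < \<theta>" "\<theta> \<le> 1" and \<delta>: "0 < \<delta>" "\<delta> \<le> \<theta> / 8"
    and D: "D \<in> sets borel" "D \<subseteq> ball 0 1" "0 \<notin> D" and e: "norm e = 1" and m: "norm m = 1" "m \<bullet> e \<le> - s"
    and flat: "\<And>a b. b \<in> D \<Longrightarrow> a \<in> ball 0 1 - D \<Longrightarrow> (b - a) \<bullet> e \<le> \<delta> * norm (b - a)"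
    and b: "b \<in> D" "norm b < 1 - \<theta>"
  shows "s * \<theta> / 8 * measure lborel (ball (0::'a) (\<theta> / 4))
      - \<delta> * (2 * measure lborel (ball (0::'a) 1) + 4 * 2 ^ DIM('a))
    \<le> (LINT v:D|lborel. \<eta> (norm v) * (m \<bullet> v))"
proof -
  define w where "w = m - (m \<bullet> e) *\<^sub>R e"
  \<comment> \<open>A ball placed below the point \<open>b\<close> of \<open>D\<close>. Flatness
    puts it inside \<open>D\<close>, and its depth along \<open>e\<close> yields the fixed positive
    contribution.\<close>
  define U where "U = ball (b - (\<theta> / 2) *\<^sub>R e) (\<theta> / 4)"
  note [measurable] = borel_measurable_kernel_norm[OF \<eta>] D(1)
  have ee: "e \<bullet> e = 1"
    using e by (simp add: norm_eq_1)
  have we: "w \<bullet> e = 0"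
    using ee by (simp add: w_def inner_simps)
  have \<gamma>: "\<bar>m \<bullet> e\<bar> \<le> 1"
    by (rule abs_inner_le_one) (use m e in auto)
  have "(norm m)\<^sup>2 = (m \<bullet> e)\<^sup>2 + (norm w)\<^sup>2"
    unfolding power2_norm_eq_inner
    using ee by (simp add: w_def inner_simps inner_commute power2_eq_square)
  then have "(norm w)\<^sup>2 \<le> 1"
    using m by (smt (verit) zero_le_power2 one_power2)
  then have w1: "norm w \<le> 1"
    by (simp add: abs_square_le_1)
  have Db: "norm v < 1" if "v \<in> D" for v
    using D that by auto
  have De: "v \<bullet> e \<le> \<delta>" if "v \<in> D" for v
  proof -
    have "(v - 0) \<bullet> e \<le> \<delta> * norm (v - 0)"
      using D that by (intro flat) auto
    also have "\<dots> \<le> \<delta> * 1"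
      using Db[OF that] \<delta> by (intro mult_left_mono) auto
    finally show ?thesis
      by simp
  qed
  have UDe: "v \<in> D \<and> v \<bullet> e \<le> - (\<theta> / 8)" if "v \<in> U" for v
  proof -
      define q where "q = v - (b - (\<theta> / 2) *\<^sub>R e)"
      have q: "norm q < \<theta> / 4"
        using that by (simp add: U_def q_def dist_norm norm_minus_commute)
      have qe: "\<bar>q \<bullet> e\<bar> < \<theta> / 4"
        using Cauchy_Schwarz_ineq2[of q e] e q by simp
      have v_eq: "v = b - (\<theta> / 2) *\<^sub>R e + q"
        by (simp add: q_def)
      have "norm v \<le> norm b + norm ((\<theta> / 2) *\<^sub>R e) + norm q"
        unfolding v_eq by (intro order_trans[OF norm_triangle_ineq] add_right_mono norm_triangle_ineq4)
      then have v1: "norm v < 1"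
        using b q e \<theta> by simp
      have "v \<in> D"
      proof (rule ccontr)
        assume "v \<notin> D"
        then have "(b - v) \<bullet> e \<le> \<delta> * norm (b - v)"
          using v1 b by (intro flat) auto
        also have bv: "b - v = (\<theta> / 2) *\<^sub>R e - q"
          by (simp add: v_eq)
        also have "\<delta> * norm ((\<theta> / 2) *\<^sub>R e - q) \<le> \<delta> * 1"
          using norm_triangle_ineq4[of "(\<theta> / 2) *\<^sub>R e" q] e q \<theta> \<delta>
          by (intro mult_left_mono) auto
        finally show False
          using qe ee \<delta> \<theta> by (simp add: inner_simps)
      qed
      moreover have "v \<bullet> e = b \<bullet> e - \<theta> / 2 + q \<bullet> e"
        using ee by (simp add: v_eq inner_simps)
      ultimately show ?thesis
        using De[OF b(1)] qe \<delta> by auto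
  qed
  then have UD: "U \<subseteq> D" and Ue: "\<And>v. v \<in> U \<Longrightarrow> v \<bullet> e \<le> - (\<theta> / 8)"
    by auto
  have U [measurable]: "U \<in> sets borel"
    by (simp add: U_def)
  have \<eta>v: "1 \<le> \<eta> (norm v)" "\<eta> (norm v) \<le> 2" "0 \<le> \<eta> (norm v)" if "v \<in> D" for v
    using admissible_kernelD[OF \<eta>, of "norm v"] Db[OF that] by auto
  have int: "set_integrable lborel A (\<lambda>v. \<eta> (norm v) * (c \<bullet> v))"
    "\<bar>LINT v:A|lborel. \<eta> (norm v) * (c \<bullet> v)\<bar> \<le> 2 * 1 * measure lborel A"
    if "A \<in> sets borel" "A \<subseteq> ball 0 1" "norm c \<le> 1" for A and c :: 'a
    by (rule unit_ball_kernel_integrable[OF \<eta> _ that(1,2), where C = 1];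
        use that in \<open>auto simp: inner_commute intro!: abs_inner_le_one\<close>)+
  have int1: "set_integrable lborel D (\<lambda>v. \<eta> (norm v) * ((m \<bullet> e) * (v \<bullet> e)))"
  proof (rule unit_ball_kernel_integrable(1)[OF \<eta> _ D(1,2), where C = 1])
    fix v assume "v \<in> D"
    then show "\<bar>m \<bullet> e * (v \<bullet> e)\<bar> \<le> 1"
      unfolding abs_mult using \<gamma> abs_inner_le_one[of v e] e Db[of v] by (intro mult_le_one) auto
  qed simp
  have fin: "emeasure lborel A < \<infinity>" if "A \<subseteq> ball (0::'a) 1" for A
    using emeasure_bounded_finite[of A] bounded_subset[OF bounded_ball that] by (simp add: less_top)
  \<comment> \<open>Normal component: on \<open>U\<close> the integrand is at least
    \<open>s * \<theta> / 8\<close>; elsewhere on \<open>D\<close> it is bounded below by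
    \<open>- 2 * \<delta>\<close>, because no point of \<open>D\<close> rises above height
    \<open>\<delta>\<close>.\<close>
  have "s * \<theta> / 8 * measure lborel U - 2 * \<delta> * measure lborel D
      = (LINT v|lborel. s * \<theta> / 8 * indicator U v - 2 * \<delta> * indicator D v)"
    using fin[of U] fin[of D] UD D by (subst Bochner_Integration.integral_diff) auto
  also have "\<dots> \<le> (LINT v:D|lborel. \<eta> (norm v) * ((m \<bullet> e) * (v \<bullet> e)))"
    unfolding set_lebesgue_integral_def
  proof (rule integral_mono)
    show "integrable lborel (\<lambda>v. s * \<theta> / 8 * indicator U v - 2 * \<delta> * indicator D v)"
      using fin[of U] fin[of D] UD D by auto
    show "s * \<theta> / 8 * indicator U v - 2 * \<delta> * indicator D v
        \<le> indicat_real D v *\<^sub>R (\<eta> (norm v) * ((m \<bullet> e) * (v \<bullet> e)))" for v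
    proof (cases "v \<in> U")
      case True
      then have vD: "v \<in> D"
        using UD by auto
      have "s * (\<theta> / 8) \<le> (- (m \<bullet> e)) * (- (v \<bullet> e))"
        using m s \<theta> Ue[OF True] by (intro mult_mono) auto
      then have *: "s * (\<theta> / 8) \<le> (m \<bullet> e) * (v \<bullet> e)"
        by simp
      moreover have "0 \<le> s * (\<theta> / 8)"
        using s \<theta> by simp
      ultimately have "0 \<le> (m \<bullet> e) * (v \<bullet> e)"
        by linarith
      then have "1 * (s * (\<theta> / 8)) \<le> \<eta> (norm v) * ((m \<bullet> e) * (v \<bullet> e))"
        by (intro mult_mono' *) (use \<eta>v[OF vD] s \<theta> in auto)
      then show ?thesis
        using True vD \<delta> by simp
    next
      case False
      show ?thesis
      proof (cases "v \<in> D")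
        case True
        have "(- (m \<bullet> e)) * (v \<bullet> e) \<le> (- (m \<bullet> e)) * \<delta>"
          using De[OF True] m s by (intro mult_left_mono) auto
        also have "\<dots> \<le> 1 * \<delta>"
          using \<gamma> \<delta> by (intro mult_right_mono) auto
        finally have "\<eta> (norm v) * ((- (m \<bullet> e)) * (v \<bullet> e)) \<le> \<eta> (norm v) * \<delta>"
          using \<eta>v[OF True] by (intro mult_left_mono) auto
        also have "\<dots> \<le> 2 * \<delta>"
          using \<eta>v[OF True] \<delta> by (intro mult_right_mono) auto
        finally show ?thesis
          using True False by simp
      qed (use False in simp)
    qed
  qed (use int1 in \<open>simp add: set_integrable_def\<close>)
  finally have first: "s * \<theta> / 8 * measure lborel U - 2 * \<delta> * measure lborel D
      \<le> (LINT v:D|lborel. \<eta> (norm v) * ((m \<bullet> e) * (v \<bullet> e)))" .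
  \<comment> \<open>\<open>H\<close> is the smallest truncated half space containing
    \<open>D\<close>; flatness confines \<open>H - D\<close> to a slab of thickness
    \<open>2 * \<delta>\<close>.\<close>
  define t where "t = (SUP v\<in>D. v \<bullet> e)"
  define H where "H = {v. norm v < 1 \<and> v \<bullet> e \<le> t}"
  have bdd: "bdd_above ((\<lambda>v. v \<bullet> e) ` D)"
    using De by (intro bdd_aboveI2)
  have H [measurable]: "H \<in> sets borel"
    unfolding H_def by measurable
  have DH: "D \<subseteq> H"
    using cSUP_upper[OF _ bdd] Db by (auto simp: H_def t_def)
  have Hb: "H \<subseteq> ball 0 1"
    by (auto simp: H_def)
  have slab: "H - D \<subseteq> {v. norm v < 1 \<and> t - 2 * \<delta> \<le> v \<bullet> e \<and> v \<bullet> e \<le> t}"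
  proof
    fix a assume a: "a \<in> H - D"
    have "t \<le> a \<bullet> e + 2 * \<delta>"
      unfolding t_def
    proof (rule cSUP_least)
      fix v assume v: "v \<in> D"
      have "(v - a) \<bullet> e \<le> \<delta> * norm (v - a)"
        using a v by (intro flat) (auto simp: H_def)
      also have "\<dots> \<le> \<delta> * 2"
        using norm_triangle_ineq4[of v a] Db[OF v] a \<delta> by (intro mult_left_mono) (auto simp: H_def)
      finally show "v \<bullet> e \<le> a \<bullet> e + 2 * \<delta>"
        by (simp add: inner_simps)
    qed (use b in auto)
    then show "a \<in> {v. norm v < 1 \<and> t - 2 * \<delta> \<le> v \<bullet> e \<and> v \<bullet> e \<le> t}"
      using a by (auto simp: H_def)
  qed
  have "measure lborel (H - D) \<le> measure lborel {v. norm v < 1 \<and> t - 2 * \<delta> \<le> v \<bullet> e \<and> v \<bullet> e \<le> t}"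
  proof (rule measure_mono_fmeasurable[OF slab])
    show "{v. norm v < 1 \<and> t - 2 * \<delta> \<le> v \<bullet> e \<and> v \<bullet> e \<le> t} \<in> fmeasurable lborel"
      by (rule fmeasurableI) (measurable, rule fin, auto)
  qed auto
  also have "\<dots> \<le> 2 ^ DIM('a) * (2 * \<delta>)"
    using measure_slab_le[OF e, of "t - 2 * \<delta>" t] \<delta> by simp
  finally have mHD: "measure lborel (H - D) \<le> 2 ^ DIM('a) * (2 * \<delta>)" .
  \<comment> \<open>Tangential component: the reflection along \<open>w\<close> preserves
    \<open>H\<close>, because \<open>w\<close> is orthogonal to \<open>e\<close>, and reverses the
    sign of \<open>w \<bullet> v\<close>. So only the slab \<open>H - D\<close> contributes.\<close>
  have "(LINT v|lborel. indicator H v *\<^sub>R (\<eta> (norm v) * (w \<bullet> v)))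
      = (LINT v|lborel. - (indicator H v *\<^sub>R (\<eta> (norm v) * (w \<bullet> v))))"
  proof -
    have 1: "reflect w v \<bullet> e = v \<bullet> e" for v
      using we by (simp add: reflect_def inner_simps)
    have 2: "w \<bullet> reflect w v = - (w \<bullet> v)" for v
      by (cases "w = 0") (simp_all add: reflect_def inner_simps inner_commute)
    have "indicator H (reflect w v) = (indicator H v :: real)" for v
      by (simp add: H_def 1 indicator_def)
    then show ?thesis
      using integral_orthogonal[OF orthogonal_transformation_reflect[of w],
          of "\<lambda>v. indicator H v *\<^sub>R (\<eta> (norm v) * (w \<bullet> v))"]
      by (simp add: 2)
  qed
  then have zero: "(LINT v:H|lborel. \<eta> (norm v) * (w \<bullet> v)) = 0"
    unfolding set_lebesgue_integral_def by simp
  have DHD: "D \<union> (H - D) = H"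
    using DH by auto
  have "(LINT v:D \<union> (H - D)|lborel. \<eta> (norm v) * (w \<bullet> v)) = (LINT v:D|lborel. \<eta> (norm v) * (w \<bullet> v))
      + (LINT v:H - D|lborel. \<eta> (norm v) * (w \<bullet> v))"
    using D Hb w1 by (intro set_integral_Un int) auto
  moreover have "\<bar>LINT v:H - D|lborel. \<eta> (norm v) * (w \<bullet> v)\<bar> \<le> 2 * 1 * measure lborel (H - D)"
    using Hb w1 by (intro int) auto
  ultimately have second: "- (2 * (2 ^ DIM('a) * (2 * \<delta>))) \<le> (LINT v:D|lborel. \<eta> (norm v) * (w \<bullet> v))"
    using zero mHD unfolding DHD by linarith
  have "(LINT v:D|lborel. \<eta> (norm v) * (m \<bullet> v))
      = (LINT v:D|lborel. \<eta> (norm v) * ((m \<bullet> e) * (v \<bullet> e)) + \<eta> (norm v) * (w \<bullet> v))"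
    by (intro set_lebesgue_integral_cong)
       (auto simp: w_def inner_simps inner_commute algebra_simps)
  also have "\<dots> = (LINT v:D|lborel. \<eta> (norm v) * ((m \<bullet> e) * (v \<bullet> e)))
      + (LINT v:D|lborel. \<eta> (norm v) * (w \<bullet> v))"
    using int1 int(1)[OF D(1,2) w1] by (rule set_integral_add)
  finally have split: "(LINT v:D|lborel. \<eta> (norm v) * (m \<bullet> v)) = \<dots>" .
  have "measure lborel D \<le> measure lborel (ball (0::'a) 1)"
    using D emeasure_lborel_ball_finite[of "0::'a"]
    by (intro measure_mono_fmeasurable fmeasurableI) auto
  then have "2 * \<delta> * measure lborel D \<le> 2 * \<delta> * measure lborel (ball (0::'a) 1)"
    using \<delta> by (intro mult_left_mono) auto
  moreover have "measure lborel U = measure lborel (ball (0::'a) (\<theta> / 4))"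
    using \<theta> by (simp add: U_def content_ball)
  ultimately show ?thesis
    using first second split by (simp add: algebra_simps)
qed

text \<open>Either \<open>D\<close> lies in a thin annulus, whose volume is too small for the
  \<open>Q\<close> term to exceed \<open>\<tau>\<close> while the linear term has the right sign; or
  the linear integral is at least \<open>c / 2\<close> and a factor \<open>R \<ge> K\<close> makes
  it dominate. Both \<open>\<delta>\<close> and \<open>K\<close> are independent of
  \<open>D\<close>, \<open>e\<close> and \<open>m\<close>, hence of the point and the scale at which
  the boundary is seen.\<close>

lemma cap_integral:
  assumes \<eta>: "admissible_kernel \<eta>" and s: "0 < s" "s \<le> 1" and \<tau>: "0 < \<tau>" and Q: "0 \<le> Q"
  shows "\<exists>\<delta>>0. \<exists>K. \<forall>(D::'a::euclidean_space set) e m R.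
     D \<in> sets borel \<longrightarrow> D \<subseteq> ball 0 1 \<longrightarrow> 0 \<notin> D \<longrightarrow> norm e = 1 \<longrightarrow> norm m = 1 \<longrightarrow>
     (D \<noteq> {} \<longrightarrow> m \<bullet> e \<le> - s) \<longrightarrow>
     (\<forall>b\<in>D. \<forall>a\<in>ball 0 1 - D. (b - a) \<bullet> e \<le> \<delta> * norm (b - a)) \<longrightarrow> K \<le> R \<longrightarrow> 0 \<le> R \<longrightarrow>
     Q * (LINT v:D|lborel. \<eta> (norm v)) - R * (LINT v:D|lborel. \<eta> (norm v) * (m \<bullet> v)) \<le> \<tau>"
proof -
  define d where "d = DIM('a)"
  define \<beta> where "\<beta> = measure lborel (ball (0::'a) 1)"
  have \<beta>: "0 < \<beta>"
    by (simp add: \<beta>_def content_ball_pos)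
  define \<theta> where "\<theta> = min (s\<^sup>2 / 64) (\<tau> / (2 * Q * \<beta> * d + 1))"
  have pos: "0 < 2 * Q * \<beta> * d + 1"
    using Q \<beta> by (intro add_nonneg_pos) auto
  have \<theta>: "0 < \<theta>" "\<theta> \<le> s\<^sup>2 / 64" "\<theta> \<le> \<tau> / (2 * Q * \<beta> * d + 1)"
    unfolding \<theta>_def using s \<tau> pos by (simp only: min_less_iff_conj, auto intro: min.cobounded1 min.cobounded2)[1]
      (rule min.cobounded1 min.cobounded2)+
  have "s\<^sup>2 \<le> 1"
    using s by (simp add: power_le_one)
  then have \<theta>1: "\<theta> \<le> 1"
    using \<theta> by simp
  define c where "c = s * \<theta> / 8 * measure lborel (ball (0::'a) (\<theta> / 4))"
  have c: "0 < c"
    unfolding c_def using s \<theta> by (intro mult_pos_pos content_ball_pos) auto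
  define B where "B = 2 * \<beta> + 4 * 2 ^ d"
  have B: "0 < B"
    using \<beta> by (simp add: B_def add_pos_pos)
  define \<delta> where "\<delta> = min (s\<^sup>2 / 128) (min (\<theta> / 8) (c / (2 * B)))"
  have \<delta>: "0 < \<delta>" "\<delta> \<le> s\<^sup>2 / 128" "\<delta> \<le> \<theta> / 8" "\<delta> \<le> c / (2 * B)"
    using s \<theta> c B by (auto simp: \<delta>_def)
  \<comment> \<open>With this value \<open>K * (c / 2) = 2 * Q * \<beta>\<close>, a bound for the
    \<open>Q\<close> term over the whole ball.\<close>
  define K where "K = 4 * Q * \<beta> / c"
  show ?thesis
  proof (intro exI conjI allI impI)
    show "0 < \<delta>" by fact
    fix D :: "'a set" and e m :: 'a and R :: real
    assume D: "D \<in> sets borel" "D \<subseteq> ball 0 1" "0 \<notin> D" and e: "norm e = 1" and m: "norm m = 1"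
      and me: "D \<noteq> {} \<longrightarrow> m \<bullet> e \<le> - s"
      and flat: "\<forall>b\<in>D. \<forall>a\<in>ball 0 1 - D. (b - a) \<bullet> e \<le> \<delta> * norm (b - a)" and R: "K \<le> R" "0 \<le> R"
    have mb: "(LINT v:D|lborel. \<eta> (norm v)) \<le> 2 * measure lborel D"
      using unit_ball_kernel_integrable(2)[OF \<eta> _ D(1,2), of "\<lambda>_. 1" 1] by simp
    show "Q * (LINT v:D|lborel. \<eta> (norm v)) - R * (LINT v:D|lborel. \<eta> (norm v) * (m \<bullet> v)) \<le> \<tau>"
    proof (cases "\<forall>v\<in>D. 1 - \<theta> \<le> norm v")
      case True
      have "0 \<le> (LINT v:D|lborel. \<eta> (norm v) * (m \<bullet> v))"
        unfolding set_lebesgue_integral_def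
      proof (rule integral_nonneg_AE, rule AE_I2)
        fix v
        show "0 \<le> indicat_real D v *\<^sub>R (\<eta> (norm v) * (m \<bullet> v))"
        proof (cases "v \<in> D")
          case vD: True
          have "0 \<le> m \<bullet> v"
            using D me flat True vD by (intro cap_far[OF s \<theta>(2) \<delta>(1,2) D(2,3) e m]) auto
          then show ?thesis
            using admissible_kernelD(1)[OF \<eta>, of "norm v"] by simp
        qed simp
      qed
      then have "0 \<le> R * (LINT v:D|lborel. \<eta> (norm v) * (m \<bullet> v))"
        using R by simp
      moreover have "measure lborel D \<le> \<beta> * (d * \<theta>)"
      proof -
        have "D \<subseteq> ball 0 1 - ball 0 (1 - \<theta>)"
          using D(2) True by force
        then have "measure lborel D \<le> measure lborel (ball (0::'a) 1 - ball 0 (1 - \<theta>))"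
          using D(1) emeasure_lborel_ball_finite[of "0::'a"]
          by (intro measure_mono_fmeasurable fmeasurable.Diff fmeasurableI) auto
        also have "\<dots> = \<beta> - measure lborel (ball (0::'a) (1 - \<theta>))"
          unfolding \<beta>_def using emeasure_lborel_ball_finite[of "0::'a" 1] \<theta>
          by (intro measure_Diff) (auto simp: less_top)
        also have "\<dots> = \<beta> * (1 - (1 - \<theta>) ^ d)"
          using \<theta>1 by (simp add: \<beta>_def content_ball d_def algebra_simps)
        also have "\<dots> \<le> \<beta> * (d * \<theta>)"
          \<comment> \<open>The volume of the annulus is at most linear in its width:
            \<open>(1 - \<theta>) ^ d \<ge> 1 - d * \<theta>\<close>.\<close>
          using Bernoulli_inequality[of "- \<theta>" d] \<theta>1 \<beta> by (intro mult_left_mono) auto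
        finally show ?thesis .
      qed
      then have "Q * (LINT v:D|lborel. \<eta> (norm v)) \<le> Q * (2 * (\<beta> * (d * \<theta>)))"
        using mb Q by (intro mult_left_mono) auto
      moreover have "\<theta> * (2 * Q * \<beta> * d + 1) \<le> \<tau>"
        using \<theta>(3) pos by (simp add: pos_le_divide_eq)
      moreover have "\<theta> * (2 * Q * \<beta> * d + 1) = Q * (2 * (\<beta> * (d * \<theta>))) + \<theta>"
        by (simp add: algebra_simps)
      ultimately show ?thesis
        using \<theta>(1) by linarith
    next
      case False
      then obtain b where b: "b \<in> D" "norm b < 1 - \<theta>"
        by force
      have "c - \<delta> * B \<le> (LINT v:D|lborel. \<eta> (norm v) * (m \<bullet> v))"
        unfolding c_def B_def \<beta>_def d_def
        using me flat b \<theta>(1) \<theta>1 by (intro cap_near[OF \<eta> s _ _ \<delta>(1,3) D e m _ _ b]) auto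
      moreover have "\<delta> * B \<le> c / 2"
        using \<delta>(4) B by (simp add: field_simps)
      ultimately have I: "c / 2 \<le> (LINT v:D|lborel. \<eta> (norm v) * (m \<bullet> v))"
        by linarith
      have "2 * Q * \<beta> = K * (c / 2)"
        using c by (simp add: K_def)
      also have "\<dots> \<le> R * (LINT v:D|lborel. \<eta> (norm v) * (m \<bullet> v))"
        using R I c Q \<beta> by (intro mult_mono) (auto simp: K_def)
      finally have "2 * Q * \<beta> \<le> R * (LINT v:D|lborel. \<eta> (norm v) * (m \<bullet> v))" .
      moreover have "measure lborel D \<le> \<beta>"
        unfolding \<beta>_def using D emeasure_lborel_ball_finite[of "0::'a"]
        by (intro measure_mono_fmeasurable fmeasurableI) auto
      then have "Q * (LINT v:D|lborel. \<eta> (norm v)) \<le> Q * (2 * \<beta>)"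
        using mb Q by (intro mult_left_mono) auto
      ultimately show ?thesis
        using \<tau> by linarith
    qed
  qed
qed

subsection \<open>Flatness of the boundary and regularity of the density\<close>

text \<open>Linearise the defining function \<open>F\<close>, whose gradient \<open>G\<close> has
  component \<open>-1\<close> along the graph axis and therefore length at least 1. The direction
  obtained is the inner normal \<open>- sgn (G z)\<close> and not the axis, since the graph may be
  steep over its own hyperplane.\<close>

lemma C1_boundary_local_cone:
  fixes \<Omega> :: "'a::euclidean_space set"
  assumes C1: "C1_boundary \<Omega>" and z: "z \<in> frontier \<Omega>" and \<delta>: "0 < \<delta>"
  shows "\<exists>r>0. \<exists>e. norm e = 1 \<and>
    (\<forall>a\<in>\<Omega> \<inter> ball z r. \<forall>b\<in>ball z r - \<Omega>. (b - a) \<bullet> e \<le> \<delta> * norm (b - a))"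
proof -
  obtain r e f g where r: "0 < r" and e: "norm e = 1"
    and f: "\<And>x. GDERIV f x :> g x" and g: "continuous_on UNIV g"
    and \<Omega>: "\<Omega> \<inter> ball z r = {y \<in> ball z r. f (y - (y \<bullet> e) *\<^sub>R e) < y \<bullet> e}"
  proof -
    obtain r where r: "0 < r" "\<exists>e f. norm e = 1 \<and> C1_function f \<and>
        \<Omega> \<inter> ball z r = {y \<in> ball z r. f (y - (y \<bullet> e) *\<^sub>R e) < y \<bullet> e}"
      using C1 z unfolding C1_boundary_def by blast
    then obtain e f where ef: "norm e = 1" "C1_function f"
        "\<Omega> \<inter> ball z r = {y \<in> ball z r. f (y - (y \<bullet> e) *\<^sub>R e) < y \<bullet> e}"
      by blast
    obtain g where "\<forall>x. GDERIV f x :> g x" "continuous_on UNIV g"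
      using ef(2) unfolding C1_function_def by blast
    then show ?thesis
      using r(1) ef by (intro that[of r e f g]) auto
  qed
  define P where "P y = y - (y \<bullet> e) *\<^sub>R e" for y
  define F where "F y = f (P y) - y \<bullet> e" for y
  define G where "G y = P (g (P y)) - e" for y
  have ee: "e \<bullet> e = 1"
    using e by (simp add: norm_eq_1)
  have F_deriv: "(F has_derivative (\<lambda>h. h \<bullet> G y)) (at y)" for y
  proof -
    have "((\<lambda>y. f (P y)) has_derivative (\<lambda>h. P h \<bullet> g (P y))) (at y)"
    proof (rule has_derivative_compose[of P P, unfolded o_def])
      show "(P has_derivative P) (at y)"
        unfolding P_def[abs_def] by (auto intro!: derivative_eq_intros)
      show "(f has_derivative (\<lambda>h. h \<bullet> g (P y))) (at (P y))"
        using f[of "P y"] by (simp add: gderiv_def inner_commute)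
    qed
    then have "(F has_derivative (\<lambda>h. P h \<bullet> g (P y) - h \<bullet> e)) (at y)"
      unfolding F_def[abs_def] by (rule has_derivative_diff) (auto intro!: derivative_eq_intros)
    also have "(\<lambda>h. P h \<bullet> g (P y) - h \<bullet> e) = (\<lambda>h. h \<bullet> G y)"
      by (simp add: G_def P_def inner_simps inner_commute mult.commute)
    finally show ?thesis .
  qed
  have G_e: "G y \<bullet> e = -1" for y
    using ee by (simp add: G_def P_def inner_simps)
  have G_norm: "1 \<le> norm (G y)" for y
    using Cauchy_Schwarz_ineq2[of "G y" e] G_e[of y] e by simp
  have "continuous_on UNIV G"
    unfolding G_def P_def
    by (intro continuous_intros continuous_on_compose2[OF g]) auto
  then have "isCont G z"
    by (simp add: continuous_on_eq_continuous_at)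
  then obtain r1 where r1: "0 < r1" and G_cont: "\<And>y. dist y z < r1 \<Longrightarrow> dist (G y) (G z) < \<delta>"
    using \<delta> unfolding continuous_at_eps_delta by blast
  define R where "R = min r r1"
  define e' where "e' = - sgn (G z)"
  have Gz: "G z \<noteq> 0"
    using G_norm[of z] by auto
  show ?thesis
  proof (intro exI[of _ R] exI[of _ e'] conjI ballI)
    show "0 < R" "norm e' = 1"
      using r r1 Gz by (auto simp: R_def e'_def norm_sgn)
    fix a b assume a: "a \<in> \<Omega> \<inter> ball z R" and b: "b \<in> ball z R - \<Omega>"
    have Fa: "F a < 0"
    proof -
      have "a \<in> \<Omega> \<inter> ball z r"
        using a by (auto simp: R_def)
      then show ?thesis
        unfolding \<Omega> by (auto simp: F_def P_def)
    qed
    have Fb: "0 \<le> F b"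
    proof -
      have "b \<in> ball z r" "b \<notin> \<Omega> \<inter> ball z r"
        using b by (auto simp: R_def)
      then show ?thesis
        unfolding \<Omega> by (auto simp: F_def P_def)
    qed
    have "norm (F b - F a - (b - a) \<bullet> G z) \<le> norm (b - a) * \<delta>"
    proof (rule differentiable_bound_linearization[where S = "ball z R" and f' = "\<lambda>y h. h \<bullet> G y"])
      show "(F has_derivative (\<lambda>h. h \<bullet> G y)) (at y within ball z R)" for y
        using F_deriv by (rule has_derivative_at_withinI)
      show "a + t *\<^sub>R (b - a) \<in> ball z R" if "t \<in> {0..1}" for t
      proof -
        have "(1 - t) *\<^sub>R a + t *\<^sub>R b \<in> ball z R"
          using a b that by (intro convexD[OF convex_ball]) auto
        then show ?thesis
          by (simp add: algebra_simps)
      qed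
      show "onorm ((\<lambda>h. h \<bullet> G y) - (\<lambda>h. h \<bullet> G z)) \<le> \<delta>" if "y \<in> ball z R" for y
      proof (rule onorm_le)
        fix h :: 'a
        have "dist (G y) (G z) < \<delta>"
          using that by (intro G_cont) (auto simp: R_def dist_commute)
        then have "norm h * norm (G y - G z) \<le> norm h * \<delta>"
          by (intro mult_left_mono) (auto simp: dist_norm)
        then show "norm (((\<lambda>h. h \<bullet> G y) - (\<lambda>h. h \<bullet> G z)) h) \<le> \<delta> * norm h"
          using Cauchy_Schwarz_ineq2[of h "G y - G z"] by (simp add: inner_diff_right mult.commute)
      qed
      show "z \<in> ball z R"
        using \<open>0 < R\<close> by simp
    qed
    then have "- ((b - a) \<bullet> G z) \<le> norm (b - a) * \<delta>"
      using Fa Fb by (simp add: abs_le_iff)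
    also have "- ((b - a) \<bullet> G z) = norm (G z) * ((b - a) \<bullet> e')"
      using Gz by (simp add: e'_def sgn_div_norm)
    finally have *: "norm (G z) * ((b - a) \<bullet> e') \<le> norm (b - a) * \<delta>" .
    show "(b - a) \<bullet> e' \<le> \<delta> * norm (b - a)"
    proof (cases "0 \<le> (b - a) \<bullet> e'")
      case True
      then have "1 * ((b - a) \<bullet> e') \<le> norm (G z) * ((b - a) \<bullet> e')"
        using G_norm by (intro mult_right_mono)
      then show ?thesis
        using * by (simp add: mult.commute)
    next
      case False
      moreover have "0 \<le> \<delta> * norm (b - a)"
        using \<delta> by simp
      ultimately show ?thesis
        by linarith
    qed
  qed
qed

text \<open>Compactness of the frontier gives a Lebesgue number. A ball around a point of
  \<open>\<Omega>\<close> that misses the frontier lies in \<open>\<Omega>\<close>; the condition is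
  then vacuous and every unit vector serves.\<close>

lemma C1_boundary_uniform_cone:
  fixes \<Omega> :: "'a::euclidean_space set"
  assumes C1: "C1_boundary \<Omega>" and bdd: "bounded \<Omega>" and \<delta>: "0 < \<delta>"
  shows "\<exists>r>0. \<forall>x\<in>\<Omega>. \<exists>e. norm e = 1 \<and>
    (\<forall>a\<in>\<Omega> \<inter> ball x r. \<forall>b\<in>ball x r - \<Omega>. (b - a) \<bullet> e \<le> \<delta> * norm (b - a))"
proof -
  define cone where "cone z r e \<longleftrightarrow> norm e = 1 \<and>
    (\<forall>a\<in>\<Omega> \<inter> ball z r. \<forall>b\<in>ball z r - \<Omega>. (b - a) \<bullet> e \<le> \<delta> * norm (b - a))" for z r e
  obtain r e where r: "\<And>z. z \<in> frontier \<Omega> \<Longrightarrow> 0 < r z" and re: "\<And>z. z \<in> frontier \<Omega> \<Longrightarrow> cone z (r z) (e z)"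
  proof -
    have "\<forall>z. \<exists>r e. z \<in> frontier \<Omega> \<longrightarrow> 0 < r \<and> cone z r e"
      using C1_boundary_local_cone[OF C1 _ \<delta>] unfolding cone_def by blast
    then obtain r where "\<forall>z. \<exists>e. z \<in> frontier \<Omega> \<longrightarrow> 0 < r z \<and> cone z (r z) e"
      by (rule choice[THEN exE])
    then obtain e where "\<forall>z. z \<in> frontier \<Omega> \<longrightarrow> 0 < r z \<and> cone z (r z) (e z)"
      by (rule choice[THEN exE])
    then show ?thesis
      by (intro that[of r e]) auto
  qed
  have "compact (frontier \<Omega>)"
    using bdd by (rule compact_frontier_bounded)
  moreover have "frontier \<Omega> \<subseteq> \<Union> ((\<lambda>z. ball z (r z)) ` frontier \<Omega>)"
    using r by fastforce
  ultimately obtain \<rho> where \<rho>: "0 < \<rho>"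
    and leb: "\<And>x. x \<in> frontier \<Omega> \<Longrightarrow> \<exists>G\<in>(\<lambda>z. ball z (r z)) ` frontier \<Omega>. ball x \<rho> \<subseteq> G"
    by (rule Heine_Borel_lemma) auto
  obtain e0 :: 'a where e0: "norm e0 = 1"
    using vector_choose_size[of 1] by auto
  show ?thesis
  proof (intro exI[of _ "\<rho> / 2"] conjI ballI)
    show "0 < \<rho> / 2"
      using \<rho> by simp
    fix x assume x: "x \<in> \<Omega>"
    show "\<exists>e. norm e = 1 \<and> (\<forall>a\<in>\<Omega> \<inter> ball x (\<rho>/2). \<forall>b\<in>ball x (\<rho>/2) - \<Omega>. (b - a) \<bullet> e \<le> \<delta> * norm (b - a))"
    proof (cases "ball x (\<rho>/2) \<subseteq> \<Omega>")
      case True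
      then show ?thesis
        using e0 by auto
    next
      case False
      then have "ball x (\<rho>/2) \<inter> frontier \<Omega> \<noteq> {}"
      proof (intro connected_Int_frontier connected_ball)
        have "x \<in> ball x (\<rho>/2) \<inter> \<Omega>"
          using x \<rho> by simp
        then show "ball x (\<rho>/2) \<inter> \<Omega> \<noteq> {}"
          by blast
      qed auto
      then obtain y where y: "y \<in> frontier \<Omega>" "dist x y < \<rho> / 2"
        by auto
      obtain z where z: "z \<in> frontier \<Omega>" "ball y \<rho> \<subseteq> ball z (r z)"
        using leb[OF y(1)] by auto
      have "ball x (\<rho>/2) \<subseteq> ball y \<rho>"
      proof
        fix w assume "w \<in> ball x (\<rho>/2)"
        then show "w \<in> ball y \<rho>"
          using y(2) dist_triangle[of y w x] by (simp add: dist_commute)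
      qed
      then have "ball x (\<rho>/2) \<subseteq> ball z (r z)"
        using z by blast
      then show ?thesis
        using re[OF z(1)] unfolding cone_def by (intro exI[of _ "e z"]) blast
    qed
  qed
qed

text \<open>A uniform inner cone with nearly the opening of a half space: inside the ball,
  \<open>\<Omega>\<close> cannot be left along a vector \<open>v\<close> with
  \<open>v \<bullet> e > \<delta> * norm v\<close>. The boundary is not mentioned, so interior
  points are covered too.\<close>

definition flat_at :: "'a::real_inner set \<Rightarrow> real \<Rightarrow> 'a \<Rightarrow> real \<Rightarrow> 'a \<Rightarrow> bool" where
  "flat_at \<Omega> \<delta> x r e \<longleftrightarrow>
     (\<forall>a\<in>\<Omega> \<inter> ball x r. \<forall>b\<in>ball x r - \<Omega>. (b - a) \<bullet> e \<le> \<delta> * norm (b - a))"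

lemma flat_atD:
  assumes "flat_at \<Omega> \<delta> x r e" "a \<in> \<Omega>" "dist x a < r" "dist x b < r"
    "\<delta> * norm (b - a) < (b - a) \<bullet> e"
  shows "b \<in> \<Omega>"
proof (rule ccontr)
  assume "b \<notin> \<Omega>"
  then have "b \<in> ball x r - \<Omega>" "a \<in> \<Omega> \<inter> ball x r"
    using assms(2-4) by simp_all
  then have "(b - a) \<bullet> e \<le> \<delta> * norm (b - a)"
    using assms(1) unfolding flat_at_def by blast
  then show False
    using assms(5) by simp
qed

text \<open>The segment from \<open>y\<close> to \<open>z\<close> may leave \<open>\<Omega>\<close>, but the detour through \<open>y + 2 h e\<close> and \<open>z + 2 h e\<close> does not.\<close>

lemma lipschitz_density:
  fixes \<Omega> :: "'a::euclidean_space set"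
  assumes op: "open \<Omega>" and fl: "flat_at \<Omega> \<delta> x r e" and \<delta>: "0 < \<delta>" "\<delta> < 1/3" and e: "norm e = 1"
    and der: "\<And>z. z \<in> \<Omega> \<Longrightarrow> GDERIV \<rho> z :> g z" and G: "\<And>z. z \<in> \<Omega> \<Longrightarrow> norm (g z) \<le> G"
    and yz: "y \<in> \<Omega>" "z \<in> \<Omega>" "norm (y - z) \<le> h" and h: "0 < h"
    and in_ball: "dist x y + 4 * h < r" "dist x z + 4 * h < r"
  shows "\<bar>\<rho> y - \<rho> z\<bar> \<le> 5 * G * h"
proof -
  have ee: "e \<bullet> e = 1"
    using e by (simp add: norm_eq_1)
  have seg: "\<bar>\<rho> a - \<rho> b\<bar> \<le> G * norm (a - b)" if "closed_segment a b \<subseteq> \<Omega>" for a b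
  proof -
    have "norm (\<rho> a - \<rho> b) \<le> G * norm (a - b)"
    proof (rule differentiable_bound[OF convex_closed_segment])
      fix w assume w: "w \<in> closed_segment a b"
      then have w': "w \<in> \<Omega>"
        using that by auto
      show "(\<rho> has_derivative (\<lambda>h. h \<bullet> g w)) (at w within closed_segment a b)"
        using der[OF w'] unfolding gderiv_def
        by (rule has_derivative_at_withinI)
      show "onorm (\<lambda>h. h \<bullet> g w) \<le> G"
      proof (rule onorm_le)
        fix h :: 'a
        have "norm h * norm (g w) \<le> norm h * G"
          using G[OF w'] by (intro mult_left_mono) auto
        then show "norm (h \<bullet> g w) \<le> G * norm h"
          using Cauchy_Schwarz_ineq2[of h "g w"] unfolding real_norm_def by (simp only: mult.commute[of G])
      qed
    qed auto
    then show ?thesis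
      by simp
  qed
  \<comment> \<open>The detour uses vectors of length at most \<open>3 * h\<close> inside the cone
    of slope 1/3. Its two legs of length \<open>2 * h\<close> and the top piece of length at most
    \<open>h\<close> give the factor 5.\<close>
  have up: "a + v \<in> \<Omega>" if "a \<in> \<Omega>" "dist x a + 4 * h < r" "norm v \<le> 3 * h" "norm v \<le> 3 * (v \<bullet> e)" for a v
  proof (cases "v = 0")
    case False
    have "dist x a < r" "dist x (a + v) < r"
      using that h dist_triangle[of x "a + v" a] norm_ge_zero[of v] by (simp_all add: dist_norm)
    moreover have "\<delta> * norm v < (1/3) * norm v"
      using False \<delta> by (intro mult_strict_right_mono) auto
    ultimately show ?thesis
      using that(1,4) by (intro flat_atD[OF fl \<open>a \<in> \<Omega>\<close>]) (simp_all del: dist_add_cancel)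
  qed (use that in simp)
  have line: "closed_segment a (a + (2 * h) *\<^sub>R e) \<subseteq> \<Omega>" if "a \<in> \<Omega>" "dist x a + 4 * h < r" for a
  proof
    fix w assume "w \<in> closed_segment a (a + (2 * h) *\<^sub>R e)"
    then obtain t where t: "0 \<le> t" "t \<le> 1" "w = a + (t * (2 * h)) *\<^sub>R e"
      by (auto simp: in_segment algebra_simps)
    have "t * (2 * h) \<le> 1 * (2 * h)"
      using t h by (intro mult_right_mono) auto
    then show "w \<in> \<Omega>"
      unfolding t(3) using that t h e ee by (intro up) (simp_all add: abs_mult)
  qed
  have top: "closed_segment (y + (2 * h) *\<^sub>R e) (z + (2 * h) *\<^sub>R e) \<subseteq> \<Omega>"
  proof
    fix w assume "w \<in> closed_segment (y + (2 * h) *\<^sub>R e) (z + (2 * h) *\<^sub>R e)"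
    then obtain t where t: "0 \<le> t" "t \<le> 1"
      "w = (1 - t) *\<^sub>R (y + (2 * h) *\<^sub>R e) + t *\<^sub>R (z + (2 * h) *\<^sub>R e)"
      by (auto simp: in_segment)
    define u where "u = (1 - t) *\<^sub>R (y - z)"
    have w: "w = z + (u + (2 * h) *\<^sub>R e)"
      by (simp add: t(3) u_def algebra_simps)
    have "norm u \<le> 1 * norm (y - z)"
      using t unfolding u_def by (simp add: mult_left_le_one_le)
    then have u: "norm u \<le> h"
      using yz by simp
    have ue: "\<bar>u \<bullet> e\<bar> \<le> h"
      using Cauchy_Schwarz_ineq2[of u e] e u by simp
    have n: "norm (u + (2 * h) *\<^sub>R e) \<le> 3 * h"
      using norm_triangle_ineq[of u "(2 * h) *\<^sub>R e"] u e h by simp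
    moreover have "h \<le> (u + (2 * h) *\<^sub>R e) \<bullet> e"
      using ue ee by (simp add: inner_simps)
    ultimately show "w \<in> \<Omega>"
      unfolding w using yz in_ball by (intro up) auto
  qed
  have G0: "0 \<le> G"
    using G[OF yz(1)] norm_ge_zero order_trans by blast
  have "norm ((y + (2 * h) *\<^sub>R e) - (z + (2 * h) *\<^sub>R e)) \<le> h"
    using yz by simp
  then have "G * norm ((y + (2 * h) *\<^sub>R e) - (z + (2 * h) *\<^sub>R e)) \<le> G * h"
    using G0 by (intro mult_left_mono)
  then have "\<bar>\<rho> (y + (2 * h) *\<^sub>R e) - \<rho> (z + (2 * h) *\<^sub>R e)\<bar> \<le> G * h"
    using seg[OF top] by linarith
  have "\<bar>\<rho> a - \<rho> (a + (2 * h) *\<^sub>R e)\<bar> \<le> 2 * G * h" if "a \<in> \<Omega>" "dist x a + 4 * h < r" for a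
    using seg[OF line[OF that]] e h by (simp add: mult_ac)
  from this[OF yz(1) in_ball(1)] this[OF yz(2) in_ball(2)] show ?thesis
    using \<open>\<bar>\<rho> (y + (2 * h) *\<^sub>R e) - \<rho> (z + (2 * h) *\<^sub>R e)\<bar> \<le> G * h\<close> by linarith
qed

subsection \<open>The discrete operator and transport\<close>

definition kernel_weight :: "(real \<Rightarrow> real) \<Rightarrow> real \<Rightarrow> real \<Rightarrow> real" where
  "kernel_weight \<eta> \<epsilon> t = (if t < \<epsilon> then \<eta> (t / \<epsilon>) else 0)"

text \<open>The operator without its positive normalising factor and with a free radius
  \<open>r\<close>. For comparison only signs and zeros matter.\<close>

definition step_sum ::
  "(real \<Rightarrow> real) \<Rightarrow> real \<Rightarrow> real \<Rightarrow> (nat \<Rightarrow> 'a::euclidean_space) \<Rightarrow> nat \<Rightarrow> ('a \<Rightarrow> real) \<Rightarrow> 'a \<Rightarrow> real"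
where
  "step_sum \<eta> r \<epsilon> x n w z = (\<Sum>j=1..n. kernel_weight \<eta> \<epsilon> (norm (z - x j)) *
     (max_op x n r w (x j) + min_op x n r w (x j) - 2 * w z))"

lemma hypergraph_op_eq_step_sum:
  fixes x :: "nat \<Rightarrow> 'a::euclidean_space"
  shows "hypergraph_op \<eta> p \<epsilon> x n w z
    = 1 / (2 * n * \<epsilon>\<^sup>2 * \<epsilon> ^ DIM('a)) * step_sum \<eta> (radius_factor TYPE('a) \<eta> p * \<epsilon>) \<epsilon> x n w z"
  unfolding hypergraph_op_def step_sum_def Let_def sum_distrib_left
  by (intro sum.cong) (auto simp: cutoff_kernel_def scaled_kernel_def kernel_weight_def)

lemma kernel_weight_bounds:
  assumes \<eta>: "admissible_kernel \<eta>" and \<epsilon>: "0 < \<epsilon>" and t: "0 \<le> t"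
  shows "0 \<le> kernel_weight \<eta> \<epsilon> t" "kernel_weight \<eta> \<epsilon> t \<le> 2" "t < \<epsilon> \<Longrightarrow> 1 \<le> kernel_weight \<eta> \<epsilon> t"
  using admissible_kernelD[OF \<eta>, of "t / \<epsilon>"] assms by (auto simp: kernel_weight_def)

lemma max_op_attained:
  assumes "j \<in> {1..n}" "0 \<le> r"
  obtains q where "q \<in> x ` {1..n}" "norm (q - x j) \<le> r" "max_op x n r w (x j) = w q"
    "\<And>q. q \<in> x ` {1..n} \<Longrightarrow> norm (q - x j) \<le> r \<Longrightarrow> w q \<le> max_op x n r w (x j)"
proof -
  define A where "A = cball (x j) r \<inter> x ` {1..n}"
  have A: "finite A" "x j \<in> A"
    using assms by (auto simp: A_def)
  then have "w ` A \<noteq> {}"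
    by blast
  then have "Max (w ` A) \<in> w ` A"
    using A by (intro Max_in) auto
  then obtain q where "q \<in> A" "Max (w ` A) = w q"
    by auto
  moreover have "w q \<le> Max (w ` A)" if "q \<in> A" for q
    using A that by auto
  ultimately show ?thesis
    using that[of q] unfolding max_op_def A_def[symmetric]
    by (auto simp: A_def dist_norm norm_minus_commute)
qed

lemma min_op_eq_max_op:
  assumes "j \<in> {1..n}" "0 \<le> r"
  shows "min_op x n r w (x j) = - max_op x n r (\<lambda>q. - w q) (x j)"
proof -
  define A where "A = cball (x j) r \<inter> x ` {1..n}"
  have "finite A" "x j \<in> A"
    using assms by (auto simp: A_def)
  then have A: "finite (w ` A)" "w ` A \<noteq> {}"
    by auto
  have "Max ((\<lambda>q. - w q) ` A) = - Min (w ` A)"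
  proof (rule Max_eqI)
    fix y assume "y \<in> (\<lambda>q. - w q) ` A"
    then show "y \<le> - Min (w ` A)"
      using A by auto
  next
    have "Min (w ` A) \<in> w ` A"
      using A by (rule Min_in)
    then show "- Min (w ` A) \<in> (\<lambda>q. - w q) ` A"
      by auto
  qed (use \<open>finite A\<close> in auto)
  then show ?thesis
    unfolding min_op_def max_op_def A_def by simp
qed

lemma min_op_attained:
  assumes "j \<in> {1..n}" "0 \<le> r"
  obtains q where "q \<in> x ` {1..n}" "norm (q - x j) \<le> r" "min_op x n r w (x j) = w q"
    "\<And>q. q \<in> x ` {1..n} \<Longrightarrow> norm (q - x j) \<le> r \<Longrightarrow> min_op x n r w (x j) \<le> w q"
proof -
  obtain q where q: "q \<in> x ` {1..n}" "norm (q - x j) \<le> r" "max_op x n r (\<lambda>q. - w q) (x j) = - w q"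
    "\<And>q. q \<in> x ` {1..n} \<Longrightarrow> norm (q - x j) \<le> r \<Longrightarrow> - w q \<le> max_op x n r (\<lambda>q. - w q) (x j)"
    using max_op_attained[OF assms, of x "\<lambda>q. - w q"] by metis
  show ?thesis
    by (rule that[of q]) (use q min_op_eq_max_op[OF assms, of x w] in fastforce)+
qed

lemma max_op_ge:
  assumes "j \<in> {1..n}" "0 \<le> r" "q \<in> x ` {1..n}" "norm (q - x j) \<le> r"
  shows "w q \<le> max_op x n r w (x j)"
proof -
  have "\<And>q. q \<in> x ` {1..n} \<Longrightarrow> norm (q - x j) \<le> r \<Longrightarrow> w q \<le> max_op x n r w (x j)"
    using max_op_attained[OF assms(1,2), of x w] by metis
  then show ?thesis
    using assms by blast
qed

lemma min_op_le:
  assumes "j \<in> {1..n}" "0 \<le> r" "q \<in> x ` {1..n}" "norm (q - x j) \<le> r"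
  shows "min_op x n r w (x j) \<le> w q"
  using max_op_ge[OF assms, of "\<lambda>q. - w q"] min_op_eq_max_op[OF assms(1,2), of x w] by simp

lemma step_sum_uminus:
  assumes "0 \<le> r"
  shows "step_sum \<eta> r \<epsilon> x n (\<lambda>q. - w q) z = - step_sum \<eta> r \<epsilon> x n w z"
  unfolding step_sum_def sum_negf[symmetric]
proof (rule sum.cong)
  fix j assume j: "j \<in> {1..n}"
  show "kernel_weight \<eta> \<epsilon> (norm (z - x j)) *
      (max_op x n r (\<lambda>q. - w q) (x j) + min_op x n r (\<lambda>q. - w q) (x j) - 2 * - w z)
    = - (kernel_weight \<eta> \<epsilon> (norm (z - x j)) * (max_op x n r w (x j) + min_op x n r w (x j) - 2 * w z))"
    unfolding min_op_eq_max_op[OF j assms] by (simp add: algebra_simps)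
qed simp

section \<open>Comparison and maximum principle on the cloud\<close>

lemma step_sum_mono_at_max:
  assumes \<eta>: "admissible_kernel \<eta>" and \<epsilon>: "0 < \<epsilon>" and r: "0 \<le> r"
    and max: "\<And>q. q \<in> x ` {1..n} \<Longrightarrow> u q - W q \<le> u z - W z"
  shows "step_sum \<eta> r \<epsilon> x n u z \<le> step_sum \<eta> r \<epsilon> x n W z"
  unfolding step_sum_def
proof (intro sum_mono mult_left_mono)
  fix j assume j: "j \<in> {1..n}"
  obtain q where q: "q \<in> x ` {1..n}" "norm (q - x j) \<le> r" "max_op x n r u (x j) = u q"
    by (rule max_op_attained[OF j r])
  obtain q' where q': "q' \<in> x ` {1..n}" "norm (q' - x j) \<le> r" "min_op x n r W (x j) = W q'"
    by (rule min_op_attained[OF j r])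
  have "W q \<le> max_op x n r W (x j)"
    by (rule max_op_ge[OF j r q(1,2)])
  moreover have "min_op x n r u (x j) \<le> u q'"
    by (rule min_op_le[OF j r q'(1,2)])
  ultimately show "max_op x n r u (x j) + min_op x n r u (x j) - 2 * u z
      \<le> max_op x n r W (x j) + min_op x n r W (x j) - 2 * W z"
    using q q' max[of q] max[of q'] by simp
qed (use kernel_weight_bounds[OF \<eta> \<epsilon>] in auto)

lemma step_sum_comparison:
  assumes \<eta>: "admissible_kernel \<eta>" and \<epsilon>: "0 < \<epsilon>" and r: "0 \<le> r"
    and step: "\<And>z. z \<in> x ` {1..n} - A \<Longrightarrow> step_sum \<eta> r \<epsilon> x n W z < step_sum \<eta> r \<epsilon> x n u z"
    and bdry: "\<And>z. z \<in> x ` {1..n} \<inter> A \<Longrightarrow> u z - W z \<le> c" and z: "z \<in> x ` {1..n}"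
  shows "u z - W z \<le> c"
proof -
  define m where "m = Max ((\<lambda>q. u q - W q) ` x ` {1..n})"
  have "m \<in> (\<lambda>q. u q - W q) ` x ` {1..n}"
    unfolding m_def using z by (intro Max_in) auto
  then obtain q where q: "q \<in> x ` {1..n}" "m = u q - W q"
    by auto
  have max: "u q' - W q' \<le> m" if "q' \<in> x ` {1..n}" for q'
    unfolding m_def using that by (intro Max_ge) auto
  have "q \<in> A"
  proof (rule ccontr)
    assume "q \<notin> A"
    then have "step_sum \<eta> r \<epsilon> x n W q < step_sum \<eta> r \<epsilon> x n u q"
      using step q by auto
    moreover have "step_sum \<eta> r \<epsilon> x n u q \<le> step_sum \<eta> r \<epsilon> x n W q"
      using max q by (intro step_sum_mono_at_max[OF \<eta> \<epsilon> r]) auto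
    ultimately show False
      by simp
  qed
  then show ?thesis
    using bdry[of q] q max[OF z] by auto
qed

text \<open>Barriers are strict supersolutions only near their pole, so the global bound needs
  another argument. At a maximum point outside \<open>L\<close> all summands are nonpositive with
  sum zero; a vanishing summand with positive weight forces the minimum around that neighbour up to
  \<open>m\<close>, and so the maximum propagates along edges of length below
  \<open>\<epsilon>\<close>.\<close>

lemma step_sum_maximum_principle:
  assumes \<eta>: "admissible_kernel \<eta>" and \<epsilon>: "0 < \<epsilon>" and r: "0 \<le> r"
    and conn: "\<And>A. A \<subseteq> x ` {1..n} \<Longrightarrow> A \<noteq> {} \<Longrightarrow>
        (\<And>a b. a \<in> A \<Longrightarrow> b \<in> x ` {1..n} \<Longrightarrow> norm (a - b) < \<epsilon> \<Longrightarrow> b \<in> A) \<Longrightarrow> A = x ` {1..n}"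
    and zero: "\<And>z. z \<in> x ` {1..n} - L \<Longrightarrow> step_sum \<eta> r \<epsilon> x n u z = 0"
    and L: "x ` {1..n} \<inter> L \<noteq> {}" "\<And>z. z \<in> L \<Longrightarrow> u z \<le> c" and z: "z \<in> x ` {1..n}"
  shows "u z \<le> c"
proof -
  define m where "m = Max (u ` x ` {1..n})"
  have "m \<in> u ` x ` {1..n}"
    unfolding m_def using z by (intro Max_in) auto
  then obtain q where q: "q \<in> x ` {1..n}" "m = u q"
    by auto
  have max: "u q' \<le> m" if "q' \<in> x ` {1..n}" for q'
    unfolding m_def using that by (intro Max_ge) auto
  define A where "A = {q \<in> x ` {1..n}. u q = m}"
  show ?thesis
  proof (cases "A \<inter> L = {}")
    case False
    then show ?thesis
      using L(2) max[OF z] by (fastforce simp: A_def)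
  next
    case True
    have "A = x ` {1..n}"
    proof (rule conn)
      show "A \<subseteq> x ` {1..n}" "A \<noteq> {}"
        using q by (auto simp: A_def)
      fix a b assume a: "a \<in> A" and b: "b \<in> x ` {1..n}" and ab: "norm (a - b) < \<epsilon>"
      obtain i where i: "i \<in> {1..n}" "b = x i"
        using b by auto
      have ua: "u a = m" and "a \<in> x ` {1..n} - L"
        using a True by (auto simp: A_def)
      have le: "max_op x n r u (x j) \<le> m" "min_op x n r u (x j) \<le> u (x j)" "u (x j) \<le> m"
        if j: "j \<in> {1..n}" for j
      proof -
        show "max_op x n r u (x j) \<le> m"
          by (rule max_op_attained[OF j r, of x u]) (use max in auto)
        show "min_op x n r u (x j) \<le> u (x j)"
          by (rule min_op_le[OF j r]) (use j r in auto)
        show "u (x j) \<le> m"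
          using j max by auto
      qed
      define f where "f j = kernel_weight \<eta> \<epsilon> (norm (a - x j)) *
        (max_op x n r u (x j) + min_op x n r u (x j) - 2 * u a)" for j
      have "sum f {1..n} = 0"
        using zero[OF \<open>a \<in> x ` {1..n} - L\<close>] by (simp add: step_sum_def f_def)
      moreover have "f j \<le> 0" if "j \<in> {1..n}" for j
        unfolding f_def using le[OF that] ua kernel_weight_bounds[OF \<eta> \<epsilon>, of "norm (a - x j)"]
        by (intro mult_nonneg_nonpos) auto
      ultimately have "f i = 0"
        using i sum_nonneg_eq_0_iff[of "{1..n}" "\<lambda>j. - f j"] by (auto simp: sum_negf)
      moreover have "1 \<le> kernel_weight \<eta> \<epsilon> (norm (a - x i))"
        using kernel_weight_bounds[OF \<eta> \<epsilon>, of "norm (a - x i)"] ab i by auto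
      ultimately have "max_op x n r u (x i) + min_op x n r u (x i) = 2 * m"
        using ua by (auto simp: f_def)
      then show "b \<in> A"
        using le[OF i(1)] b i by (simp add: A_def)
    qed
    then show ?thesis
      using L(1) True by auto
  qed
qed

text \<open>The balls of radius \<open>\<epsilon> / 2\<close> around \<open>A\<close> and those
  around \<open>S - A\<close> would be two disjoint open families covering the connected set
  \<open>\<Omega>\<close>.\<close>

lemma cover_connected:
  fixes \<Omega> :: "'a::euclidean_space set"
  assumes conn: "connected \<Omega>" and S: "S \<subseteq> \<Omega>"
    and cover: "\<And>y. y \<in> \<Omega> \<Longrightarrow> \<exists>q\<in>S. norm (y - q) < \<epsilon> / 2"
    and A: "A \<subseteq> S" "A \<noteq> {}" and closed: "\<And>a b. a \<in> A \<Longrightarrow> b \<in> S \<Longrightarrow> norm (a - b) < \<epsilon> \<Longrightarrow> b \<in> A"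
  shows "A = S"
proof -
  define U where "U B = (\<Union>a\<in>B. ball a (\<epsilon> / 2))" for B :: "'a set"
  have cov: "\<Omega> \<subseteq> U A \<union> U (S - A)"
    using cover by (force simp: U_def dist_norm norm_minus_commute)
  have disj: "U A \<inter> U (S - A) \<inter> \<Omega> = {}"
  proof -
    have False if "a \<in> A" "b \<in> S - A" "y \<in> ball a (\<epsilon>/2)" "y \<in> ball b (\<epsilon>/2)" for a b y
    proof -
      have "dist a b < \<epsilon>"
        using that dist_triangle[of a b y] by (simp add: dist_commute)
      then show False
        using closed[of a b] that by (simp add: dist_norm)
    qed
    then show ?thesis
      unfolding U_def by blast
  qed
  obtain a where a: "a \<in> A"
    using A by auto
  have "0 < \<epsilon>"
    using cover[of a] a A S by (smt (verit) subsetD norm_ge_zero half_gt_zero_iff)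
  then have "a \<in> ball a (\<epsilon> / 2)"
    by simp
  then have "a \<in> U A \<inter> \<Omega>"
    unfolding U_def using a A S by blast
  then have "U A \<inter> \<Omega> \<noteq> {}"
    by blast
  moreover have "open (U A)" "open (U (S - A))"
    by (auto simp: U_def)
  ultimately have "U (S - A) \<inter> \<Omega> = {}"
    using connectedD[OF conn, of "U A" "U (S - A)"] cov disj by auto
  moreover have "b \<in> U (S - A) \<inter> \<Omega>" if "b \<in> S - A" for b
    using that S \<open>0 < \<epsilon>\<close> by (auto simp: U_def intro!: bexI[of _ b])
  ultimately show ?thesis
    using A by auto
qed

section \<open>Sums over the cloud as integrals through the transport map\<close>

lemma transport_sum:
  fixes \<Omega> :: "'a::euclidean_space set" and f :: "'a \<Rightarrow> real"
  assumes op: "open \<Omega>" and T: "transport_map \<Omega> \<rho> x n T" and n: "0 < n"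
    and \<rho>: "continuous_on \<Omega> \<rho>" "\<And>y. y \<in> \<Omega> \<Longrightarrow> 0 \<le> \<rho> y"
    and f [measurable]: "f \<in> borel_measurable borel"
  shows "(\<Sum>j=1..n. f (x j)) / n = (LINT y:\<Omega>|lborel. \<rho> y * f (T y))"
proof -
  have \<Omega> [measurable]: "\<Omega> \<in> sets borel"
    using op by simp
  have \<rho>m: "\<rho> \<in> borel_measurable (restrict_space lborel \<Omega>)"
    using borel_measurable_continuous_on_restrict[OF \<rho>(1)]
    by (simp add: measurable_def space_restrict_space sets_restrict_space)
  have Tm0: "T \<in> measurable (density_measure \<Omega> \<rho>) borel"
    using T by (simp add: transport_map_def)
  then have Tm: "T \<in> measurable (restrict_space lborel \<Omega>) borel"
    by (simp add: density_measure_def)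
  have "(\<Sum>j=1..n. f (x j)) / n = integral\<^sup>L (uniform_count_measure {1..n}) (\<lambda>i. f (x i))"
    by (simp add: integral_uniform_count_measure)
  also have "\<dots> = integral\<^sup>L (empirical_measure x n) f"
  proof -
    have "x \<in> measurable (uniform_count_measure {1..n}) borel"
      by (auto simp: measurable_def space_uniform_count_measure sets_uniform_count_measure)
    then show ?thesis
      unfolding empirical_measure_def by (rule integral_distr[symmetric]) (rule f)
  qed
  also have "\<dots> = integral\<^sup>L (distr (density_measure \<Omega> \<rho>) borel T) f"
    using T by (simp add: transport_map_def)
  also have "\<dots> = integral\<^sup>L (density_measure \<Omega> \<rho>) (\<lambda>y. f (T y))"
    by (rule integral_distr[OF Tm0 f])
  also have "\<dots> = integral\<^sup>L (restrict_space lborel \<Omega>) (\<lambda>y. \<rho> y *\<^sub>R f (T y))"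
    unfolding density_measure_def
  proof (rule integral_density)
    show "(\<lambda>y. f (T y)) \<in> borel_measurable (restrict_space lborel \<Omega>)"
      using Tm f by (rule measurable_compose)
    show "AE y in restrict_space lborel \<Omega>. 0 \<le> \<rho> y"
      using \<rho>(2) by (auto simp: space_restrict_space intro!: AE_I2)
  qed (use \<rho>m in simp)
  also have "\<dots> = (LINT y:\<Omega>|lborel. \<rho> y * f (T y))"
    unfolding set_lebesgue_integral_def
    by (subst integral_restrict_space) simp_all
  finally show ?thesis .
qed

lemma displacement_AE:
  assumes op: "open \<Omega>" and "Linf_displacement \<Omega> T \<le> ereal \<delta>"
  shows "AE y in lborel. y \<in> \<Omega> \<longrightarrow> norm (y - T y) \<le> \<delta>"
proof -
  have "AE y in restrict_space lborel \<Omega>. ereal (norm (y - T y)) \<le> Linf_displacement \<Omega> T"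
    unfolding Linf_displacement_def by (rule esssup_AE)
  then have "AE y in restrict_space lborel \<Omega>. norm (y - T y) \<le> \<delta>"
    by eventually_elim (use assms(2) in \<open>metis ereal_less_eq(3) order_trans\<close>)
  then show ?thesis
    using op by (simp add: AE_restrict_space_iff)
qed

text \<open>The displacement bound holds only almost everywhere, so a good point is chosen in a
  small ball around \<open>y\<close>; this turns \<open>\<delta>\<close> into
  \<open>2 * \<delta>\<close>.\<close>

lemma transport_cover:
  fixes \<Omega> :: "'a::euclidean_space set" and \<delta> :: real
  assumes op: "open \<Omega>" and T: "T ` \<Omega> \<subseteq> S" and \<delta>: "0 < \<delta>"
    and AE: "AE y in lborel. y \<in> \<Omega> \<longrightarrow> norm (y - T y) \<le> \<delta>" and y: "y \<in> \<Omega>"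
  shows "\<exists>q\<in>S. norm (y - q) < 2 * \<delta>"
proof -
  obtain r where r: "0 < r" "ball y r \<subseteq> \<Omega>"
    using op y openE by blast
  define B where "B = ball y (min r \<delta>)"
  have "\<exists>w\<in>B. norm (w - T w) \<le> \<delta>"
  proof (rule ccontr)
    assume "\<not> (\<exists>w\<in>B. norm (w - T w) \<le> \<delta>)"
    then have "AE w in lborel. w \<notin> B"
      using AE r by (auto simp: B_def elim!: eventually_mono)
    then have "emeasure lborel B = 0"
      by (subst (asm) AE_iff_measurable[of B]) (auto simp: B_def)
    moreover have "0 < emeasure lborel B"
      unfolding B_def using r \<delta> by (subst emeasure_ball) (simp_all add: unit_ball_vol_pos)
    ultimately show False
      by simp
  qed
  then obtain w where w: "w \<in> B" "norm (w - T w) \<le> \<delta>"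
    by auto
  have "norm (y - w) < \<delta>" "w \<in> \<Omega>"
    using w r by (auto simp: B_def dist_norm)
  moreover have "norm (y - T w) \<le> norm (y - w) + norm (w - T w)"
    using norm_triangle_ineq[of "y - w" "w - T w"] by simp
  ultimately show ?thesis
    using w(2) T by (intro bexI[of _ "T w"]) auto
qed

lemma lborel_integral_affine:
  fixes f :: "'a::euclidean_space \<Rightarrow> real"
  assumes f [measurable]: "f \<in> borel_measurable borel" and c: "0 < c"
  shows "(LINT y|lborel. f y) = c ^ DIM('a) * (LINT v|lborel. f (z + c *\<^sub>R v))"
proof -
  have "(LINT y|lborel. f y) = (LINT y|density (distr lborel borel (\<lambda>v. z + c *\<^sub>R v)) (\<lambda>_. \<bar>c\<bar> ^ DIM('a)). f y)"
    using c by (subst lborel_affine[of c z]) auto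
  also have "\<dots> = (LINT y|distr lborel borel (\<lambda>v. z + c *\<^sub>R v). \<bar>c\<bar> ^ DIM('a) *\<^sub>R f y)"
    by (subst integral_density) auto
  also have "\<dots> = (LINT v|lborel. \<bar>c\<bar> ^ DIM('a) *\<^sub>R f (z + c *\<^sub>R v))"
    by (subst integral_distr) auto
  finally show ?thesis
    using c by simp
qed

lemma ball_annulus_measure:
  fixes z :: "'a::euclidean_space"
  assumes "0 \<le> \<delta>" "\<delta> \<le> \<epsilon>"
  shows "measure lborel (ball z (\<epsilon> + \<delta>)) - measure lborel (ball z (\<epsilon> - \<delta>))
    \<le> unit_ball_vol DIM('a) * (2 * \<delta> * DIM('a) * (2 * \<epsilon>) ^ (DIM('a) - 1))"
proof -
  define d where "d = DIM('a)"
  have d: "d = Suc (d - 1)"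
    using DIM_positive[where 'a = 'a] by (simp add: d_def)
  have "(\<epsilon> + \<delta>) ^ d - (\<epsilon> - \<delta>) ^ d = (2 * \<delta>) * (\<Sum>i<d. (\<epsilon> + \<delta>) ^ i * (\<epsilon> - \<delta>) ^ (d - 1 - i))"
    using diff_power_eq_sum[of "\<epsilon> + \<delta>" "d - 1" "\<epsilon> - \<delta>"] unfolding d[symmetric]
    by (simp del: sum.lessThan_Suc)
  also have "\<dots> \<le> (2 * \<delta>) * (\<Sum>i<d. (2 * \<epsilon>) ^ i * (2 * \<epsilon>) ^ (d - 1 - i))"
    using assms by (intro mult_left_mono sum_mono mult_mono power_mono) auto
  also have "\<dots> = (2 * \<delta>) * (\<Sum>i<d. (2 * \<epsilon>) ^ (d - 1))"
    by (intro arg_cong[of _ _ "\<lambda>t. 2 * \<delta> * t"] sum.cong refl, subst power_add[symmetric]) simp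
  also have "\<dots> = 2 * \<delta> * d * (2 * \<epsilon>) ^ (d - 1)"
    by simp
  finally have "unit_ball_vol d * ((\<epsilon> + \<delta>) ^ d - (\<epsilon> - \<delta>) ^ d) \<le> unit_ball_vol d * (2 * \<delta> * d * (2 * \<epsilon>) ^ (d - 1))"
    by (intro mult_left_mono) auto
  then show ?thesis
    using assms by (simp add: content_ball d_def algebra_simps)
qed

text \<open>Moving the mass by \<open>\<delta>\<close> only matters through the modulus of continuity inside the ball and
  through the annulus where \<open>\<psi>\<close> is cut off.\<close>

lemma transport_sum_le:
  fixes \<Omega> :: "'a::euclidean_space set" and \<psi> :: "'a \<Rightarrow> real" and \<delta> \<epsilon> \<Lambda> B H \<rho>M :: real
  assumes op: "open \<Omega>" and bdd: "bounded \<Omega>" and T: "transport_map \<Omega> \<rho> x n T" and n: "0 < n"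
    and \<rho>: "continuous_on \<Omega> \<rho>" "\<And>y. y \<in> \<Omega> \<Longrightarrow> 0 \<le> \<rho> y" "\<And>y. y \<in> \<Omega> \<Longrightarrow> \<rho> y \<le> \<rho>M"
    and AE: "AE y in lborel. y \<in> \<Omega> \<longrightarrow> norm (y - T y) \<le> \<delta>" and \<delta>: "0 \<le> \<delta>" "\<delta> \<le> \<epsilon>" and \<epsilon>: "0 < \<epsilon>"
    and \<psi>: "\<psi> \<in> borel_measurable borel" "\<And>v. \<epsilon> \<le> norm v \<Longrightarrow> \<psi> v = 0" "\<And>v. \<bar>\<psi> v\<bar> \<le> B"
      "\<And>v w. norm v < \<epsilon> \<Longrightarrow> norm w < \<epsilon> \<Longrightarrow> \<bar>\<psi> v - \<psi> w\<bar> \<le> \<Lambda> * norm (v - w)"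
    and \<Lambda>: "0 \<le> \<Lambda>"
    and nonneg: "0 \<le> H" "0 \<le> \<rho>M"
    and osc: "\<And>y. y \<in> \<Omega> \<Longrightarrow> norm (y - z) < \<epsilon> \<Longrightarrow> \<bar>\<rho> y - \<rho> z\<bar> \<le> H"
  shows "(\<Sum>j=1..n. \<psi> (x j - z)) / n
    \<le> \<rho> z * (LINT y:\<Omega>|lborel. \<psi> (y - z))
      + unit_ball_vol DIM('a) * (2 * \<epsilon>) ^ DIM('a) * (H * B + \<rho>M * (\<Lambda> * \<delta> + DIM('a) * B * \<delta> / \<epsilon>))"
proof -
  define d where "d = DIM('a)"
  define V where "V = ball z (\<epsilon> + \<delta>)"
  define W where "W = V - ball z (\<epsilon> - \<delta>)"
  note [measurable] = \<psi>(1)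
  have B: "0 \<le> B"
    using \<psi>(3) abs_ge_zero order_trans by blast
  have \<Omega> [measurable]: "\<Omega> \<in> sets borel" and V [measurable]: "V \<in> sets borel" and W [measurable]: "W \<in> sets borel"
    using op by (auto simp: V_def W_def)
  have \<rho>m [measurable]: "(\<lambda>y. indicator \<Omega> y * \<rho> y) \<in> borel_measurable borel"
    using borel_measurable_continuous_on_indicator[OF _ \<rho>(1)] op by simp
  have Tm: "T \<in> measurable (restrict_space lborel \<Omega>) borel"
    using T by (simp add: transport_map_def density_measure_def)
  have Tm' [measurable]: "(\<lambda>y. indicator \<Omega> y * \<psi> (T y - z)) \<in> borel_measurable borel"
  proof -
    have "(\<lambda>y. \<psi> (T y - z)) \<in> borel_measurable (restrict_space lborel \<Omega>)"
      using Tm by measurable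
    then show ?thesis
      by (subst (asm) borel_measurable_restrict_space_iff) (simp_all add: mult.commute)
  qed
  have fin: "emeasure lborel A < \<infinity>" if "bounded A" for A :: "'a set"
    using emeasure_bounded_finite[OF that] by (simp add: less_top)
  have finV: "emeasure lborel V < \<infinity>" "emeasure lborel W < \<infinity>"
    unfolding V_def W_def by (rule fin, use bounded_ball in \<open>blast intro: bounded_subset\<close>)+
  have int1: "integrable lborel (\<lambda>y. indicator \<Omega> y * (\<rho> y * \<psi> (T y - z)))"
  proof -
    have "integrable lborel (\<lambda>y. indicator \<Omega> y *\<^sub>R (\<rho>M * B))"
      using fin[OF bdd] by (intro integrable_scaleR_left) simp
    then show ?thesis
    proof (rule Bochner_Integration.integrable_bound)
      have "(\<lambda>y. (indicator \<Omega> y * \<rho> y) * (indicator \<Omega> y * \<psi> (T y - z))) \<in> borel_measurable borel"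
        by measurable
      also have "(\<lambda>y. (indicator \<Omega> y * \<rho> y) * (indicator \<Omega> y * \<psi> (T y - z)))
          = (\<lambda>y. indicator \<Omega> y * (\<rho> y * \<psi> (T y - z)))"
        by (auto simp: indicator_def)
      finally show "(\<lambda>y. indicator \<Omega> y * (\<rho> y * \<psi> (T y - z))) \<in> borel_measurable lborel"
        by simp
      show "AE y in lborel. norm (indicat_real \<Omega> y * (\<rho> y * \<psi> (T y - z))) \<le> norm (indicator \<Omega> y *\<^sub>R (\<rho>M * B))"
      proof (rule AE_I2)
        fix y
        show "norm (indicat_real \<Omega> y * (\<rho> y * \<psi> (T y - z))) \<le> norm (indicator \<Omega> y *\<^sub>R (\<rho>M * B))"
        proof (cases "y \<in> \<Omega>")
          case True
          have "\<rho> y * \<bar>\<psi> (T y - z)\<bar> \<le> \<rho>M * B"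
            using \<rho>(2,3)[OF True] nonneg(2) \<psi>(3) by (intro mult_mono) auto
          then show ?thesis
            using True \<rho>(2)[OF True] nonneg(2) B by (simp add: abs_mult)
        qed simp
      qed
    qed
  qed
  have int2: "set_integrable lborel \<Omega> (\<lambda>y. \<psi> (y - z))"
    by (rule set_integrable_bounded[OF _ \<Omega> bdd, of _ B]) (use \<psi>(3) in auto)
  \<comment> \<open>Three sources: freezing the density at \<open>z\<close>; the oscillation of
    \<open>\<psi>\<close> under a displacement \<open>\<delta>\<close> when both points lie inside
    the cut-off; and, on the annulus \<open>W\<close>, points that cross the cut-off, where only the
    bound \<open>B\<close> is available.\<close>
  define err where "err y = H * B * indicator (ball z \<epsilon>) y + \<rho>M * (\<Lambda> * \<delta> * indicator V y + B * indicator W y)" for y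
  have int3: "integrable lborel (\<lambda>y. indicator \<Omega> y * err y)"
  proof -
    have "set_integrable lborel \<Omega> err"
    proof (rule set_integrable_bounded[OF _ \<Omega> bdd])
      have [measurable]: "ball z \<epsilon> \<in> sets borel"
        by simp
      show "err \<in> borel_measurable borel"
        unfolding err_def by (intro borel_measurable_add borel_measurable_times borel_measurable_const borel_measurable_indicator)
          (use V W in auto)
      have "0 \<le> H * B" "0 \<le> \<rho>M * (\<Lambda> * \<delta>)" "0 \<le> \<rho>M * B"
        using nonneg B \<Lambda> \<delta> by auto
      then show "\<bar>err y\<bar> \<le> H * B + \<rho>M * (\<Lambda> * \<delta> + B)" for y
        unfolding err_def by (auto simp: indicator_def distrib_left)
    qed
    then show ?thesis
      by (simp add: set_integrable_def)
  qed
  have "(\<Sum>j=1..n. \<psi> (x j - z)) / n = (LINT y:\<Omega>|lborel. \<rho> y * \<psi> (T y - z))"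
    using transport_sum[OF op T n \<rho>(1,2), of "\<lambda>w. \<psi> (w - z)"] by simp
  also have "\<dots> \<le> (LINT y|lborel. \<rho> z * (indicator \<Omega> y * \<psi> (y - z)) + indicator \<Omega> y * err y)"
    unfolding set_lebesgue_integral_def real_scaleR_def
  proof (rule integral_mono_AE)
    show "integrable lborel (\<lambda>y. \<rho> z * (indicator \<Omega> y * \<psi> (y - z)) + indicator \<Omega> y * err y)"
      using int2 int3 by (intro Bochner_Integration.integrable_add integrable_mult_right)
        (simp_all add: set_integrable_def)
    show "AE y in lborel. indicat_real \<Omega> y * (\<rho> y * \<psi> (T y - z))
        \<le> \<rho> z * (indicator \<Omega> y * \<psi> (y - z)) + indicator \<Omega> y * err y"
      using AE
    proof eventually_elim
      fix y assume Ty: "y \<in> \<Omega> \<longrightarrow> norm (y - T y) \<le> \<delta>"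
      show "indicat_real \<Omega> y * (\<rho> y * \<psi> (T y - z))
          \<le> \<rho> z * (indicator \<Omega> y * \<psi> (y - z)) + indicator \<Omega> y * err y"
      proof (cases "y \<in> \<Omega>")
        case True
        define a b where "a = norm (y - z)" and "b = norm (T y - z)"
        have ab: "\<bar>a - b\<bar> \<le> \<delta>"
          using Ty True norm_triangle_ineq3[of "y - z" "T y - z"] by (simp add: a_def b_def)
        have V: "y \<in> V \<longleftrightarrow> a < \<epsilon> + \<delta>" and W: "y \<in> W \<longleftrightarrow> a < \<epsilon> + \<delta> \<and> \<epsilon> - \<delta> \<le> a"
          by (auto simp: V_def W_def a_def dist_norm norm_minus_commute)
        have diff: "\<psi> (T y - z) - \<psi> (y - z) \<le> \<Lambda> * \<delta> * indicator V y + B * indicator W y"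
        proof -
          have t: "\<Lambda> * norm ((T y - z) - (y - z)) \<le> \<Lambda> * \<delta>"
            using Ty True \<Lambda> by (intro mult_left_mono) (auto simp: norm_minus_commute)
          have \<Lambda>\<delta>: "0 \<le> \<Lambda> * \<delta>"
            using \<Lambda> \<delta> by simp
          consider "a < \<epsilon>" "b < \<epsilon>" | "\<epsilon> \<le> a" "\<epsilon> \<le> b" | "a < \<epsilon>" "\<epsilon> \<le> b" | "\<epsilon> \<le> a" "b < \<epsilon>"
            by linarith
          then show ?thesis
          proof cases
            case 1
            then have "\<bar>\<psi> (T y - z) - \<psi> (y - z)\<bar> \<le> \<Lambda> * \<delta>"
              using \<psi>(4)[of "T y - z" "y - z"] t by (simp add: a_def b_def)
            moreover have "y \<in> V"
              using V 1 \<delta> by simp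
            ultimately show ?thesis
              using B by (auto simp: indicator_def abs_le_iff)
          next
            case 2
            then show ?thesis
              using \<psi>(2)[of "y - z"] \<psi>(2)[of "T y - z"] B \<Lambda>\<delta> by (simp add: a_def b_def indicator_def)
          next
            case 3
            then have "y \<in> W" "\<psi> (T y - z) = 0"
              using W ab \<delta> \<psi>(2)[of "T y - z"] by (auto simp: b_def)
            then show ?thesis
              using \<psi>(3)[of "y - z"] \<Lambda>\<delta> by (simp add: indicator_def abs_le_iff)
          next
            case 4
            then have "y \<in> W" "\<psi> (y - z) = 0"
              using W ab \<delta> \<psi>(2)[of "y - z"] by (auto simp: a_def)
            then show ?thesis
              using \<psi>(3)[of "T y - z"] \<Lambda>\<delta> by (simp add: indicator_def abs_le_iff)
          qed
        qed
        have "0 \<le> \<Lambda> * \<delta> * indicator V y + B * indicator W y"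
          using \<Lambda> \<delta> B by simp
        then have "\<rho> y * (\<psi> (T y - z) - \<psi> (y - z)) \<le> \<rho>M * (\<Lambda> * \<delta> * indicator V y + B * indicator W y)"
          using mult_left_mono[OF diff \<rho>(2)[OF True]] mult_right_mono[OF \<rho>(3)[OF True]] by (meson order_trans)
        moreover have "(\<rho> y - \<rho> z) * \<psi> (y - z) \<le> H * B * indicator (ball z \<epsilon>) y"
        proof (cases "a < \<epsilon>")
          case a: True
          have "(\<rho> y - \<rho> z) * \<psi> (y - z) \<le> \<bar>\<rho> y - \<rho> z\<bar> * \<bar>\<psi> (y - z)\<bar>"
            by (simp add: abs_mult[symmetric])
          also have "\<dots> \<le> H * B"
            using osc[OF True] a \<psi>(3) by (intro mult_mono) (auto simp: a_def intro: order_trans[OF abs_ge_zero])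
          finally show ?thesis
            using a by (simp add: a_def dist_norm norm_minus_commute)
        next
          case False
          then show ?thesis
            using \<psi>(2)[of "y - z"] by (simp add: a_def dist_norm norm_minus_commute)
        qed
        ultimately show ?thesis
          using True by (simp add: err_def algebra_simps)
      qed simp
    qed
  qed (use int1 in simp)
  also have "\<dots> = \<rho> z * (LINT y:\<Omega>|lborel. \<psi> (y - z)) + (LINT y:\<Omega>|lborel. err y)"
    unfolding set_lebesgue_integral_def real_scaleR_def
    using int2 int3 by (subst Bochner_Integration.integral_add) (simp_all add: set_integrable_def)
  also have "(LINT y:\<Omega>|lborel. err y)
    \<le> unit_ball_vol d * (2 * \<epsilon>) ^ d * (H * B + \<rho>M * (\<Lambda> * \<delta> + d * B * \<delta> / \<epsilon>))"
  proof -
    define X where "X = unit_ball_vol d * (2 * \<epsilon>) ^ d"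
    have mV: "measure lborel V \<le> X" "measure lborel (ball z \<epsilon>) \<le> X"
    proof -
      have "(\<epsilon> + \<delta>) ^ d \<le> (2 * \<epsilon>) ^ d" "\<epsilon> ^ d \<le> (2 * \<epsilon>) ^ d"
        using \<delta> \<epsilon> by (intro power_mono; simp)+
      then have "unit_ball_vol d * (\<epsilon> + \<delta>) ^ d \<le> X" "unit_ball_vol d * \<epsilon> ^ d \<le> X"
        unfolding X_def by (intro mult_left_mono; simp)+
      then show "measure lborel V \<le> X" "measure lborel (ball z \<epsilon>) \<le> X"
        using \<delta> \<epsilon> by (simp_all add: V_def content_ball d_def)
    qed
    have dS: "d = Suc (d - 1)"
      using DIM_positive[where 'a = 'a] by (simp add: d_def)
    have "measure lborel W = measure lborel V - measure lborel (ball z (\<epsilon> - \<delta>))"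
      unfolding W_def using finV \<delta> by (intro measure_Diff) (auto simp: V_def less_top)
    also have "\<dots> \<le> unit_ball_vol d * (2 * \<delta> * d * (2 * \<epsilon>) ^ (d - 1))"
      unfolding V_def d_def using \<delta> by (rule ball_annulus_measure)
    also have "\<dots> = X * (d * \<delta> / \<epsilon>)"
      using \<epsilon> unfolding X_def by (subst (5) dS) (simp add: field_simps)
    finally have mW: "measure lborel W \<le> X * (d * \<delta> / \<epsilon>)" .
    have finb: "emeasure lborel (ball z \<epsilon>) < \<infinity>"
      by (rule emeasure_lborel_ball_finite)
    have "(LINT y:\<Omega>|lborel. err y) \<le> (LINT y|lborel. err y)"
      unfolding set_lebesgue_integral_def real_scaleR_def
    proof (rule integral_mono[OF int3])
      show "integrable lborel err"
        unfolding err_def using finV finb by (intro Bochner_Integration.integrable_add integrable_mult_right) simp_all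
      show "indicat_real \<Omega> y * err y \<le> err y" for y
        using nonneg B \<Lambda> \<delta> by (auto simp: indicator_def err_def)
    qed
    also have "\<dots> = H * B * measure lborel (ball z \<epsilon>) + \<rho>M * (\<Lambda> * \<delta> * measure lborel V + B * measure lborel W)"
      unfolding err_def using finV finb by (simp add: Bochner_Integration.integral_add)
    also have "\<dots> \<le> H * B * X + \<rho>M * (\<Lambda> * \<delta> * X + B * (X * (d * \<delta> / \<epsilon>)))"
      using mV mW nonneg B \<Lambda> \<delta> by (intro add_mono mult_left_mono mult_nonneg_nonneg) auto
    also have "\<dots> = X * (H * B + \<rho>M * (\<Lambda> * \<delta> + d * B * \<delta> / \<epsilon>))"
      by (simp add: algebra_simps)
    finally show ?thesis
      by (simp add: X_def)
  qed
  finally show ?thesis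
    by (simp add: d_def)
qed

subsection \<open>The barrier\<close>

text \<open>Over a full ball the linear part is odd and disappears; by isotropy the quadratic part
  reduces to the two kernel moments.\<close>

lemma kernel_quadratic_integral:
  fixes u l :: "'a::euclidean_space" and b c :: real
  assumes \<eta>: "admissible_kernel \<eta>" and u: "norm u = 1"
  shows "set_integrable lborel (ball 0 1) (\<lambda>v. \<eta> (norm v) * (l \<bullet> v + ((norm v)\<^sup>2 - c * (u \<bullet> v)\<^sup>2 - b)))"
    "(LINT v:ball 0 1|lborel. \<eta> (norm v) * (l \<bullet> v + ((norm v)\<^sup>2 - c * (u \<bullet> v)\<^sup>2 - b)))
     = (DIM('a) - c) * (2 * sigma1 TYPE('a) \<eta>) - b * (2 * sigma2 TYPE('a) \<eta>)"
proof -
  note [measurable] = borel_measurable_kernel_norm[OF \<eta>]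
  have B: "ball (0::'a) 1 \<in> sets borel" "ball (0::'a) 1 \<subseteq> ball 0 1"
    by auto
  have i1: "set_integrable lborel (ball (0::'a) 1) (\<lambda>v. \<eta> (norm v) * (l \<bullet> v))"
  proof (rule unit_ball_kernel_integrable(1)[OF \<eta> _ B])
    fix v :: 'a assume "v \<in> ball 0 1"
    then have "norm l * norm v \<le> norm l * 1"
      by (intro mult_left_mono) auto
    then show "\<bar>l \<bullet> v\<bar> \<le> norm l"
      using Cauchy_Schwarz_ineq2[of l v] by simp
  qed simp
  have i2: "set_integrable lborel (ball (0::'a) 1) (\<lambda>v. \<eta> (norm v) * (norm v)\<^sup>2)"
    by (rule unit_ball_kernel_integrable(1)[OF \<eta> _ B, where C = 1]) (auto simp: abs_square_le_1)
  have i3: "set_integrable lborel (ball (0::'a) 1) (\<lambda>v. \<eta> (norm v) * (v \<bullet> u)\<^sup>2)"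
    by (rule unit_ball_kernel_integrable(1)[OF \<eta> _ B, where C = 1])
       (use u in \<open>auto simp: abs_square_le_1 intro!: abs_inner_le_one\<close>)
  have i4: "set_integrable lborel (ball (0::'a) 1) (\<lambda>v. \<eta> (norm v))"
    using unit_ball_kernel_integrable(1)[OF \<eta> _ B, of "\<lambda>_. 1" 1] by simp
  have eq: "(\<lambda>v. \<eta> (norm v) * (l \<bullet> v + ((norm v)\<^sup>2 - c * (u \<bullet> v)\<^sup>2 - b)))
      = (\<lambda>v. \<eta> (norm v) * (l \<bullet> v) + (\<eta> (norm v) * (norm v)\<^sup>2 - c * (\<eta> (norm v) * (v \<bullet> u)\<^sup>2) - b * \<eta> (norm v)))"
    by (auto simp: algebra_simps inner_commute)
  have i5: "set_integrable lborel (ball (0::'a) 1)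
      (\<lambda>v. \<eta> (norm v) * (norm v)\<^sup>2 - c * (\<eta> (norm v) * (v \<bullet> u)\<^sup>2))"
    using i2 set_integrable_mult_right[OF i3, of c] by (intro set_integral_diff) auto
  have i6: "set_integrable lborel (ball (0::'a) 1) (\<lambda>v. b * \<eta> (norm v))"
    using i4 by simp
  show "set_integrable lborel (ball 0 1) (\<lambda>v. \<eta> (norm v) * (l \<bullet> v + ((norm v)\<^sup>2 - c * (u \<bullet> v)\<^sup>2 - b)))"
    unfolding eq by (intro set_integral_add set_integral_diff i1 i5 i6)
  have "(LINT v|lborel. indicator (ball 0 1) v *\<^sub>R (\<eta> (norm v) * (l \<bullet> v))) = 0"
  proof -
    have "orthogonal_transformation (uminus :: 'a \<Rightarrow> 'a)"
      by (simp add: orthogonal_transformation linear_uminus)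
    from integral_orthogonal[OF this, of "\<lambda>v. indicator (ball 0 1) v *\<^sub>R (\<eta> (norm v) * (l \<bullet> v))"]
    show ?thesis
      by (simp add: indicator_def)
  qed
  then have "(LINT v:ball 0 1|lborel. \<eta> (norm v) * (l \<bullet> v)) = 0"
    by (simp add: set_lebesgue_integral_def)
  moreover have "(LINT v:ball (0::'a) 1|lborel. \<eta> (norm v)) = 2 * sigma2 TYPE('a) \<eta>"
    by (simp add: sigma2_def)
  ultimately show "(LINT v:ball 0 1|lborel. \<eta> (norm v) * (l \<bullet> v + ((norm v)\<^sup>2 - c * (u \<bullet> v)\<^sup>2 - b)))
     = (DIM('a) - c) * (2 * sigma1 TYPE('a) \<eta>) - b * (2 * sigma2 TYPE('a) \<eta>)"
    unfolding eq set_integral_add(2)[OF i1 set_integral_diff(1)[OF i5 i6]] set_integral_diff(2)[OF i5 i6]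
      set_integral_diff(2)[OF i2 set_integrable_mult_right[OF i3, of c]] set_integral_mult_right
      kernel_second_moment[OF \<eta> u] kernel_norm_moment[OF \<eta>]
    by (simp add: algebra_simps)
qed

text \<open>After \<open>y = z + \<epsilon> *\<^sub>R v\<close> the linear part acquires the factor
  \<open>2 * R / \<epsilon>\<close> relative to the quadratic part. The full ball is explicit; on
  the missing cap \<open>D\<close> the quadratic part is at least \<open>- Q\<close>, and
  \<open>cap\<close> is the statement that the linear part compensates for it.\<close>

lemma kernel_quadratic_integral_le:
  fixes \<Omega> :: "'a::euclidean_space set" and z u l :: 'a and \<epsilon> b c Q \<tau> :: real
  assumes \<eta>: "admissible_kernel \<eta>" and op: "open \<Omega>" and u: "norm u = 1" and \<epsilon>: "0 < \<epsilon>"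
    and c: "0 \<le> c" and Q: "c + b \<le> Q"
    and D: "D = {v \<in> ball 0 1. z + \<epsilon> *\<^sub>R v \<notin> \<Omega>}" and l: "l = R *\<^sub>R m"
    and cap: "Q * (LINT v:D|lborel. \<eta> (norm v)) - (2 * R / \<epsilon>) * (LINT v:D|lborel. \<eta> (norm v) * (m \<bullet> v)) \<le> \<tau>"
  shows "(LINT y:\<Omega>|lborel. kernel_weight \<eta> \<epsilon> (norm (y - z)) *
      (2 * (l \<bullet> (y - z)) + (norm (y - z))\<^sup>2 - c * (u \<bullet> (y - z))\<^sup>2 - b * \<epsilon>\<^sup>2))
    \<le> \<epsilon> ^ (DIM('a) + 2) * ((DIM('a) - c) * (2 * sigma1 TYPE('a) \<eta>) - b * (2 * sigma2 TYPE('a) \<eta>) + \<tau>)"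
proof -
  note [measurable] = borel_measurable_kernel_norm[OF \<eta>]
  define R' where "R' = 2 * R / \<epsilon>"
  define q where "q v = (norm v)\<^sup>2 - c * (u \<bullet> v)\<^sup>2 - b" for v
  define f where "f v = \<eta> (norm v) * (R' * (m \<bullet> v) + q v)" for v
  have \<Omega> [measurable]: "\<Omega> \<in> sets borel"
    using op by simp
  have Dm [measurable]: "D \<in> sets borel"
    unfolding D by measurable
  have Db: "D \<subseteq> ball 0 1"
    by (auto simp: D)
  have fb: "set_integrable lborel (ball 0 1) f"
    "(LINT v:ball 0 1|lborel. f v) = (DIM('a) - c) * (2 * sigma1 TYPE('a) \<eta>) - b * (2 * sigma2 TYPE('a) \<eta>)"
    using kernel_quadratic_integral[OF \<eta> u, of "R' *\<^sub>R m" c b] unfolding f_def q_def by simp_all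
  have kw: "kernel_weight \<eta> \<epsilon> (norm w) = (indicator {..<\<epsilon>} (norm w) * \<eta> (norm (w /\<^sub>R \<epsilon>)))" for w :: 'a
    using \<epsilon> by (simp add: kernel_weight_def divide_inverse mult.commute)
  define g where "g y = indicator \<Omega> y *\<^sub>R (kernel_weight \<eta> \<epsilon> (norm (y - z)) *
      (2 * (l \<bullet> (y - z)) + (norm (y - z))\<^sup>2 - c * (u \<bullet> (y - z))\<^sup>2 - b * \<epsilon>\<^sup>2))" for y
  have [measurable]: "g \<in> borel_measurable borel"
    unfolding g_def kw by measurable
  have "(LINT y|lborel. g y) = \<epsilon> ^ DIM('a) * (LINT v|lborel. g (z + \<epsilon> *\<^sub>R v))"
    by (rule lborel_integral_affine) (use \<epsilon> in auto)
  also have "(LINT v|lborel. g (z + \<epsilon> *\<^sub>R v)) = (LINT v|lborel. \<epsilon>\<^sup>2 * (indicator (ball 0 1 - D) v *\<^sub>R f v))"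
  proof (rule Bochner_Integration.integral_cong)
    fix v :: 'a
    have ind: "indicator \<Omega> (z + \<epsilon> *\<^sub>R v) * indicator {..<\<epsilon>} (norm (\<epsilon> *\<^sub>R v)) = (indicator (ball 0 1 - D) v :: real)"
      using \<epsilon> by (auto simp: indicator_def D)
    have quad: "2 * (l \<bullet> (\<epsilon> *\<^sub>R v)) + (norm (\<epsilon> *\<^sub>R v))\<^sup>2 - c * (u \<bullet> (\<epsilon> *\<^sub>R v))\<^sup>2 - b * \<epsilon>\<^sup>2
        = \<epsilon>\<^sup>2 * (R' * (m \<bullet> v) + q v)"
      using \<epsilon> by (simp add: R'_def q_def l power_mult_distrib power2_eq_square field_simps)
    have nv: "(\<epsilon> *\<^sub>R v) /\<^sub>R \<epsilon> = v"
      using \<epsilon> by simp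
    have "g (z + \<epsilon> *\<^sub>R v) = indicator \<Omega> (z + \<epsilon> *\<^sub>R v) * (indicator {..<\<epsilon>} (norm (\<epsilon> *\<^sub>R v)) * \<eta> (norm v)
        * (\<epsilon>\<^sup>2 * (R' * (m \<bullet> v) + q v)))"
      unfolding g_def kw add_diff_cancel_left' quad nv real_scaleR_def ..
    also have "\<dots> = (indicator \<Omega> (z + \<epsilon> *\<^sub>R v) * indicator {..<\<epsilon>} (norm (\<epsilon> *\<^sub>R v)))
        * (\<eta> (norm v) * (\<epsilon>\<^sup>2 * (R' * (m \<bullet> v) + q v)))"
      by (simp only: mult.assoc)
    finally show "g (z + \<epsilon> *\<^sub>R v) = \<epsilon>\<^sup>2 * (indicator (ball 0 1 - D) v *\<^sub>R f v)"
      unfolding ind f_def by simp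
  qed simp
  also have "\<dots> = \<epsilon>\<^sup>2 * (LINT v:ball 0 1 - D|lborel. f v)"
    by (simp add: set_lebesgue_integral_def)
  also have "(LINT v:ball 0 1 - D|lborel. f v) = (LINT v:ball 0 1|lborel. f v) - (LINT v:D|lborel. f v)"
  proof -
    have "D \<union> (ball 0 1 - D) = ball 0 1"
      using Db by auto
    then show ?thesis
      using set_integral_Un[of D "ball 0 1 - D" lborel f] Db
        set_integrable_subset[OF fb(1), of D] set_integrable_subset[OF fb(1), of "ball 0 1 - D"] by auto
  qed
  finally have eq: "(LINT y|lborel. g y) = \<epsilon> ^ DIM('a) * (\<epsilon>\<^sup>2 * ((LINT v:ball 0 1|lborel. f v) - (LINT v:D|lborel. f v)))" .
  have "- (LINT v:D|lborel. f v) \<le> \<tau>"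
  proof -
    have C: "\<bar>m \<bullet> v\<bar> \<le> norm m" if "v \<in> D" for v
    proof -
      have "norm m * norm v \<le> norm m * 1"
        using that Db by (intro mult_left_mono) auto
      then show ?thesis
        using Cauchy_Schwarz_ineq2[of m v] by simp
    qed
    have i1: "set_integrable lborel D (\<lambda>v. \<eta> (norm v) * (m \<bullet> v))"
      by (rule unit_ball_kernel_integrable(1)[OF \<eta> _ Dm Db C]) simp_all
    have i2: "set_integrable lborel D (\<lambda>v. \<eta> (norm v))"
      using unit_ball_kernel_integrable(1)[OF \<eta> _ Dm Db, of "\<lambda>_. 1" 1] by simp
    have "R' * (LINT v:D|lborel. \<eta> (norm v) * (m \<bullet> v)) - Q * (LINT v:D|lborel. \<eta> (norm v))
        = (LINT v:D|lborel. R' * (\<eta> (norm v) * (m \<bullet> v)) - Q * \<eta> (norm v))"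
      using set_integral_diff(2)[OF set_integrable_mult_right[OF i1, of R'] set_integrable_mult_right[OF i2, of Q]]
      by simp
    also have "\<dots> \<le> (LINT v:D|lborel. f v)"
    proof (rule set_integral_mono)
      show "set_integrable lborel D (\<lambda>v. R' * (\<eta> (norm v) * (m \<bullet> v)) - Q * \<eta> (norm v))"
        using i1 i2 by (intro set_integral_diff) auto
      show "set_integrable lborel D f"
        using Db by (intro set_integrable_subset[OF fb(1)]) auto
      fix v assume v: "v \<in> D"
      have "\<bar>u \<bullet> v\<bar> \<le> 1"
        using v Db u by (intro abs_inner_le_one) auto
      then have "c * (u \<bullet> v)\<^sup>2 \<le> c * 1"
        using c by (intro mult_left_mono) (simp_all add: abs_square_le_1)
      then have "- Q \<le> q v"
        using Q zero_le_power2[of "norm v"] unfolding q_def by linarith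
      then have "\<eta> (norm v) * (- Q) \<le> \<eta> (norm v) * q v"
        using admissible_kernelD(1)[OF \<eta>, of "norm v"] by (intro mult_left_mono) auto
      then show "R' * (\<eta> (norm v) * (m \<bullet> v)) - Q * \<eta> (norm v) \<le> f v"
        by (simp add: f_def algebra_simps)
    qed
    finally show ?thesis
      using cap by (simp add: R'_def)
  qed
  then have "(LINT y|lborel. g y) \<le> \<epsilon> ^ DIM('a) * (\<epsilon>\<^sup>2 * ((LINT v:ball 0 1|lborel. f v) + \<tau>))"
    unfolding eq using \<epsilon> by (intro mult_left_mono) auto
  also have "\<dots> = \<epsilon> ^ (DIM('a) + 2) * ((DIM('a) - c) * (2 * sigma1 TYPE('a) \<eta>) - b * (2 * sigma2 TYPE('a) \<eta>) + \<tau>)"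
    unfolding fb(2) by (simp only: power_add mult.assoc)
  finally show ?thesis
    unfolding g_def set_lebesgue_integral_def .
qed

lemma norm_mult_inner_sgn:
  fixes h e :: "'a::real_inner"
  shows "norm h * (sgn h \<bullet> e) = h \<bullet> e"
  by (cases "h = 0") (simp_all add: sgn_div_norm)

lemma flat_at_le:
  assumes "flat_at \<Omega> \<delta> x r e" "a \<in> \<Omega>" "b \<notin> \<Omega>" "dist x a < r" "dist x b < r"
  shows "(b - a) \<bullet> e \<le> \<delta> * norm (b - a)"
  using assms(1)[unfolded flat_at_def, rule_format, of a b] assms(2-5) by simp

text \<open>The data of a single \<open>n\<close>. Regularity enters only through the numbers
  \<open>\<rho>m\<close>, \<open>\<rho>M\<close>, \<open>G\<close>, \<open>L\<close>, so that
  constants chosen from these are uniform in \<open>n\<close>. Here \<open>\<delta>\<close> bounds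
  the displacement; flatness is called \<open>\<delta>0\<close> below.\<close>

locale cloud =
  fixes \<Omega> :: "'a::euclidean_space set" and \<rho> :: "'a \<Rightarrow> real" and g :: "'a \<Rightarrow> 'a"
    and x :: "nat \<Rightarrow> 'a" and n :: nat and T :: "'a \<Rightarrow> 'a" and \<eta> :: "real \<Rightarrow> real"
    and \<epsilon> \<delta> \<rho>m \<rho>M G L :: real
  assumes op: "open \<Omega>" and bdd: "bounded \<Omega>" and transport: "transport_map \<Omega> \<rho> x n T" and n: "0 < n"
    and S: "x ` {1..n} \<subseteq> \<Omega>"
    and \<rho>_cont: "continuous_on \<Omega> \<rho>" and \<rho>m: "0 < \<rho>m"
    and \<rho>_bounds: "\<And>y. y \<in> \<Omega> \<Longrightarrow> \<rho>m \<le> \<rho> y" "\<And>y. y \<in> \<Omega> \<Longrightarrow> \<rho> y \<le> \<rho>M"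
    and \<rho>_deriv: "\<And>y. y \<in> \<Omega> \<Longrightarrow> GDERIV \<rho> y :> g y" and g_bound: "\<And>y. y \<in> \<Omega> \<Longrightarrow> norm (g y) \<le> G"
    and disp: "AE y in lborel. y \<in> \<Omega> \<longrightarrow> norm (y - T y) \<le> \<delta>"
    and \<delta>: "0 < \<delta>" "\<delta> \<le> \<epsilon>" and \<epsilon>: "0 < \<epsilon>"
    and \<eta>: "admissible_kernel \<eta>" and \<eta>_lipschitz: "L-lipschitz_on {0..} \<eta>"
begin

lemma cover: "y \<in> \<Omega> \<Longrightarrow> \<exists>q\<in>x ` {1..n}. norm (y - q) < 2 * \<delta>"
  by (rule transport_cover[OF op _ \<delta>(1) disp]) (use transport in \<open>simp_all add: transport_map_def\<close>)

lemma nonneg_constants: "0 \<le> \<rho>M" "0 \<le> G" "0 \<le> L"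
proof -
  have "x 1 \<in> \<Omega>"
    using S n by auto
  then show "0 \<le> \<rho>M" "0 \<le> G"
    using \<rho>m \<rho>_bounds[of "x 1"] g_bound[of "x 1"] norm_ge_zero[of "g (x 1)"] by linarith+
  show "0 \<le> L"
    using \<eta>_lipschitz by (rule lipschitz_on_nonneg)
qed

text \<open>The minimum can exploit the steepest descent step only if that step ends inside
  \<open>\<Omega>\<close>, where the cloud is dense. This is the second use of the tilt, next to the
  sign of the first order term.\<close>

lemma far_pointwise:
  fixes x0 z e :: 'a and a s k r \<delta>0 R :: real
  assumes a: "0 < a" "a < 1" and s: "0 < s" "s \<le> 1/8" and k: "0 < k"
    and x0: "x0 \<in> \<Omega>" and z: "z \<in> \<Omega>" and R: "R = norm (z - x0)" and e: "norm e = 1"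
    and flat: "flat_at \<Omega> \<delta>0 x0 r e" and \<delta>0: "0 < \<delta>0" "\<delta>0 \<le> s / 16"
    and far: "16 * (1 + k) * \<epsilon> \<le> s * R" and R1: "R \<le> 1" and rad: "R + (1 + k) * \<epsilon> < r"
    and small: "8 * \<delta> \<le> s\<^sup>2 * \<epsilon>\<^sup>2" "2 * \<delta> < k * \<epsilon>"
    and j: "j \<in> {1..n}" and v: "norm (x j - z) \<le> \<epsilon>"
  defines "N \<equiv> \<lambda>q. tilted_norm s e (q - x0)"
  shows "max_op x n (k * \<epsilon>) N (x j) powr a + min_op x n (k * \<epsilon>) N (x j) powr a - 2 * N z powr a
    \<le> a * R powr (a - 2) *
       (2 * (((N z / R) powr (a - 1) * R) *\<^sub>R (sgn (z - x0) - s *\<^sub>R e) \<bullet> (x j - z))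
        + (norm (x j - z))\<^sup>2 - (2 - a) * (sgn (z - x0) \<bullet> (x j - z))\<^sup>2
        - ((1 - a) * k\<^sup>2 - (204 + 50 * k\<^sup>2) * s) * \<epsilon>\<^sup>2)"
proof -
  define \<zeta> w where "\<zeta> = x j - x0" and "w = x j - z"
  \<comment> \<open>The step is shortened by \<open>2 * \<delta>\<close>, so that a cloud point
    within \<open>2 * \<delta>\<close> of its end still belongs to the ball of radius
    \<open>k * \<epsilon>\<close>.\<close>
  define p where "p = x j - (k * \<epsilon> - 2 * \<delta>) *\<^sub>R sgn (sgn \<zeta> - s *\<^sub>R e)"
  have k\<epsilon>: "0 < k * \<epsilon>" "0 \<le> k * \<epsilon>"
    using k \<epsilon> by auto
  have "0 < 16 * (1 + k) * \<epsilon>"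
    using k \<epsilon> by simp
  then have "0 < s * R"
    using far by linarith
  then have Rpos: "0 < R"
    using s by (simp add: zero_less_mult_iff)
  have b1: "16 * \<epsilon> + 16 * (k * \<epsilon>) \<le> s * R"
    using far by (simp add: algebra_simps)
  have "s * R \<le> (1/8) * R"
    using s Rpos by (intro mult_right_mono) auto
  then have \<epsilon>R: "\<epsilon> \<le> R / 128" "k * \<epsilon> \<le> R / 128" "\<epsilon> \<le> s * R" "k * \<epsilon> \<le> s * R"
    using b1 k\<epsilon> \<epsilon> by auto
  have \<zeta>_eq: "\<zeta> = (z - x0) + w"
    by (simp add: \<zeta>_def w_def)
  have \<zeta>: "R / 2 \<le> norm \<zeta>" "norm \<zeta> \<le> R + \<epsilon>"
    using norm_diff_ineq[of "z - x0" w] norm_triangle_ineq[of "z - x0" w] v \<epsilon>R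
    unfolding \<zeta>_eq R w_def by linarith+
  have \<zeta>0: "\<zeta> \<noteq> 0"
    using \<zeta> Rpos by auto
  have s2: "0 \<le> s" "s \<le> 1"
    using s by auto
  have ng: "1 - s \<le> norm (sgn \<zeta> - s *\<^sub>R e)" "norm (sgn \<zeta> - s *\<^sub>R e) \<le> 1 + s"
    using norm_tilted_gradient[OF s2(1) e \<zeta>0] by auto
  define \<nu> where "\<nu> = sgn (sgn \<zeta> - s *\<^sub>R e)"
  have \<nu>1: "norm \<nu> = 1"
    using ng s by (auto simp: \<nu>_def norm_sgn)
  define \<tau> where "\<tau> = k * \<epsilon> - 2 * \<delta>"
  have \<tau>: "0 < \<tau>" "\<tau> \<le> k * \<epsilon>"
    using small \<delta> by (auto simp: \<tau>_def)
  have p_eq: "p = x j - \<tau> *\<^sub>R \<nu>"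
    by (simp add: p_def \<tau>_def \<nu>_def)
  have xj: "x j \<in> \<Omega>"
    using j S by auto
  have dxj: "dist x0 (x j) < r"
    using \<zeta> rad k\<epsilon> \<epsilon> by (simp add: \<zeta>_def dist_norm norm_minus_commute algebra_simps)
  have px0: "norm (p - x0) \<le> R + \<epsilon> + k * \<epsilon>"
  proof -
    have "p - x0 = \<zeta> - \<tau> *\<^sub>R \<nu>"
      by (simp add: p_eq \<zeta>_def)
    then show ?thesis
      using norm_triangle_ineq4[of \<zeta> "\<tau> *\<^sub>R \<nu>"] \<nu>1 \<tau> \<zeta> by simp
  qed
  have dp: "dist x0 p < r"
    using px0 rad by (simp add: dist_norm norm_minus_commute algebra_simps)
  \<comment> \<open>If the descent step left \<open>\<Omega>\<close>, flatness between
    \<open>p\<close> and \<open>x j\<close> would make \<open>sgn \<zeta> \<bullet> e\<close> at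
    least \<open>s - 2 * \<delta>0\<close>, whereas flatness between \<open>p\<close> and the pole
    makes it at most \<open>4 * \<delta>0 + s / 8\<close>. With
    \<open>\<delta>0 \<le> s / 16\<close> these are incompatible.\<close>
  have p: "p \<in> \<Omega>"
  proof (rule ccontr)
    assume np: "p \<notin> \<Omega>"
    have "(p - x j) \<bullet> e \<le> \<delta>0 * norm (p - x j)"
      using flat xj dxj dp np unfolding flat_at_def by auto
    then have "\<tau> * (- (\<nu> \<bullet> e)) \<le> \<tau> * \<delta>0"
      using \<tau> \<nu>1 by (simp add: p_eq mult.commute)
    then have "- (\<nu> \<bullet> e) \<le> \<delta>0"
      using \<tau>(1) by (rule mult_left_le_imp_le)
    moreover have "(sgn \<zeta> - s *\<^sub>R e) \<bullet> e = norm (sgn \<zeta> - s *\<^sub>R e) * (\<nu> \<bullet> e)"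
      by (simp add: \<nu>_def norm_mult_inner_sgn)
    moreover have "norm (sgn \<zeta> - s *\<^sub>R e) * (- (\<nu> \<bullet> e)) \<le> 2 * \<delta>0"
    proof (cases "0 \<le> - (\<nu> \<bullet> e)")
      case True
      then show ?thesis
        using \<open>- (\<nu> \<bullet> e) \<le> \<delta>0\<close> ng s by (intro mult_mono) auto
    next
      case False
      then have "norm (sgn \<zeta> - s *\<^sub>R e) * (- (\<nu> \<bullet> e)) \<le> 0"
        by (intro mult_nonneg_nonpos) auto
      then show ?thesis
        using \<delta>0 by linarith
    qed
    moreover have "(sgn \<zeta> - s *\<^sub>R e) \<bullet> e = sgn \<zeta> \<bullet> e - s"
      using e by (simp add: inner_simps norm_eq_1)
    ultimately have lower: "s - 2 * \<delta>0 \<le> sgn \<zeta> \<bullet> e"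
      by simp
    have "(p - x0) \<bullet> e \<le> \<delta>0 * norm (p - x0)"
    proof -
      have "x0 \<in> ball x0 r"
        using le_less_trans[OF zero_le_dist dp] by simp
      then show ?thesis
        using flat x0 dp np unfolding flat_at_def by auto
    qed
    also have "\<dots> \<le> \<delta>0 * (4 * norm \<zeta>)"
      using px0 \<zeta> \<epsilon>R \<delta>0 Rpos by (intro mult_left_mono) auto
    finally have "\<zeta> \<bullet> e - \<tau> * (\<nu> \<bullet> e) \<le> \<delta>0 * (4 * norm \<zeta>)"
      by (simp add: p_eq \<zeta>_def inner_simps)
    moreover have "\<tau> * (\<nu> \<bullet> e) \<le> \<tau> * 1"
      using abs_inner_le_one[of \<nu> e] \<nu>1 e \<tau> by (intro mult_left_mono) auto
    moreover have "\<tau> \<le> s / 8 * norm \<zeta>"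
    proof -
      have "s * R \<le> s * (2 * norm \<zeta>)"
        using \<zeta> s by (intro mult_left_mono) auto
      then show ?thesis
        using \<tau> b1 \<epsilon> by simp
    qed
    moreover have "\<zeta> \<bullet> e = norm \<zeta> * (sgn \<zeta> \<bullet> e)"
      using \<zeta>0 by (simp add: sgn_div_norm)
    ultimately have "norm \<zeta> * (sgn \<zeta> \<bullet> e) \<le> norm \<zeta> * (4 * \<delta>0 + s / 8)"
      by (simp add: algebra_simps)
    then have "sgn \<zeta> \<bullet> e \<le> 4 * \<delta>0 + s / 8"
      using \<zeta>0 by simp
    then show False
      using lower \<delta>0 s by simp
  qed
  obtain q where q: "q \<in> x ` {1..n}" "norm (p - q) < 2 * \<delta>"
    using cover[OF p] by auto
  have qj: "norm (q - x j) \<le> k * \<epsilon>"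
  proof -
    have "norm (q - x j) \<le> norm (q - p) + norm (p - x j)"
      using norm_triangle_ineq[of "q - p" "p - x j"] by simp
    also have "norm (p - x j) = \<tau>"
      using \<nu>1 \<tau> by (simp add: p_eq)
    finally show ?thesis
      using q(2) by (simp add: \<tau>_def norm_minus_commute)
  qed
  have "min_op x n (k * \<epsilon>) N (x j) \<le> N q"
    by (rule min_op_le[OF j k\<epsilon>(2) q(1) qj])
  also have "N q \<le> tilted_norm s e (\<zeta> - (k * \<epsilon>) *\<^sub>R \<nu>) + 2 * norm (q - x0 - (\<zeta> - (k * \<epsilon>) *\<^sub>R \<nu>))"
    using tilted_norm_lipschitz[OF s2 e, of "\<zeta> - (k * \<epsilon>) *\<^sub>R \<nu>" "q - x0 - (\<zeta> - (k * \<epsilon>) *\<^sub>R \<nu>)"]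
    by (simp add: N_def)
  also have "norm (q - x0 - (\<zeta> - (k * \<epsilon>) *\<^sub>R \<nu>)) \<le> 4 * \<delta>"
  proof -
    have "q - x0 - (\<zeta> - (k * \<epsilon>) *\<^sub>R \<nu>) = (q - p) + (2 * \<delta>) *\<^sub>R \<nu>"
      by (simp add: p_eq \<tau>_def \<zeta>_def algebra_simps)
    then show ?thesis
      using norm_triangle_ineq[of "q - p" "(2 * \<delta>) *\<^sub>R \<nu>"] q(2) \<nu>1 \<delta>
      by (simp only: norm_minus_commute[of q p]) simp
  qed
  finally have mn1: "min_op x n (k * \<epsilon>) N (x j) \<le> tilted_norm s e (\<zeta> - (k * \<epsilon>) *\<^sub>R \<nu>) + 8 * \<delta>"
    by simp
  have "s\<^sup>2 * \<epsilon>\<^sup>2 / 1 \<le> s\<^sup>2 * \<epsilon>\<^sup>2 / R"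
    using R1 Rpos by (intro divide_left_mono) auto
  then have mn: "min_op x n (k * \<epsilon>) N (x j) \<le> tilted_norm s e (\<zeta> - (k * \<epsilon>) *\<^sub>R \<nu>) + s\<^sup>2 * \<epsilon>\<^sup>2 / R"
    using mn1 small by simp
  have mn0: "0 \<le> min_op x n (k * \<epsilon>) N (x j)"
    by (rule min_op_attained[OF j k\<epsilon>(2), of x N]) (use tilted_norm_bounds(3)[OF s2 e] in \<open>auto simp: N_def\<close>)
  obtain q' where q': "norm (q' - x j) \<le> k * \<epsilon>" "max_op x n (k * \<epsilon>) N (x j) = N q'"
    by (rule max_op_attained[OF j k\<epsilon>(2), of x N])
  have z0: "z - x0 \<noteq> 0"
    using R Rpos by auto
  have "tilted_norm s e ((z - x0) + w + (q' - x j)) powr a + min_op x n (k * \<epsilon>) N (x j) powr a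
    \<le> 2 * tilted_norm s e (z - x0) powr a + a * norm (z - x0) powr (a - 2) *
       (2 * (tilted_norm s e (z - x0) / norm (z - x0)) powr (a - 1) * norm (z - x0) * ((sgn (z - x0) - s *\<^sub>R e) \<bullet> w)
        + (norm w)\<^sup>2 - (2 - a) * (sgn (z - x0) \<bullet> w)\<^sup>2 - (1 - a) * k\<^sup>2 * \<epsilon>\<^sup>2 + (204 + 50 * k\<^sup>2) * s * \<epsilon>\<^sup>2)"
  proof (rule tilted_norm_powr_step[OF a s e z0 _ _ \<epsilon> k])
    show "norm w \<le> \<epsilon>" "\<epsilon> \<le> s * norm (z - x0)" "k * \<epsilon> \<le> s * norm (z - x0)" "norm (q' - x j) \<le> k * \<epsilon>"
      using v \<epsilon>R q' by (auto simp: w_def R)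
    show "0 \<le> min_op x n (k * \<epsilon>) N (x j)"
      by (rule mn0)
    show "min_op x n (k * \<epsilon>) N (x j) \<le> tilted_norm s e (z - x0 + w - (k * \<epsilon>) *\<^sub>R
        sgn (sgn (z - x0 + w) - s *\<^sub>R e)) + s\<^sup>2 * \<epsilon>\<^sup>2 / norm (z - x0)"
      using mn unfolding \<nu>_def \<zeta>_eq R .
  qed
  moreover have "(z - x0) + w + (q' - x j) = q' - x0"
    by (simp add: w_def)
  ultimately show ?thesis
    unfolding q'(2) by (simp add: N_def R w_def algebra_simps)
qed

text \<open>Seen from the pole, a point outside \<open>\<Omega>\<close> has almost no height along
  \<open>e\<close>, so \<open>sgn (z - x0) \<bullet> e\<close> is at most \<open>3 * s / 16\<close>
  at nearby \<open>z\<close>. Subtracting \<open>s\<close> leaves \<open>- 13 * s / 16\<close>, and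
  normalising by a length at most \<open>1 + s\<close> keeps it below
  \<open>- s / 2\<close>.\<close>

lemma near_boundary_direction:
  fixes x0 z e :: 'a and s r \<delta>0 R :: real
  assumes s: "0 < s" "s \<le> 1/8"
    and x0: "x0 \<in> \<Omega>" and R: "R = norm (z - x0)" and e: "norm e = 1"
    and flat: "flat_at \<Omega> \<delta>0 x0 r e" and \<delta>0: "0 < \<delta>0" "\<delta>0 \<le> s / 16"
    and far: "16 * \<epsilon> \<le> s * R" and rad: "R + \<epsilon> < r"
    and p: "p \<notin> \<Omega>" "norm (p - z) \<le> \<epsilon>"
  shows "sgn (sgn (z - x0) - s *\<^sub>R e) \<bullet> e \<le> - (s / 2)"
proof -
  have Rpos: "0 < R"
    using far \<epsilon> s by (smt (verit) mult_nonneg_nonpos norm_ge_zero R zero_less_mult_iff)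
  have z0: "z - x0 \<noteq> 0"
    using R Rpos by auto
  have "s * R \<le> 1 * R"
    using s Rpos by (intro mult_right_mono) auto
  then have \<epsilon>R: "\<epsilon> \<le> R"
    using far \<epsilon> by simp
  have px0: "norm (p - x0) \<le> R + \<epsilon>"
    using norm_triangle_ineq[of "p - z" "z - x0"] p R by simp
  have dp: "dist x0 p < r" "0 < r"
    using px0 rad norm_ge_zero[of "p - x0"] unfolding dist_norm norm_minus_commute[of x0] by linarith+
  have "(p - x0) \<bullet> e \<le> \<delta>0 * norm (p - x0)"
    using flat x0 dp p unfolding flat_at_def by auto
  also have "\<dots> \<le> \<delta>0 * (2 * R)"
    using px0 \<epsilon>R \<delta>0 by (intro mult_left_mono) auto
  finally have "(p - x0) \<bullet> e \<le> \<delta>0 * (2 * R)" .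
  moreover have "\<bar>(p - z) \<bullet> e\<bar> \<le> \<epsilon>"
    using Cauchy_Schwarz_ineq2[of "p - z" e] e p by simp
  moreover have "(p - x0) \<bullet> e = (p - z) \<bullet> e + (z - x0) \<bullet> e"
    by (simp add: inner_simps)
  moreover have "(z - x0) \<bullet> e = R * (sgn (z - x0) \<bullet> e)"
    using z0 R by (simp add: sgn_div_norm)
  moreover have "\<delta>0 * (2 * R) \<le> s / 16 * (2 * R)"
    using \<delta>0 Rpos by (intro mult_right_mono) auto
  ultimately have "R * (sgn (z - x0) \<bullet> e) \<le> R * (3 * s / 16)"
    using far by (simp add: algebra_simps)
  then have sg: "sgn (z - x0) \<bullet> e \<le> 3 * s / 16"
    using Rpos by simp
  define h where "h = sgn (z - x0) - s *\<^sub>R e"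
  have h: "1 - s \<le> norm h" "norm h \<le> 1 + s"
    using norm_tilted_gradient[OF _ e z0, of s] s by (auto simp: h_def)
  have "h \<bullet> e \<le> - (13 * s / 16)"
    using sg e by (simp add: h_def inner_simps norm_eq_1)
  also have "\<dots> \<le> (1 + s) * (- (s / 2))"
  proof -
    have "s * s \<le> (1/8) * s"
      using s by (intro mult_right_mono) auto
    then show ?thesis
      using s by (simp add: algebra_simps)
  qed
  also have "\<dots> \<le> norm h * (- (s / 2))"
    using h s by (intro mult_right_mono_neg) auto
  finally have "norm h * (sgn h \<bullet> e) \<le> norm h * (- (s / 2))"
    unfolding norm_mult_inner_sgn .
  moreover have "0 < norm h"
    using h s by linarith
  ultimately show ?thesis
    unfolding h_def by (subst (asm) mult_le_cancel_left_pos) auto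
qed

lemma kernel_weight_lipschitz:
  fixes v w :: 'a
  assumes "norm v < \<epsilon>" "norm w < \<epsilon>"
  shows "\<bar>kernel_weight \<eta> \<epsilon> (norm v) - kernel_weight \<eta> \<epsilon> (norm w)\<bar> \<le> L / \<epsilon> * norm (v - w)"
proof -
  have "dist (\<eta> (norm v / \<epsilon>)) (\<eta> (norm w / \<epsilon>)) \<le> L * dist (norm v / \<epsilon>) (norm w / \<epsilon>)"
    using \<epsilon> by (intro lipschitz_onD[OF \<eta>_lipschitz]) auto
  also have "dist (norm v / \<epsilon>) (norm w / \<epsilon>) = \<bar>norm v - norm w\<bar> / \<epsilon>"
    using \<epsilon> by (simp add: dist_real_def diff_divide_distrib[symmetric] abs_divide)
  also have "L * (\<bar>norm v - norm w\<bar> / \<epsilon>) \<le> L * (norm (v - w) / \<epsilon>)"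
    using nonneg_constants(3) \<epsilon> norm_triangle_ineq3[of v w] by (intro mult_left_mono divide_right_mono) auto
  finally show ?thesis
    using assms by (simp add: kernel_weight_def dist_real_def)
qed

text \<open>The summands are majorised by the explicit function \<open>\<psi>\<close>, whose linear
  part dominates its size: \<open>C * R * \<epsilon>\<close>. Hence the variation of the density
  costs \<open>\<epsilon>^2 * R\<close>, small for small \<open>R\<close>, and transport costs
  \<open>R * \<delta>\<close>, small relative to \<open>\<epsilon>^2\<close> because
  \<open>\<delta> / \<epsilon>^2\<close> is small.\<close>

lemma far_sum:
  fixes x0 z e :: 'a and a s k r \<delta>0 R K \<tau> :: real
  assumes a: "0 < a" "a < 1" and s: "0 < s" "s \<le> 1/8" and k: "0 < k"
    and x0: "x0 \<in> \<Omega>" and z: "z \<in> \<Omega>" and R: "R = norm (z - x0)" and e: "norm e = 1"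
    and flat: "flat_at \<Omega> \<delta>0 x0 r e" and \<delta>0: "0 < \<delta>0" "\<delta>0 \<le> s / 16"
    and far: "16 * (1 + k) * \<epsilon> \<le> s * R" and R1: "R \<le> 1" and rad: "R + (5 + k) * \<epsilon> < r"
    and small: "8 * \<delta> \<le> s\<^sup>2 * \<epsilon>\<^sup>2" "2 * \<delta> < k * \<epsilon>"
    and K: "K * \<epsilon> \<le> R"
    and cap: "\<And>(D::'a set) m R'. D \<in> sets borel \<Longrightarrow> D \<subseteq> ball 0 1 \<Longrightarrow> 0 \<notin> D \<Longrightarrow> norm m = 1 \<Longrightarrow>
      (D \<noteq> {} \<longrightarrow> m \<bullet> e \<le> - (s / 2)) \<Longrightarrow>
      (\<forall>b\<in>D. \<forall>a\<in>ball 0 1 - D. (b - a) \<bullet> e \<le> \<delta>0 * norm (b - a)) \<Longrightarrow> K \<le> R' \<Longrightarrow> 0 \<le> R' \<Longrightarrow>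
      (2 + k\<^sup>2) * (LINT v:D|lborel. \<eta> (norm v)) - R' * (LINT v:D|lborel. \<eta> (norm v) * (m \<bullet> v)) \<le> \<tau>"
  defines "N \<equiv> \<lambda>q. tilted_norm s e (q - x0)" and "d \<equiv> DIM('a)" and "\<sigma> \<equiv> (204 + 50 * k\<^sup>2) * s"
  defines "C \<equiv> 7 + k\<^sup>2 + \<sigma>"
  shows "(\<Sum>j=1..n. kernel_weight \<eta> \<epsilon> (norm (z - x j)) *
      (max_op x n (k * \<epsilon>) N (x j) powr a + min_op x n (k * \<epsilon>) N (x j) powr a - 2 * N z powr a)) / n
    \<le> a * R powr (a - 2) * (\<epsilon> ^ (d + 2) *
      (\<rho> z * ((d - (2 - a)) * (2 * sigma1 TYPE('a) \<eta>) - ((1 - a) * k\<^sup>2 - \<sigma>) * (2 * sigma2 TYPE('a) \<eta>) + \<tau>)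
       + unit_ball_vol d * 2 ^ d * (10 * G * C * R + \<rho>M * R * (\<delta> / \<epsilon>\<^sup>2) * (L * C + 20 + 2 * d * C))))"
proof -
  define u where "u = sgn (z - x0)"
  define h where "h = u - s *\<^sub>R e"
  define c where "c = (N z / R) powr (a - 1) * R"
  define l where "l = c *\<^sub>R h"
  define b where "b = (1 - a) * k\<^sup>2 - \<sigma>"
  define P where "P v = 2 * (l \<bullet> v) + (norm v)\<^sup>2 - (2 - a) * (u \<bullet> v)\<^sup>2 - b * \<epsilon>\<^sup>2" for v
  define \<psi> where "\<psi> v = kernel_weight \<eta> \<epsilon> (norm v) * P v" for v
  note nn = nonneg_constants
  have k\<epsilon>: "0 < k * \<epsilon>"
    using k \<epsilon> by auto
  have b1: "16 * \<epsilon> + 16 * (k * \<epsilon>) \<le> s * R"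
    using far by (simp add: algebra_simps)
  then have "0 < s * R"
    using k\<epsilon> \<epsilon> by linarith
  then have Rpos: "0 < R"
    using s by (simp add: zero_less_mult_iff)
  have "s * R \<le> (1/8) * R"
    using s Rpos by (intro mult_right_mono) auto
  then have \<epsilon>R: "\<epsilon> \<le> R / 128"
    using b1 k\<epsilon> by simp
  have z0: "z - x0 \<noteq> 0"
    using R Rpos by auto
  have u1: "norm u = 1"
    using z0 by (simp add: u_def norm_sgn)
  have s2: "0 \<le> s" "s \<le> 1"
    using s by auto
  have h: "1 - s \<le> norm h" "norm h \<le> 1 + s"
    using norm_tilted_gradient[OF s2(1) e z0] by (auto simp: h_def u_def)
  have hpos: "0 < norm h"
    using h s by linarith
  have Nz: "(1 - s) * R \<le> N z" "N z \<le> (1 + s) * R"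
    using tilted_norm_bounds[OF s2 e, of "z - x0"] by (auto simp: N_def R)
  define t where "t = N z / R"
  have t: "7/8 \<le> t" "t \<le> 9/8"
  proof -
    have "1 - s \<le> t" "t \<le> 1 + s"
      using Nz Rpos by (auto simp: t_def field_simps)
    then show "7/8 \<le> t" "t \<le> 9/8"
      using s by auto
  qed
  have tp: "t powr (a - 1) \<le> 8/7" "8/9 \<le> t powr (a - 1)"
  proof -
    have "t powr (a - 1) \<le> (7/8) powr (a - 1)"
      using t a by (intro powr_mono2') auto
    also have "\<dots> \<le> (7/8) powr (-1)"
      using a by (intro powr_mono') auto
    finally show "t powr (a - 1) \<le> 8/7"
      by (simp add: powr_minus_divide)
    have "(9/8) powr (-1) \<le> (9/8) powr (a - 1)"
      using a by (intro powr_mono) auto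
    also have "\<dots> \<le> t powr (a - 1)"
      using t a by (intro powr_mono2') auto
    finally show "8/9 \<le> t powr (a - 1)"
      by (simp add: powr_minus_divide)
  qed
  have c: "8/9 * R \<le> c" "c \<le> 8/7 * R"
    using tp Rpos by (auto simp: c_def t_def[symmetric] intro!: mult_right_mono)
  have cpos: "0 < c"
    using c Rpos by linarith
  have l1: "norm l \<le> 2 * R"
  proof -
    have "norm l = c * norm h"
      using cpos by (simp add: l_def)
    also have "\<dots> \<le> (8/7 * R) * (9/8)"
      using c h s cpos Rpos by (intro mult_mono) auto
    finally show ?thesis
      using Rpos by simp
  qed
  have l2: "R / 2 \<le> norm l"
  proof -
    have "(8/9 * R) * (7/8) \<le> c * norm h"
      using c h s cpos Rpos by (intro mult_mono) auto
    then show ?thesis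
      using cpos Rpos by (simp add: l_def)
  qed
  have \<sigma>0: "0 \<le> \<sigma>"
    using s by (simp add: \<sigma>_def)
  have b: "\<bar>b\<bar> \<le> k\<^sup>2 + \<sigma>"
  proof -
    have "(1 - a) * k\<^sup>2 \<le> 1 * k\<^sup>2"
      using a by (intro mult_right_mono) auto
    moreover have "0 \<le> (1 - a) * k\<^sup>2"
      using a by simp
    ultimately show ?thesis
      using \<sigma>0 by (simp add: b_def abs_le_iff)
  qed
  have uv: "(u \<bullet> v)\<^sup>2 \<le> (norm v)\<^sup>2" for v
    using Cauchy_Schwarz_ineq2[of u v] u1 by (simp add: abs_le_square_iff[symmetric])
  have C0: "0 \<le> C"
    using \<sigma>0 by (simp add: C_def)
  have Pb: "\<bar>P v\<bar> \<le> C * R * \<epsilon>" if v: "norm v < \<epsilon>" for v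
  proof -
    have 1: "\<bar>l \<bullet> v\<bar> \<le> 2 * R * \<epsilon>"
    proof -
      have "norm l * norm v \<le> (2 * R) * \<epsilon>"
        using l1 v Rpos by (intro mult_mono) auto
      then show ?thesis
        using Cauchy_Schwarz_ineq2[of l v] by linarith
    qed
    have 2: "(norm v)\<^sup>2 \<le> \<epsilon>\<^sup>2"
      using v by (intro power_mono) auto
    have 3: "0 \<le> (2 - a) * (u \<bullet> v)\<^sup>2" "(2 - a) * (u \<bullet> v)\<^sup>2 \<le> 2 * \<epsilon>\<^sup>2"
    proof -
      have "(2 - a) * (u \<bullet> v)\<^sup>2 \<le> 2 * (norm v)\<^sup>2"
        using a uv by (intro mult_mono) auto
      then show "(2 - a) * (u \<bullet> v)\<^sup>2 \<le> 2 * \<epsilon>\<^sup>2"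
        using 2 by linarith
    qed (use a in simp)
    have 4: "\<bar>b * \<epsilon>\<^sup>2\<bar> \<le> (k\<^sup>2 + \<sigma>) * \<epsilon>\<^sup>2"
      using b by (simp add: abs_mult mult_right_mono)
    have "\<bar>P v\<bar> \<le> 4 * R * \<epsilon> + (3 + (k\<^sup>2 + \<sigma>)) * \<epsilon>\<^sup>2"
      using 1 2 3 4 zero_le_power2[of "norm v"] unfolding P_def distrib_right[of 3] by linarith
    also have "\<dots> \<le> 4 * R * \<epsilon> + (3 + (k\<^sup>2 + \<sigma>)) * (R * \<epsilon>)"
    proof -
      have "\<epsilon>\<^sup>2 \<le> R * \<epsilon>"
        using \<epsilon>R \<epsilon> Rpos by (simp add: power2_eq_square)
      then show ?thesis
        using \<sigma>0 by (intro add_left_mono mult_left_mono) auto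
    qed
    finally show ?thesis
      by (simp add: C_def algebra_simps)
  qed
  have PL: "\<bar>P v - P w\<bar> \<le> 10 * R * norm (v - w)" if vw: "norm v < \<epsilon>" "norm w < \<epsilon>" for v w
  proof -
    define D where "D = norm (v - w)"
    have 1: "\<bar>l \<bullet> (v - w)\<bar> \<le> 2 * R * D"
    proof -
      have "norm l * D \<le> (2 * R) * D"
        using l1 by (intro mult_right_mono) (auto simp: D_def)
      then show ?thesis
        using Cauchy_Schwarz_ineq2[of l "v - w"] by (simp add: D_def)
    qed
    have 2: "\<bar>(norm v)\<^sup>2 - (norm w)\<^sup>2\<bar> \<le> D * (2 * \<epsilon>)"
    proof -
      have "\<bar>(norm v)\<^sup>2 - (norm w)\<^sup>2\<bar> = \<bar>norm v - norm w\<bar> * \<bar>norm v + norm w\<bar>"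
        unfolding abs_mult[symmetric] by (simp add: power2_eq_square algebra_simps)
      also have "\<dots> \<le> D * (2 * \<epsilon>)"
        using vw norm_triangle_ineq3[of v w] by (intro mult_mono) (auto simp: D_def)
      finally show ?thesis .
    qed
    have 3: "\<bar>(u \<bullet> v)\<^sup>2 - (u \<bullet> w)\<^sup>2\<bar> \<le> D * (2 * \<epsilon>)"
    proof -
      have "\<bar>(u \<bullet> v)\<^sup>2 - (u \<bullet> w)\<^sup>2\<bar> = \<bar>u \<bullet> (v - w)\<bar> * \<bar>u \<bullet> v + u \<bullet> w\<bar>"
        unfolding abs_mult[symmetric] by (simp add: power2_eq_square algebra_simps inner_diff_right)
      also have "\<dots> \<le> D * (2 * \<epsilon>)"
        using vw Cauchy_Schwarz_ineq2[of u "v - w"] Cauchy_Schwarz_ineq2[of u v] Cauchy_Schwarz_ineq2[of u w] u1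
        by (intro mult_mono) (auto simp: D_def)
      finally show ?thesis .
    qed
    have "P v - P w = 2 * (l \<bullet> (v - w)) + ((norm v)\<^sup>2 - (norm w)\<^sup>2) - (2 - a) * ((u \<bullet> v)\<^sup>2 - (u \<bullet> w)\<^sup>2)"
      by (simp add: P_def inner_diff_right algebra_simps)
    moreover have "\<bar>(2 - a) * ((u \<bullet> v)\<^sup>2 - (u \<bullet> w)\<^sup>2)\<bar> \<le> 2 * (D * (2 * \<epsilon>))"
      unfolding abs_mult using 3 a by (intro mult_mono) auto
    ultimately have "\<bar>P v - P w\<bar> \<le> 4 * R * D + 6 * (\<epsilon> * D)"
      using 1 2 by (simp add: mult.commute)
    also have "\<dots> \<le> 4 * R * D + 6 * (R * D)"
      using \<epsilon>R Rpos by (intro add_left_mono mult_left_mono mult_right_mono) (auto simp: D_def)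
    finally show ?thesis
      by (simp add: D_def)
  qed
  have kwb: "0 \<le> kernel_weight \<eta> \<epsilon> (norm v)" "kernel_weight \<eta> \<epsilon> (norm v) \<le> 2" for v :: 'a
    using kernel_weight_bounds[OF \<eta> \<epsilon>, of "norm v"] by auto
  have kw0: "kernel_weight \<eta> \<epsilon> (norm v) = 0" if "\<epsilon> \<le> norm v" for v :: 'a
    using that by (simp add: kernel_weight_def)
  have CR: "0 \<le> C * R * \<epsilon>"
    using C0 Rpos \<epsilon> by simp
  have \<psi>b: "\<bar>\<psi> v\<bar> \<le> 2 * (C * R * \<epsilon>)" for v
  proof (cases "norm v < \<epsilon>")
    case True
    then show ?thesis
      unfolding \<psi>_def abs_mult using kwb[of v] Pb[OF True] by (intro mult_mono) auto
  next
    case False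
    then show ?thesis
      using kw0[of v] CR by (simp add: \<psi>_def)
  qed
  have \<psi>L: "\<bar>\<psi> v - \<psi> w\<bar> \<le> (R * (L * C + 20)) * norm (v - w)" if vw: "norm v < \<epsilon>" "norm w < \<epsilon>" for v w
  proof -
    have "\<psi> v - \<psi> w = (kernel_weight \<eta> \<epsilon> (norm v) - kernel_weight \<eta> \<epsilon> (norm w)) * P v
        + kernel_weight \<eta> \<epsilon> (norm w) * (P v - P w)"
      by (simp add: \<psi>_def algebra_simps)
    then have "\<bar>\<psi> v - \<psi> w\<bar> \<le> \<bar>kernel_weight \<eta> \<epsilon> (norm v) - kernel_weight \<eta> \<epsilon> (norm w)\<bar> * \<bar>P v\<bar>
        + \<bar>kernel_weight \<eta> \<epsilon> (norm w)\<bar> * \<bar>P v - P w\<bar>"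
      by (metis abs_mult abs_triangle_ineq)
    also have "\<dots> \<le> (L / \<epsilon> * norm (v - w)) * (C * R * \<epsilon>) + 2 * (10 * R * norm (v - w))"
      using kernel_weight_lipschitz[OF vw] Pb[OF vw(1)] kwb[of w] PL[OF vw] nn \<epsilon>
      by (intro add_mono mult_mono) auto
    also have "\<dots> = (R * (L * C + 20)) * norm (v - w)"
      using \<epsilon> by (simp add: field_simps)
    finally show ?thesis .
  qed
  have \<psi>m: "\<psi> \<in> borel_measurable borel"
  proof -
    note [measurable] = borel_measurable_kernel_norm[OF \<eta>]
    have kw: "kernel_weight \<eta> \<epsilon> (norm w) = (indicator {..<\<epsilon>} (norm w) * \<eta> (norm (w /\<^sub>R \<epsilon>)))" for w :: 'a
      using \<epsilon> by (simp add: kernel_weight_def divide_inverse mult.commute)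
    show ?thesis
      unfolding \<psi>_def kw P_def by measurable
  qed
  have sum_le: "(\<Sum>j=1..n. \<psi> (x j - z)) / n
    \<le> \<rho> z * (LINT y:\<Omega>|lborel. \<psi> (y - z))
      + unit_ball_vol DIM('a) * (2 * \<epsilon>) ^ DIM('a) * ((5 * G * \<epsilon>) * (2 * (C * R * \<epsilon>))
          + \<rho>M * ((R * (L * C + 20)) * \<delta> + DIM('a) * (2 * (C * R * \<epsilon>)) * \<delta> / \<epsilon>))"
  proof (rule transport_sum_le[OF op bdd transport n \<rho>_cont _ \<rho>_bounds(2) disp _ \<delta>(2) \<epsilon> \<psi>m])
    show "0 \<le> \<rho> y" if "y \<in> \<Omega>" for y
      using \<rho>_bounds(1)[OF that] \<rho>m by simp
    show "\<bar>\<rho> y - \<rho> z\<bar> \<le> 5 * G * \<epsilon>" if y: "y \<in> \<Omega>" "norm (y - z) < \<epsilon>" for y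
    proof (rule lipschitz_density[OF op flat \<delta>0(1) _ e \<rho>_deriv g_bound y(1) z _ \<epsilon>])
      show "norm (y - z) \<le> \<epsilon>" "\<delta>0 < 1 / 3"
        using y \<delta>0 s by auto
      have "dist x0 z = R"
        by (simp add: R dist_norm norm_minus_commute)
      moreover have "dist x0 y \<le> dist x0 z + dist z y"
        by (rule dist_triangle)
      moreover have "dist z y < \<epsilon>"
        using y by (simp add: dist_norm norm_minus_commute)
      moreover have "R + (5 * \<epsilon> + k * \<epsilon>) < r"
        using rad by (simp add: algebra_simps)
      ultimately show "dist x0 y + 4 * \<epsilon> < r" "dist x0 z + 4 * \<epsilon> < r"
        using k\<epsilon> \<epsilon> by linarith+
    qed auto
    show "\<psi> v = 0" if "\<epsilon> \<le> norm v" for v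
      using kw0[OF that] by (simp add: \<psi>_def)
  qed (use \<psi>b \<psi>L nn \<delta> \<epsilon> Rpos C0 in auto)
  have int_le: "(LINT y:\<Omega>|lborel. \<psi> (y - z))
    \<le> \<epsilon> ^ (DIM('a) + 2) * ((DIM('a) - (2 - a)) * (2 * sigma1 TYPE('a) \<eta>) - b * (2 * sigma2 TYPE('a) \<eta>) + \<tau>)"
    unfolding \<psi>_def P_def
  \<comment> \<open>The value \<open>2 + k^2\<close> bounds \<open>(2 - a) + b\<close> for every
    \<open>a\<close> and every tilt, so the cap estimate can be fixed independently of them.\<close>
  proof (rule kernel_quadratic_integral_le[OF \<eta> op u1 \<epsilon>, where m = "sgn l" and R = "norm l" and Q = "2 + k\<^sup>2"])
    show "0 \<le> 2 - a"
      using a by simp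
    show "2 - a + b \<le> 2 + k\<^sup>2"
    proof -
      have "(1 - a) * k\<^sup>2 \<le> 1 * k\<^sup>2"
        using a by (intro mult_right_mono) auto
      then show ?thesis
        using a \<sigma>0 by (simp add: b_def)
    qed
    show "l = norm l *\<^sub>R sgn l"
    proof -
      have "norm l \<noteq> 0"
        using l2 Rpos by linarith
      then show ?thesis
        by (simp add: sgn_div_norm)
    qed
    define D where "D = {v \<in> ball 0 1. z + \<epsilon> *\<^sub>R v \<notin> \<Omega>}"
    show "{v \<in> ball 0 1. z + \<epsilon> *\<^sub>R v \<notin> \<Omega>} = {v \<in> ball 0 1. z + \<epsilon> *\<^sub>R v \<notin> \<Omega>}" ..
    have sl: "sgn l = sgn (u - s *\<^sub>R e)"
      using cpos by (simp add: l_def h_def sgn_scaleR)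
    have \<Omega>m: "\<Omega> \<in> sets borel"
      using op by simp
    have dv: "dist x0 (z + \<epsilon> *\<^sub>R v) < r" if "norm v < 1" for v
    proof -
      have "norm (\<epsilon> *\<^sub>R v) \<le> \<epsilon> * 1"
        using that \<epsilon> by simp
      moreover have "norm (z + \<epsilon> *\<^sub>R v - x0) \<le> norm (z - x0) + norm (\<epsilon> *\<^sub>R v)"
        using norm_triangle_ineq[of "z - x0" "\<epsilon> *\<^sub>R v"] by (simp add: algebra_simps)
      moreover have "R + (5 * \<epsilon> + k * \<epsilon>) < r"
        using rad by (simp add: algebra_simps)
      ultimately show ?thesis
        using k\<epsilon> \<epsilon> R unfolding dist_norm norm_minus_commute[of x0] by linarith
    qed
    have "(2 + k\<^sup>2) * (LINT v:D|lborel. \<eta> (norm v)) - (2 * norm l / \<epsilon>) * (LINT v:D|lborel. \<eta> (norm v) * (sgn l \<bullet> v)) \<le> \<tau>"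
    proof (rule cap)
      show "D \<in> sets borel"
        unfolding D_def using \<Omega>m by measurable
      show "D \<subseteq> ball 0 1" "0 \<notin> D"
        using z by (auto simp: D_def)
      show "norm (sgn l) = 1"
        using l2 Rpos by (auto simp: norm_sgn)
      show "D \<noteq> {} \<longrightarrow> sgn l \<bullet> e \<le> - (s / 2)"
      proof
        assume "D \<noteq> {}"
        then obtain v where v: "norm v < 1" "z + \<epsilon> *\<^sub>R v \<notin> \<Omega>"
          by (auto simp: D_def)
        show "sgn l \<bullet> e \<le> - (s / 2)"
          unfolding sl u_def
        proof (rule near_boundary_direction[OF s x0 R e flat \<delta>0 _ _ v(2)])
          show "16 * \<epsilon> \<le> s * R"
            using b1 k\<epsilon> by linarith
          have "R + (5 * \<epsilon> + k * \<epsilon>) < r"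
            using rad by (simp add: algebra_simps)
          then show "R + \<epsilon> < r"
            using k\<epsilon> \<epsilon> by linarith
          show "norm (z + \<epsilon> *\<^sub>R v - z) \<le> \<epsilon>"
            using v \<epsilon> by simp
        qed
      qed
      \<comment> \<open>Flatness is invariant under scaling, so the condition on
        \<open>\<Omega>\<close> in the ball of radius \<open>\<epsilon>\<close> passes to the
        rescaled cap with the same constant.\<close>
      show "\<forall>b\<in>D. \<forall>a\<in>ball 0 1 - D. (b - a) \<bullet> e \<le> \<delta>0 * norm (b - a)"
      proof (intro ballI)
        fix b a assume b: "b \<in> D" and a: "a \<in> ball 0 1 - D"
        have "(z + \<epsilon> *\<^sub>R b - (z + \<epsilon> *\<^sub>R a)) \<bullet> e \<le> \<delta>0 * norm (z + \<epsilon> *\<^sub>R b - (z + \<epsilon> *\<^sub>R a))"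
          by (rule flat_at_le[OF flat]) (use a b dv[of a] dv[of b] in \<open>auto simp: D_def\<close>)
        moreover have "z + \<epsilon> *\<^sub>R b - (z + \<epsilon> *\<^sub>R a) = \<epsilon> *\<^sub>R (b - a)"
          by (simp add: algebra_simps)
        ultimately have "\<epsilon> * ((b - a) \<bullet> e) \<le> \<epsilon> * (\<delta>0 * norm (b - a))"
          using \<epsilon> by (simp add: mult.left_commute)
        then show "(b - a) \<bullet> e \<le> \<delta>0 * norm (b - a)"
          using \<epsilon> by (rule mult_left_le_imp_le)
      qed
      show "K \<le> 2 * norm l / \<epsilon>"
        using K l2 \<epsilon> by (simp add: pos_le_divide_eq)
      show "0 \<le> 2 * norm l / \<epsilon>"
        using \<epsilon> by simp
    qed
    then show "(2 + k\<^sup>2) * (LINT v:{v \<in> ball 0 1. z + \<epsilon> *\<^sub>R v \<notin> \<Omega>}|lborel. \<eta> (norm v))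
        - (2 * norm l / \<epsilon>) * (LINT v:{v \<in> ball 0 1. z + \<epsilon> *\<^sub>R v \<notin> \<Omega>}|lborel. \<eta> (norm v) * (sgn l \<bullet> v)) \<le> \<tau>"
      by (simp add: D_def)
  qed
  have main: "(\<Sum>j=1..n. \<psi> (x j - z)) / n \<le> \<epsilon> ^ (d + 2) *
      (\<rho> z * ((d - (2 - a)) * (2 * sigma1 TYPE('a) \<eta>) - b * (2 * sigma2 TYPE('a) \<eta>) + \<tau>)
       + unit_ball_vol d * 2 ^ d * (10 * G * C * R + \<rho>M * R * (\<delta> / \<epsilon>\<^sup>2) * (L * C + 20 + 2 * d * C)))"
  proof -
    have "0 \<le> \<rho> z"
      using \<rho>_bounds(1)[OF z] \<rho>m by simp
    then have "(\<Sum>j=1..n. \<psi> (x j - z)) / n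
      \<le> \<rho> z * (\<epsilon> ^ (DIM('a) + 2) * ((DIM('a) - (2 - a)) * (2 * sigma1 TYPE('a) \<eta>) - b * (2 * sigma2 TYPE('a) \<eta>) + \<tau>))
        + unit_ball_vol DIM('a) * (2 * \<epsilon>) ^ DIM('a) * ((5 * G * \<epsilon>) * (2 * (C * R * \<epsilon>))
          + \<rho>M * ((R * (L * C + 20)) * \<delta> + DIM('a) * (2 * (C * R * \<epsilon>)) * \<delta> / \<epsilon>))"
      using sum_le mult_left_mono[OF int_le] by fastforce
    also have "(5 * G * \<epsilon>) * (2 * (C * R * \<epsilon>)) + \<rho>M * ((R * (L * C + 20)) * \<delta> + DIM('a) * (2 * (C * R * \<epsilon>)) * \<delta> / \<epsilon>)
        = \<epsilon>\<^sup>2 * (10 * G * C * R + \<rho>M * R * (\<delta> / \<epsilon>\<^sup>2) * (L * C + 20 + 2 * d * C))"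
      using \<epsilon> by (simp add: d_def power2_eq_square field_simps)
    finally have le: "(\<Sum>j=1..n. \<psi> (x j - z)) / n
      \<le> \<rho> z * (\<epsilon> ^ (d + 2) * ((d - (2 - a)) * (2 * sigma1 TYPE('a) \<eta>) - b * (2 * sigma2 TYPE('a) \<eta>) + \<tau>))
        + unit_ball_vol d * (2 * \<epsilon>) ^ d * (\<epsilon>\<^sup>2 * (10 * G * C * R + \<rho>M * R * (\<delta> / \<epsilon>\<^sup>2) * (L * C + 20 + 2 * d * C)))"
      unfolding d_def .
    have factor: "\<rho> z * (\<epsilon> ^ (d + 2) * X) + V * (2 * \<epsilon>) ^ d * (\<epsilon>\<^sup>2 * Y) = \<epsilon> ^ (d + 2) * (\<rho> z * X + V * 2 ^ d * Y)"
      for X V Y :: real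
      by (simp add: power_add power_mult_distrib power2_eq_square algebra_simps)
    show ?thesis
      using le unfolding factor .
  qed
  have "(\<Sum>j=1..n. kernel_weight \<eta> \<epsilon> (norm (z - x j)) *
      (max_op x n (k * \<epsilon>) N (x j) powr a + min_op x n (k * \<epsilon>) N (x j) powr a - 2 * N z powr a))
    \<le> (\<Sum>j=1..n. a * R powr (a - 2) * \<psi> (x j - z))"
  proof (rule sum_mono)
    fix j assume j: "j \<in> {1..n}"
    have sym: "norm (z - x j) = norm (x j - z)"
      by (rule norm_minus_commute)
    show "kernel_weight \<eta> \<epsilon> (norm (z - x j)) *
      (max_op x n (k * \<epsilon>) N (x j) powr a + min_op x n (k * \<epsilon>) N (x j) powr a - 2 * N z powr a)
      \<le> a * R powr (a - 2) * \<psi> (x j - z)"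
    proof (cases "norm (x j - z) < \<epsilon>")
      case True
      have "R + (5 * \<epsilon> + k * \<epsilon>) < r"
        using rad by (simp add: algebra_simps)
      then have rad': "R + (1 + k) * \<epsilon> < r"
        using \<epsilon> by (simp add: algebra_simps)
      have "max_op x n (k * \<epsilon>) N (x j) powr a + min_op x n (k * \<epsilon>) N (x j) powr a - 2 * N z powr a
          \<le> a * R powr (a - 2) * P (x j - z)"
        using far_pointwise[OF a s k x0 z R e flat \<delta>0 far R1 rad' small j] True
        by (simp add: P_def N_def l_def c_def h_def u_def b_def \<sigma>_def)
      then have "kernel_weight \<eta> \<epsilon> (norm (x j - z)) *
        (max_op x n (k * \<epsilon>) N (x j) powr a + min_op x n (k * \<epsilon>) N (x j) powr a - 2 * N z powr a)
        \<le> kernel_weight \<eta> \<epsilon> (norm (x j - z)) * (a * R powr (a - 2) * P (x j - z))"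
        using kwb by (intro mult_left_mono) auto
      then show ?thesis
        unfolding sym by (simp add: \<psi>_def mult_ac)
    next
      case False
      then show ?thesis
        unfolding sym using kw0[of "x j - z"] by (simp add: \<psi>_def)
    qed
  qed
  also have "\<dots> = a * R powr (a - 2) * (\<Sum>j=1..n. \<psi> (x j - z))"
    by (simp add: sum_distrib_left)
  finally have "(\<Sum>j=1..n. kernel_weight \<eta> \<epsilon> (norm (z - x j)) *
      (max_op x n (k * \<epsilon>) N (x j) powr a + min_op x n (k * \<epsilon>) N (x j) powr a - 2 * N z powr a)) / n
    \<le> a * R powr (a - 2) * ((\<Sum>j=1..n. \<psi> (x j - z)) / n)"
    by (simp add: divide_right_mono)
  also have "\<dots> \<le> a * R powr (a - 2) * (\<epsilon> ^ (d + 2) *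
      (\<rho> z * ((d - (2 - a)) * (2 * sigma1 TYPE('a) \<eta>) - b * (2 * sigma2 TYPE('a) \<eta>) + \<tau>)
       + unit_ball_vol d * 2 ^ d * (10 * G * C * R + \<rho>M * R * (\<delta> / \<epsilon>\<^sup>2) * (L * C + 20 + 2 * d * C))))"
    using main a by (intro mult_left_mono) auto
  finally show ?thesis
    by (simp add: b_def)
qed

end

text \<open>The jump at \<open>0\<close> makes the pole attractive for every point that sees it in one move; the
  exponential makes all other points at microscopic distance favour a move towards the pole.\<close>

definition micro_jump :: "real \<Rightarrow> real \<Rightarrow> real \<Rightarrow> real" where
  "micro_jump lam \<epsilon> t = (if t = 0 then - exp lam else - exp (- (lam * t / \<epsilon>)))"

lemma micro_jump_nonpos: "micro_jump lam \<epsilon> t \<le> 0"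
  by (simp add: micro_jump_def)

lemma micro_jump_mono:
  assumes "0 \<le> lam" "0 < \<epsilon>" "0 \<le> t" "t \<le> t'"
  shows "micro_jump lam \<epsilon> t \<le> micro_jump lam \<epsilon> t'"
proof -
  have "0 \<le> lam * t' / \<epsilon>" "lam * t / \<epsilon> \<le> lam * t' / \<epsilon>"
    using assms by (auto intro!: divide_right_mono mult_left_mono)
  then have "- (lam * t' / \<epsilon>) \<le> lam" "- (lam * t' / \<epsilon>) \<le> - (lam * t / \<epsilon>)"
    using assms(1) by linarith+
  then show ?thesis
    using assms(3,4) by (simp add: micro_jump_def)
qed

context cloud
begin

section \<open>Proportions of cloud points in balls, and the barrier at microscopic distance\<close>

lemma integrable_transport:
  fixes f :: "'a \<Rightarrow> real"
  assumes f [measurable]: "f \<in> borel_measurable borel" and C: "\<And>v. \<bar>f v\<bar> \<le> C"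
  shows "set_integrable lborel \<Omega> (\<lambda>y. \<rho> y * f (T y))"
proof -
  have \<Omega> [measurable]: "\<Omega> \<in> sets borel"
    using op by simp
  have [measurable]: "(\<lambda>y. indicator \<Omega> y * \<rho> y) \<in> borel_measurable borel"
    using borel_measurable_continuous_on_indicator[OF _ \<rho>_cont] op by simp
  have Tm: "T \<in> measurable (restrict_space lborel \<Omega>) borel"
    using transport by (simp add: transport_map_def density_measure_def)
  have [measurable]: "(\<lambda>y. indicator \<Omega> y * f (T y)) \<in> borel_measurable borel"
  proof -
    have "(\<lambda>y. f (T y)) \<in> borel_measurable (restrict_space lborel \<Omega>)"
      using Tm by measurable
    then show ?thesis
      by (subst (asm) borel_measurable_restrict_space_iff) (simp_all add: mult.commute)
  qed
  have "set_integrable lborel \<Omega> (\<lambda>y. (indicator \<Omega> y * \<rho> y) * (indicator \<Omega> y * f (T y)))"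
  proof (rule set_integrable_bounded[OF _ \<Omega> bdd, of _ "\<rho>M * C"])
    fix y assume y: "y \<in> \<Omega>"
    have "\<rho> y * \<bar>f (T y)\<bar> \<le> \<rho>M * C"
      using \<rho>_bounds[OF y] \<rho>m C by (intro mult_mono) auto
    then show "\<bar>indicator \<Omega> y * \<rho> y * (indicator \<Omega> y * f (T y))\<bar> \<le> \<rho>M * C"
      using y \<rho>_bounds(1)[OF y] \<rho>m by (simp add: abs_mult)
  qed measurable
  then show ?thesis
    unfolding set_integrable_def
    by (rule Bochner_Integration.integrable_cong[THEN iffD1, rotated 2]) (auto simp: indicator_def)
qed

lemma fraction_eq_integral:
  assumes A: "A \<in> sets borel"
  shows "card {j \<in> {1..n}. x j \<in> A} / n = (LINT y:\<Omega>|lborel. \<rho> y * indicator A (T y))"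
proof -
  have "(\<Sum>j=1..n. indicator A (x j)) = (\<Sum>j\<in>{j \<in> {1..n}. x j \<in> A}. 1::real)"
    by (rule sum.mono_neutral_cong_right) (auto simp: indicator_def)
  then have "card {j \<in> {1..n}. x j \<in> A} / n = (\<Sum>j=1..n. indicator A (x j)) / n"
    by simp
  also have "\<dots> = (LINT y:\<Omega>|lborel. \<rho> y * indicator A (T y))"
  proof (rule transport_sum[OF op transport n \<rho>_cont])
    show "0 \<le> \<rho> y" if "y \<in> \<Omega>" for y
      using \<rho>_bounds(1)[OF that] \<rho>m by simp
  qed (use A in simp)
  finally show ?thesis .
qed

text \<open>Cloud points within \<open>\<epsilon>\<close> of \<open>z\<close> receive their mass
  from within \<open>\<epsilon> + \<delta> \<le> 2 * \<epsilon>\<close>, up to a null set.\<close>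

lemma fraction_upper:
  "card {j \<in> {1..n}. norm (x j - z) < \<epsilon>} / n \<le> \<rho>M * (unit_ball_vol DIM('a) * (2 * \<epsilon>) ^ DIM('a))"
proof -
  have "card {j \<in> {1..n}. norm (x j - z) < \<epsilon>} / n = (LINT y:\<Omega>|lborel. \<rho> y * indicator (ball z \<epsilon>) (T y))"
    using fraction_eq_integral[of "ball z \<epsilon>"] by (simp add: dist_norm norm_minus_commute)
  also have "\<dots> \<le> (LINT y|lborel. \<rho>M * indicator (ball z (2 * \<epsilon>)) y)"
    unfolding set_lebesgue_integral_def
  proof (rule integral_mono_AE)
    show "integrable lborel (\<lambda>y. indicat_real \<Omega> y *\<^sub>R (\<rho> y * indicator (ball z \<epsilon>) (T y)))"
    proof -
      have "set_integrable lborel \<Omega> (\<lambda>y. \<rho> y * indicator (ball z \<epsilon>) (T y))"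
        by (rule integrable_transport[where C = 1]) (simp_all add: indicator_def)
      then show ?thesis
        by (simp only: set_integrable_def)
    qed
    show "integrable lborel (\<lambda>y. \<rho>M * indicator (ball z (2 * \<epsilon>)) y)"
      using emeasure_lborel_ball_finite[of z "2 * \<epsilon>"] by simp
    show "AE y in lborel. indicat_real \<Omega> y *\<^sub>R (\<rho> y * indicator (ball z \<epsilon>) (T y)) \<le> \<rho>M * indicator (ball z (2 * \<epsilon>)) y"
      using disp
    proof eventually_elim
      fix y assume Ty: "y \<in> \<Omega> \<longrightarrow> norm (y - T y) \<le> \<delta>"
      show "indicat_real \<Omega> y *\<^sub>R (\<rho> y * indicator (ball z \<epsilon>) (T y)) \<le> \<rho>M * indicator (ball z (2 * \<epsilon>)) y"
      proof (cases "y \<in> \<Omega> \<and> T y \<in> ball z \<epsilon>")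
        case True
        have "dist z y \<le> dist z (T y) + dist (T y) y"
          by (rule dist_triangle)
        also have "\<dots> < 2 * \<epsilon>"
          using True Ty \<delta> by (simp add: dist_norm norm_minus_commute)
        finally show ?thesis
          using True \<rho>_bounds(2)[of y] by simp
      next
        case False
        then show ?thesis
          using nonneg_constants by (auto simp: indicator_def)
      qed
    qed
  qed
  also have "\<dots> = \<rho>M * (unit_ball_vol DIM('a) * (2 * \<epsilon>) ^ DIM('a))"
    using \<epsilon> by (simp add: content_ball)
  finally show ?thesis .
qed

text \<open>Almost all mass of the ball is transported into \<open>A\<close>, and there is at least
  \<open>\<rho>m\<close> times its volume.\<close>

lemma fraction_lower:
  assumes U: "ball c t \<subseteq> \<Omega>" and t: "0 < t" and A: "A \<in> sets borel"
    and near: "\<And>y w. y \<in> ball c t \<Longrightarrow> norm (y - w) \<le> \<delta> \<Longrightarrow> w \<in> A"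
  shows "\<rho>m * (unit_ball_vol DIM('a) * t ^ DIM('a)) \<le> card {j \<in> {1..n}. x j \<in> A} / n"
proof -
  have "\<rho>m * (unit_ball_vol DIM('a) * t ^ DIM('a)) = (LINT y|lborel. \<rho>m * indicator (ball c t) y)"
    using t by (simp add: content_ball)
  also have "\<dots> \<le> (LINT y:\<Omega>|lborel. \<rho> y * indicator A (T y))"
    unfolding set_lebesgue_integral_def
  proof (rule integral_mono_AE)
    show "integrable lborel (\<lambda>y. indicat_real \<Omega> y *\<^sub>R (\<rho> y * indicator A (T y)))"
    proof -
      have "set_integrable lborel \<Omega> (\<lambda>y. \<rho> y * indicator A (T y))"
        by (rule integrable_transport[where C = 1]) (use A in \<open>simp_all add: indicator_def\<close>)
      then show ?thesis
        by (simp only: set_integrable_def)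
    qed
    show "integrable lborel (\<lambda>y. \<rho>m * indicator (ball c t) y)"
      using emeasure_lborel_ball_finite[of c t] by simp
    show "AE y in lborel. \<rho>m * indicator (ball c t) y \<le> indicat_real \<Omega> y *\<^sub>R (\<rho> y * indicator A (T y))"
      using disp
    proof eventually_elim
      fix y assume Ty: "y \<in> \<Omega> \<longrightarrow> norm (y - T y) \<le> \<delta>"
      show "\<rho>m * indicator (ball c t) y \<le> indicat_real \<Omega> y *\<^sub>R (\<rho> y * indicator A (T y))"
      proof (cases "y \<in> ball c t")
        case True
        then have "y \<in> \<Omega>" "T y \<in> A"
          using U Ty near by auto
        then show ?thesis
          using True \<rho>_bounds(1)[of y] by simp
      next
        case False
        then show ?thesis
          using \<rho>_bounds(1)[of y] \<rho>m by (auto simp: indicator_def)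
      qed
    qed
  qed
  also have "\<dots> = card {j \<in> {1..n}. x j \<in> A} / n"
    using fraction_eq_integral[OF A] by simp
  finally show ?thesis .
qed

text \<open>With \<open>E = exp (- (lam * N z / \<epsilon>))\<close>, a cloud point within
  \<open>\<epsilon>\<close> of \<open>z\<close> contributes at most \<open>4 * E\<close> to the
  positive side. A proportion bounded below, the points in \<open>A\<close>, contributes a gain
  \<open>E * exp (10 * \<kappa> * lam)\<close>. Both counts scale like
  \<open>\<epsilon> ^ d\<close>, so a large \<open>lam\<close> makes the gain prevail whatever their
  ratio.\<close>

lemma micro_sum:
  fixes x0 z e :: 'a and s k r \<delta>0 lam \<kappa> :: real
  assumes s: "0 < s" "s \<le> 1/8" and k: "0 < k"
    and x0: "x0 \<in> x ` {1..n}" and z: "z \<in> x ` {1..n}" "z \<noteq> x0" and e: "norm e = 1"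
    and flat: "flat_at \<Omega> \<delta>0 x0 r e" and \<delta>0: "0 < \<delta>0" "\<delta>0 \<le> s / 16"
    and rad: "norm (z - x0) + \<epsilon> < r" and lam: "0 \<le> lam"
    and \<kappa>: "\<kappa> = min 1 k / 32" and small: "\<delta> \<le> \<kappa> * \<epsilon> / 2"
  defines "N \<equiv> \<lambda>q. tilted_norm s e (q - x0)" and "d \<equiv> DIM('a)"
  shows "(\<Sum>j=1..n. kernel_weight \<eta> \<epsilon> (norm (z - x j)) *
      (micro_jump lam \<epsilon> (max_op x n (k * \<epsilon>) N (x j)) + micro_jump lam \<epsilon> (min_op x n (k * \<epsilon>) N (x j))
        - 2 * micro_jump lam \<epsilon> (N z))) / n
    \<le> exp (- (lam * N z / \<epsilon>)) * (unit_ball_vol d * \<epsilon> ^ d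
        * (4 * \<rho>M * 2 ^ d - \<rho>m * (\<kappa> / 2) ^ d * exp (10 * \<kappa> * lam)))"
proof -
  define R where "R = norm (z - x0)"
  \<comment> \<open>\<open>p\<close> is reached from \<open>z\<close> by going
    \<open>16 * \<kappa> * \<epsilon>\<close> towards the pole; \<open>t = 1\<close> means that the
    pole is at most that far and \<open>p\<close> is the pole.\<close>
  define t where "t = min 1 (16 * \<kappa> * \<epsilon> / R)"
  define p where "p = z + t *\<^sub>R (x0 - z)"
  define E where "E = exp (- (lam * N z / \<epsilon>))"
  define A where "A = {w. norm (w - p) < 2 * \<kappa> * \<epsilon>}"
  have s2: "0 \<le> s" "s \<le> 1"
    using s by auto
  have \<kappa>0: "0 < \<kappa>" "\<kappa> \<le> 1/32" "32 * \<kappa> \<le> k"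
    using k by (auto simp: \<kappa>)
  have k\<epsilon>: "0 \<le> k * \<epsilon>"
    using k \<epsilon> by simp
  have \<kappa>\<epsilon>: "0 < \<kappa> * \<epsilon>" "32 * (\<kappa> * \<epsilon>) \<le> \<epsilon>" "32 * (\<kappa> * \<epsilon>) \<le> k * \<epsilon>"
    using \<kappa>0 \<epsilon> by (auto simp: mult.assoc[symmetric] intro: mult_right_mono)
  have R: "0 < R"
    using z by (simp add: R_def)
  have t: "0 < t" "t \<le> 1" "t * R \<le> 16 * (\<kappa> * \<epsilon>)"
  proof -
    have "t * R \<le> (16 * \<kappa> * \<epsilon> / R) * R"
      using R by (intro mult_right_mono) (auto simp: t_def)
    then show "t * R \<le> 16 * (\<kappa> * \<epsilon>)"
      using R by simp
  qed (use \<kappa>\<epsilon> R in \<open>auto simp: t_def mult.assoc\<close>)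
  have pz: "norm (p - z) = t * R" and px: "norm (p - x0) = (1 - t) * R"
  proof -
    have "p - x0 = (1 - t) *\<^sub>R (z - x0)"
      by (simp add: p_def algebra_simps)
    then show "norm (p - x0) = (1 - t) * R"
      using t by (simp add: R_def)
    show "norm (p - z) = t * R"
      using t by (simp add: p_def R_def norm_minus_commute)
  qed
  have N0: "0 \<le> N q" for q
    unfolding N_def using tilted_norm_bounds(3)[OF s2 e] .
  have Nz: "(1 - s) * R \<le> N z"
    using tilted_norm_bounds(1)[OF s2 e, of "z - x0"] by (simp add: N_def R_def)
  have Nzpos: "0 < N z"
  proof -
    have "0 < (1 - s) * R"
      using s R by simp
    then show ?thesis
      using Nz by linarith
  qed
  have hz: "micro_jump lam \<epsilon> (N z) = - E"
    using Nzpos by (simp add: micro_jump_def E_def)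
  have E0: "0 < E"
    by (simp add: E_def)
  \<comment> \<open>The segment from \<open>z\<close> to the pole may leave \<open>\<Omega>\<close>,
    so the ball is lifted along \<open>e\<close>. Flatness bounds the height of a point outside
    \<open>\<Omega>\<close> over both endpoints; averaging with weights \<open>1 - t\<close> and
    \<open>t\<close>, its height over \<open>p\<close> is at most
    \<open>36 * \<delta>0 * (\<kappa> * \<epsilon>)\<close>, less than the
    \<open>\<kappa> * \<epsilon> / 2\<close> that the lifted ball guarantees.\<close>
  have ball_\<Omega>: "ball (p + (\<kappa> * \<epsilon>) *\<^sub>R e) (\<kappa> * \<epsilon> / 2) \<subseteq> \<Omega>"
  proof (rule subsetI, rule ccontr)
    fix y assume y: "y \<in> ball (p + (\<kappa> * \<epsilon>) *\<^sub>R e) (\<kappa> * \<epsilon> / 2)" and ny: "y \<notin> \<Omega>"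
    define q where "q = y - (p + (\<kappa> * \<epsilon>) *\<^sub>R e)"
    have q: "norm q < \<kappa> * \<epsilon> / 2"
      using y by (simp add: q_def dist_norm norm_minus_commute)
    have yp: "y - p = (\<kappa> * \<epsilon>) *\<^sub>R e + q"
      by (simp add: q_def)
    have nyp: "norm (y - p) \<le> 2 * (\<kappa> * \<epsilon>)"
      using norm_triangle_ineq[of "(\<kappa> * \<epsilon>) *\<^sub>R e" q] q e \<kappa>\<epsilon> unfolding yp by simp
    have yz: "norm (y - z) \<le> 18 * (\<kappa> * \<epsilon>)"
      using norm_triangle_ineq[of "y - p" "p - z"] nyp pz t by simp
    have yx: "norm (y - x0) \<le> 2 * (\<kappa> * \<epsilon>) + (1 - t) * R"
      using norm_triangle_ineq[of "y - p" "p - x0"] nyp px by simp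
    have "(1 - t) * R \<le> 1 * R"
      using t R by (intro mult_right_mono) auto
    then have dy: "dist x0 y < r"
      using yx rad \<kappa>\<epsilon> by (simp add: dist_norm norm_minus_commute R_def)
    have "dist x0 z + \<epsilon> < r"
      using rad by (simp add: dist_norm norm_minus_commute)
    moreover have "0 < r"
      using calculation \<epsilon> zero_le_dist[of x0 z] by linarith
    ultimately have dz: "dist x0 z < r" "dist x0 x0 < r"
      using \<epsilon> by simp_all
    have in\<Omega>: "x0 \<in> \<Omega>" "z \<in> \<Omega>"
      using x0 z S by auto
    have "(1 - t) * ((y - z) \<bullet> e) \<le> (1 - t) * (\<delta>0 * norm (y - z))"
      using flat_at_le[OF flat in\<Omega>(2) ny dz(1) dy] t by (intro mult_left_mono) auto
    also have "\<dots> \<le> 1 * (\<delta>0 * (18 * (\<kappa> * \<epsilon>)))"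
      using yz t \<delta>0 by (intro mult_mono) auto
    finally have 1: "(1 - t) * ((y - z) \<bullet> e) \<le> 18 * \<delta>0 * (\<kappa> * \<epsilon>)"
      by simp
    have "t * norm (y - x0) \<le> t * (2 * (\<kappa> * \<epsilon>) + (1 - t) * R)"
      using yx t by (intro mult_left_mono) auto
    also have "\<dots> = t * (2 * (\<kappa> * \<epsilon>)) + (1 - t) * (t * R)"
      by (simp add: algebra_simps)
    also have "\<dots> \<le> 1 * (2 * (\<kappa> * \<epsilon>)) + 1 * (16 * (\<kappa> * \<epsilon>))"
    proof (rule add_mono)
      show "t * (2 * (\<kappa> * \<epsilon>)) \<le> 1 * (2 * (\<kappa> * \<epsilon>))"
        using t \<kappa>\<epsilon> by (intro mult_right_mono) auto
      have "(1 - t) * (t * R) \<le> 1 * (t * R)"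
        using t R by (intro mult_right_mono) auto
      then show "(1 - t) * (t * R) \<le> 1 * (16 * (\<kappa> * \<epsilon>))"
        using t by linarith
    qed
    finally have "t * norm (y - x0) \<le> 18 * (\<kappa> * \<epsilon>)"
      by linarith
    then have "\<delta>0 * (t * norm (y - x0)) \<le> \<delta>0 * (18 * (\<kappa> * \<epsilon>))"
      using \<delta>0 by (intro mult_left_mono) auto
    moreover have "t * ((y - x0) \<bullet> e) \<le> t * (\<delta>0 * norm (y - x0))"
      using flat_at_le[OF flat in\<Omega>(1) ny dz(2) dy] t by (intro mult_left_mono) auto
    ultimately have 2: "t * ((y - x0) \<bullet> e) \<le> 18 * \<delta>0 * (\<kappa> * \<epsilon>)"
      by (simp add: mult_ac)
    have "y - p = (1 - t) *\<^sub>R (y - z) + t *\<^sub>R (y - x0)"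
      by (simp add: p_def algebra_simps)
    then have "(y - p) \<bullet> e = (1 - t) * ((y - z) \<bullet> e) + t * ((y - x0) \<bullet> e)"
      by (simp add: inner_add_left)
    also have "\<dots> \<le> 36 * \<delta>0 * (\<kappa> * \<epsilon>)"
      using 1 2 by simp
    also have "\<dots> \<le> 36 * (1/128) * (\<kappa> * \<epsilon>)"
      using \<delta>0 s \<kappa>\<epsilon> by (intro mult_right_mono) auto
    finally have "(y - p) \<bullet> e \<le> 36 / 128 * (\<kappa> * \<epsilon>)"
      by simp
    moreover have "(y - p) \<bullet> e = \<kappa> * \<epsilon> + q \<bullet> e"
      unfolding yp using e by (simp add: inner_add_left norm_eq_1)
    moreover have "\<bar>q \<bullet> e\<bar> < \<kappa> * \<epsilon> / 2"
      using Cauchy_Schwarz_ineq2[of q e] e q by simp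
    ultimately show False
      using \<kappa>\<epsilon> by linarith
  qed
  have Am: "A \<in> sets borel"
    unfolding A_def by measurable
  have "\<rho>m * (unit_ball_vol DIM('a) * (\<kappa> * \<epsilon> / 2) ^ DIM('a)) \<le> card {j \<in> {1..n}. x j \<in> A} / n"
  proof (rule fraction_lower[OF ball_\<Omega> _ Am])
    fix y w assume y: "y \<in> ball (p + (\<kappa> * \<epsilon>) *\<^sub>R e) (\<kappa> * \<epsilon> / 2)" and w: "norm (y - w) \<le> \<delta>"
    have "w - p = (w - y) + (y - (p + (\<kappa> * \<epsilon>) *\<^sub>R e)) + (\<kappa> * \<epsilon>) *\<^sub>R e"
      by simp
    then have "norm (w - p) \<le> norm (w - y) + norm (y - (p + (\<kappa> * \<epsilon>) *\<^sub>R e)) + norm ((\<kappa> * \<epsilon>) *\<^sub>R e)"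
      using norm_triangle_ineq[of "(w - y) + (y - (p + (\<kappa> * \<epsilon>) *\<^sub>R e))" "(\<kappa> * \<epsilon>) *\<^sub>R e"]
        norm_triangle_ineq[of "w - y" "y - (p + (\<kappa> * \<epsilon>) *\<^sub>R e)"] by simp
    also have "\<dots> < 2 * (\<kappa> * \<epsilon>)"
    proof -
      have "norm (y - (p + (\<kappa> * \<epsilon>) *\<^sub>R e)) < \<kappa> * \<epsilon> / 2" "norm (w - y) \<le> \<delta>"
        "norm ((\<kappa> * \<epsilon>) *\<^sub>R e) = \<kappa> * \<epsilon>"
        using y w e \<kappa>\<epsilon> by (simp_all add: dist_norm norm_minus_commute)
      then show ?thesis
        using small by linarith
    qed
    finally show "w \<in> A"
      by (simp add: A_def mult.assoc)
  qed (use \<kappa>\<epsilon> in simp)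
  then have lower: "\<rho>m * (unit_ball_vol d * ((\<kappa> / 2) ^ d * \<epsilon> ^ d)) \<le> card {j \<in> {1..n}. x j \<in> A} / n"
    by (simp add: d_def power_mult_distrib[symmetric] mult_ac)
  define J where "J = {j \<in> {1..n}. norm (x j - z) < \<epsilon>}"
  define JA where "JA = {j \<in> {1..n}. x j \<in> A}"
  have good: "norm (x j - z) < \<epsilon> \<and> micro_jump lam \<epsilon> (min_op x n (k * \<epsilon>) N (x j)) \<le> - (E * exp (10 * \<kappa> * lam))"
    if j: "j \<in> {1..n}" "x j \<in> A" for j
  proof
    have xp: "norm (x j - p) < 2 * (\<kappa> * \<epsilon>)"
      using j by (simp add: A_def mult.assoc)
    show "norm (x j - z) < \<epsilon>"
    proof -
      have "norm (x j - z) \<le> norm (x j - p) + norm (p - z)"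
        using norm_triangle_ineq[of "x j - p" "p - z"] by simp
      then show ?thesis
        using xp pz t \<kappa>\<epsilon> by linarith
    qed
    define m where "m = min_op x n (k * \<epsilon>) N (x j)"
    have m0: "0 \<le> m"
      unfolding m_def by (rule min_op_attained[OF j(1) k\<epsilon>, of x N]) (use N0 in auto)
    have Em: "E * exp (10 * \<kappa> * lam) = exp (lam * (10 * (\<kappa> * \<epsilon>) - N z) / \<epsilon>)"
      unfolding E_def mult_exp_exp using \<epsilon> by (simp add: field_simps)
    \<comment> \<open>If the minimum is 0, the pole is visible and the jump value
      \<open>- exp lam\<close> is low enough. Otherwise the pole is too far for
      \<open>t = 1\<close>, and the full step towards it lowers the tilted norm.\<close>
    show "micro_jump lam \<epsilon> m \<le> - (E * exp (10 * \<kappa> * lam))"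
    proof (cases "m = 0")
      case True
      have "10 * (\<kappa> * \<epsilon>) - N z \<le> \<epsilon>"
        using \<kappa>\<epsilon> Nzpos by linarith
      then have "lam * (10 * (\<kappa> * \<epsilon>) - N z) / \<epsilon> \<le> lam * \<epsilon> / \<epsilon>"
        using lam \<epsilon> by (intro divide_right_mono mult_left_mono) auto
      then show ?thesis
        unfolding Em using True \<epsilon> by (simp add: micro_jump_def)
    next
      case False
      have "t \<noteq> 1"
      proof
        assume "t = 1"
        then have "p = x0"
          by (simp add: p_def)
        then have "norm (x j - x0) < 2 * (\<kappa> * \<epsilon>)"
          using xp by metis
        then have "norm (x j - x0) \<le> k * \<epsilon>"
          using \<kappa>\<epsilon> by linarith
        then have "norm (x0 - x j) \<le> k * \<epsilon>"
          by (simp only: norm_minus_commute)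
        then have "m \<le> N x0"
          unfolding m_def by (rule min_op_le[OF j(1) k\<epsilon> x0])
        then show False
          using m0 False by (simp add: N_def tilted_norm_def)
      qed
      then have tR: "t * R = 16 * (\<kappa> * \<epsilon>)"
        using R by (auto simp: t_def min_def split: if_splits)
      have "m \<le> N (x j)"
        unfolding m_def by (rule min_op_le[OF j(1) k\<epsilon>]) (use j k\<epsilon> in auto)
      also have "\<dots> \<le> tilted_norm s e (p - x0) + 2 * norm (x j - p)"
        using tilted_norm_lipschitz[OF s2 e, of "p - x0" "x j - p"] by (simp add: N_def)
      also have "p - x0 = (1 - t) *\<^sub>R (z - x0)"
        by (simp add: p_def algebra_simps)
      also have "tilted_norm s e ((1 - t) *\<^sub>R (z - x0)) = N z - t * N z"
      proof -
        have "tilted_norm s e ((1 - t) *\<^sub>R (z - x0)) = (1 - t) * N z"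
          unfolding N_def by (rule tilted_norm_scaleR) (use t in simp)
        then show ?thesis
          by (simp add: left_diff_distrib)
      qed
      finally have m: "m \<le> N z - t * N z + 2 * norm (x j - p)" .
      \<comment> \<open>The step of length \<open>16 * \<kappa> * \<epsilon>\<close> lowers the
        tilted norm by at least 7/8 of its length; the distance from \<open>x j\<close> to
        \<open>p\<close> takes back less than \<open>4 * \<kappa> * \<epsilon>\<close>. This leaves
        the 10 in the exponent.\<close>
      have "14 * (\<kappa> * \<epsilon>) \<le> t * N z"
      proof -
        have "t * ((7/8) * R) \<le> t * N z"
        proof (intro mult_left_mono)
          have "(7/8) * R \<le> (1 - s) * R"
            using s R by (intro mult_right_mono) auto
          then show "(7/8) * R \<le> N z"
            using Nz by linarith
        qed (use t in simp)
        moreover have "t * ((7/8) * R) = (7/8) * (t * R)"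
          by simp
        ultimately show ?thesis
          unfolding tR by linarith
      qed
      then have "m \<le> N z - 10 * (\<kappa> * \<epsilon>)"
        using m xp by linarith
      then have "10 * (\<kappa> * \<epsilon>) - N z \<le> - m"
        by linarith
      then have "lam * (10 * (\<kappa> * \<epsilon>) - N z) / \<epsilon> \<le> lam * (- m) / \<epsilon>"
        using lam \<epsilon> by (intro divide_right_mono mult_left_mono) auto
      then show ?thesis
        unfolding Em using False by (simp add: micro_jump_def)
    qed
  qed
  have kw: "0 \<le> kernel_weight \<eta> \<epsilon> (norm (z - q))" "kernel_weight \<eta> \<epsilon> (norm (z - q)) \<le> 2"
    "norm (q - z) < \<epsilon> \<Longrightarrow> 1 \<le> kernel_weight \<eta> \<epsilon> (norm (z - q))"
    "\<not> norm (q - z) < \<epsilon> \<Longrightarrow> kernel_weight \<eta> \<epsilon> (norm (z - q)) = 0" for q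
    using kernel_weight_bounds[OF \<eta> \<epsilon>, of "norm (z - q)"] by (auto simp: norm_minus_commute kernel_weight_def)
  have "(\<Sum>j=1..n. kernel_weight \<eta> \<epsilon> (norm (z - x j)) *
      (micro_jump lam \<epsilon> (max_op x n (k * \<epsilon>) N (x j)) + micro_jump lam \<epsilon> (min_op x n (k * \<epsilon>) N (x j))
        - 2 * micro_jump lam \<epsilon> (N z)))
    \<le> (\<Sum>j=1..n. 4 * E * indicator J j - E * exp (10 * \<kappa> * lam) * indicator JA j)"
  proof (rule sum_mono)
    fix j assume j: "j \<in> {1..n}"
    define w where "w = kernel_weight \<eta> \<epsilon> (norm (z - x j))"
    define hM hm where "hM = micro_jump lam \<epsilon> (max_op x n (k * \<epsilon>) N (x j))"
      and "hm = micro_jump lam \<epsilon> (min_op x n (k * \<epsilon>) N (x j))"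
    have h0: "hM \<le> 0" "hm \<le> 0"
      by (simp_all add: hM_def hm_def micro_jump_nonpos)
    have w0: "0 \<le> w" "w \<le> 2"
      using kw by (auto simp: w_def)
    have "w * (hM + hm - 2 * micro_jump lam \<epsilon> (N z)) = w * hM + w * hm + w * (2 * E)"
      unfolding hz by (simp add: algebra_simps)
    moreover have "w * hM \<le> 0"
      using w0 h0 by (intro mult_nonneg_nonpos) auto
    moreover have "w * (2 * E) \<le> 4 * E * indicator J j"
    proof (cases "j \<in> J")
      case True
      have "w * (2 * E) \<le> 2 * (2 * E)"
        using w0 E0 by (intro mult_right_mono) auto
      then show ?thesis
        using True by simp
    next
      case False
      then show ?thesis
        using kw(4)[of "x j"] j by (simp add: J_def w_def)
    qed
    moreover have "w * hm \<le> - (E * exp (10 * \<kappa> * lam) * indicator JA j)"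
    proof (cases "j \<in> JA")
      case True
      then have g: "norm (x j - z) < \<epsilon>" "hm \<le> - (E * exp (10 * \<kappa> * lam))"
        using good[of j] by (auto simp: JA_def hm_def)
      have "1 * (- hm) \<le> w * (- hm)"
        using kw(3)[OF g(1)] h0 by (intro mult_right_mono) (auto simp: w_def)
      then show ?thesis
        using g True by simp
    next
      case False
      then show ?thesis
        using w0 h0 by (simp add: mult_nonneg_nonpos)
    qed
    ultimately show "w * (hM + hm - 2 * micro_jump lam \<epsilon> (N z))
        \<le> 4 * E * indicator J j - E * exp (10 * \<kappa> * lam) * indicator JA j"
      by linarith
  qed
  also have "\<dots> = 4 * E * card J - E * exp (10 * \<kappa> * lam) * card JA"
  proof -
    have "(\<Sum>j=1..n. indicator B j) = real (card B)" if "B \<subseteq> {1..n}" for B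
      using that by (simp add: indicator_def sum.If_cases Int_absorb1)
    moreover have "J \<subseteq> {1..n}" "JA \<subseteq> {1..n}"
      by (auto simp: J_def JA_def)
    ultimately have "(\<Sum>j=1..n. indicator J j) = real (card J)" "(\<Sum>j=1..n. indicator JA j) = real (card JA)"
      by blast+
    then show ?thesis
      by (simp add: sum_subtractf sum_distrib_left[symmetric])
  qed
  finally have "(\<Sum>j=1..n. kernel_weight \<eta> \<epsilon> (norm (z - x j)) *
      (micro_jump lam \<epsilon> (max_op x n (k * \<epsilon>) N (x j)) + micro_jump lam \<epsilon> (min_op x n (k * \<epsilon>) N (x j))
        - 2 * micro_jump lam \<epsilon> (N z))) / n \<le> (4 * E * card J - E * exp (10 * \<kappa> * lam) * card JA) / n"
    by (intro divide_right_mono) auto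
  also have "\<dots> = 4 * E * (card J / n) - E * exp (10 * \<kappa> * lam) * (card JA / n)"
    by (simp add: diff_divide_distrib)
  also have "\<dots> \<le> 4 * E * (\<rho>M * (unit_ball_vol d * (2 * \<epsilon>) ^ d))
      - E * exp (10 * \<kappa> * lam) * (\<rho>m * (unit_ball_vol d * ((\<kappa> / 2) ^ d * \<epsilon> ^ d)))"
    using fraction_upper[of z] lower E0 by (intro diff_mono mult_left_mono) (auto simp: J_def JA_def d_def)
  also have "\<dots> = E * (unit_ball_vol d * \<epsilon> ^ d
        * (4 * \<rho>M * 2 ^ d - \<rho>m * (\<kappa> / 2) ^ d * exp (10 * \<kappa> * lam)))"
    by (simp add: power_mult_distrib algebra_simps)
  finally show ?thesis
    by (simp add: E_def)
qed

end

definition barrier_profile :: "real \<Rightarrow> real \<Rightarrow> real \<Rightarrow> real \<Rightarrow> real \<Rightarrow> real" where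
  "barrier_profile a B lam \<epsilon> t = t powr a + B * \<epsilon> powr a * micro_jump lam \<epsilon> t"

lemma barrier_profile_mono:
  assumes "0 < a" "0 \<le> B" "0 \<le> lam" "0 < \<epsilon>" "0 \<le> t" "t \<le> t'"
  shows "barrier_profile a B lam \<epsilon> t \<le> barrier_profile a B lam \<epsilon> t'"
  unfolding barrier_profile_def using assms
  by (intro add_mono powr_mono2 mult_left_mono micro_jump_mono) auto

text \<open>Monotonicity is asked only between values of \<open>w\<close>, because the barrier
  profile is known to increase only on nonnegative arguments.\<close>

lemma max_op_comp:
  assumes j: "j \<in> {1..n}" and r: "0 \<le> r"
    and mono: "\<And>p q. w p \<le> w q \<Longrightarrow> F (w p) \<le> F (w q)"
  shows "max_op x n r (\<lambda>q. F (w q)) (x j) = F (max_op x n r w (x j))"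
proof (rule antisym)
  obtain q where q: "q \<in> x ` {1..n}" "norm (q - x j) \<le> r" "max_op x n r (\<lambda>q. F (w q)) (x j) = F (w q)"
    by (rule max_op_attained[OF j r])
  obtain q' where q': "q' \<in> x ` {1..n}" "norm (q' - x j) \<le> r" "max_op x n r w (x j) = w q'"
    by (rule max_op_attained[OF j r])
  show "max_op x n r (\<lambda>q. F (w q)) (x j) \<le> F (max_op x n r w (x j))"
    using max_op_ge[OF j r q(1,2), of w] unfolding q q' by (rule mono)
  show "F (max_op x n r w (x j)) \<le> max_op x n r (\<lambda>q. F (w q)) (x j)"
    unfolding q'(3) by (rule max_op_ge[OF j r q'(1,2)])
qed

lemma min_op_comp:
  assumes j: "j \<in> {1..n}" and r: "0 \<le> r"
    and mono: "\<And>p q. w p \<le> w q \<Longrightarrow> F (w p) \<le> F (w q)"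
  shows "min_op x n r (\<lambda>q. F (w q)) (x j) = F (min_op x n r w (x j))"
proof (rule antisym)
  obtain q where q: "q \<in> x ` {1..n}" "norm (q - x j) \<le> r" "min_op x n r (\<lambda>q. F (w q)) (x j) = F (w q)"
    by (rule min_op_attained[OF j r])
  obtain q' where q': "q' \<in> x ` {1..n}" "norm (q' - x j) \<le> r" "min_op x n r w (x j) = w q'"
    by (rule min_op_attained[OF j r])
  show "F (min_op x n r w (x j)) \<le> min_op x n r (\<lambda>q. F (w q)) (x j)"
    using min_op_le[OF j r q(1,2), of w] unfolding q q' by (rule mono)
  show "min_op x n r (\<lambda>q. F (w q)) (x j) \<le> F (min_op x n r w (x j))"
    unfolding q'(3) by (rule min_op_le[OF j r q'(1,2)])
qed

lemma step_sum_scale: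
  assumes c: "0 \<le> c" and r: "0 \<le> r"
  shows "step_sum \<eta> r \<epsilon> x n (\<lambda>q. c * w q) z = c * step_sum \<eta> r \<epsilon> x n w z"
  unfolding step_sum_def sum_distrib_left
proof (rule sum.cong)
  fix j assume j: "j \<in> {1..n}"
  have "max_op x n r (\<lambda>q. c * w q) (x j) = c * max_op x n r w (x j)"
    "min_op x n r (\<lambda>q. c * w q) (x j) = c * min_op x n r w (x j)"
    using c by (auto intro!: max_op_comp[OF j r] min_op_comp[OF j r] mult_left_mono)
  then show "kernel_weight \<eta> \<epsilon> (norm (z - x j)) *
      (max_op x n r (\<lambda>q. c * w q) (x j) + min_op x n r (\<lambda>q. c * w q) (x j) - 2 * (c * w z))
    = c * (kernel_weight \<eta> \<epsilon> (norm (z - x j)) * (max_op x n r w (x j) + min_op x n r w (x j) - 2 * w z))"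
    by (simp add: algebra_simps)
qed simp

context cloud
begin

text \<open>No cancellation is used at this scale: every value that occurs is at most
  \<open>(2 * (K + 1 + k) * \<epsilon>) powr a\<close>, and the negative term is dropped. The
  exponential part of the barrier has to outweigh the result.\<close>

lemma near_sum:
  fixes x0 z e :: 'a and a s k R K :: real
  assumes a: "0 < a" and s: "0 \<le> s" "s \<le> 1" and k: "0 < k" and e: "norm e = 1"
    and near: "norm (z - x0) \<le> K * \<epsilon>"
  defines "N \<equiv> \<lambda>q. tilted_norm s e (q - x0)"
  shows "(\<Sum>j=1..n. kernel_weight \<eta> \<epsilon> (norm (z - x j)) *
      (max_op x n (k * \<epsilon>) N (x j) powr a + min_op x n (k * \<epsilon>) N (x j) powr a - 2 * N z powr a)) / n
    \<le> 4 * (2 * (K + 1 + k)) powr a * \<epsilon> powr a * (\<rho>M * (unit_ball_vol DIM('a) * (2 * \<epsilon>) ^ DIM('a)))"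
proof -
  define X where "X = (2 * (K + 1 + k) * \<epsilon>) powr a"
  define J where "J = {j \<in> {1..n}. norm (x j - z) < \<epsilon>}"
  have k\<epsilon>: "0 \<le> k * \<epsilon>"
    using k \<epsilon> by simp
  have "0 \<le> K * \<epsilon>"
    using near norm_ge_zero order_trans by blast
  then have K: "0 \<le> K"
    using \<epsilon> by (simp add: zero_le_mult_iff)
  have N0: "0 \<le> N q" for q
    unfolding N_def using tilted_norm_bounds(3)[OF s e] .
  have "(\<Sum>j=1..n. kernel_weight \<eta> \<epsilon> (norm (z - x j)) *
      (max_op x n (k * \<epsilon>) N (x j) powr a + min_op x n (k * \<epsilon>) N (x j) powr a - 2 * N z powr a))
    \<le> (\<Sum>j=1..n. (4 * X) * indicator J j)"
  proof (rule sum_mono)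
    fix j assume j: "j \<in> {1..n}"
    show "kernel_weight \<eta> \<epsilon> (norm (z - x j)) *
      (max_op x n (k * \<epsilon>) N (x j) powr a + min_op x n (k * \<epsilon>) N (x j) powr a - 2 * N z powr a)
      \<le> (4 * X) * indicator J j"
    proof (cases "j \<in> J")
      case True
      then have xz: "norm (x j - z) < \<epsilon>"
        by (simp add: J_def)
      have N_le: "N q powr a \<le> X" if "norm (q - x j) \<le> k * \<epsilon>" for q
      proof -
        have "norm (q - x0) \<le> norm (q - x j) + norm (x j - z) + norm (z - x0)"
          using norm_triangle_ineq[of "(q - x j) + (x j - z)" "z - x0"] norm_triangle_ineq[of "q - x j" "x j - z"]
          by simp
        also have "\<dots> \<le> (K + 1 + k) * \<epsilon>"
          using that xz near by (simp add: algebra_simps)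
        finally have "(1 + s) * norm (q - x0) \<le> 2 * ((K + 1 + k) * \<epsilon>)"
          using s by (intro mult_mono) auto
        then have "N q \<le> 2 * (K + 1 + k) * \<epsilon>"
          using tilted_norm_bounds(2)[OF s e, of "q - x0"] unfolding N_def mult.assoc by linarith
        then show ?thesis
          unfolding X_def using a N0 by (intro powr_mono2) auto
      qed
      obtain q where "norm (q - x j) \<le> k * \<epsilon>" "max_op x n (k * \<epsilon>) N (x j) = N q"
        by (rule max_op_attained[OF j k\<epsilon>, of x N])
      moreover obtain q' where "norm (q' - x j) \<le> k * \<epsilon>" "min_op x n (k * \<epsilon>) N (x j) = N q'"
        by (rule min_op_attained[OF j k\<epsilon>, of x N])
      ultimately have "max_op x n (k * \<epsilon>) N (x j) powr a + min_op x n (k * \<epsilon>) N (x j) powr a - 2 * N z powr a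
          \<le> X + X"
        using N_le[of q] N_le[of q'] by (smt (verit) powr_ge_zero)
      then have "kernel_weight \<eta> \<epsilon> (norm (z - x j)) *
          (max_op x n (k * \<epsilon>) N (x j) powr a + min_op x n (k * \<epsilon>) N (x j) powr a - 2 * N z powr a)
        \<le> kernel_weight \<eta> \<epsilon> (norm (z - x j)) * (X + X)"
        using kernel_weight_bounds[OF \<eta> \<epsilon>] by (intro mult_left_mono) auto
      also have "\<dots> \<le> 2 * (X + X)"
        using kernel_weight_bounds[OF \<eta> \<epsilon>] by (intro mult_right_mono) (auto simp: X_def)
      finally show ?thesis
        using True by simp
    next
      case False
      then show ?thesis
        using j by (simp add: J_def kernel_weight_def norm_minus_commute)
    qed
  qed
  also have "\<dots> = 4 * X * card J"
  proof -
    have "(\<Sum>j=1..n. indicator J j) = real (card J)"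
    proof -
      have "J \<subseteq> {1..n}"
        by (auto simp: J_def)
      then show ?thesis
        by (simp add: indicator_def sum.If_cases Int_absorb1)
    qed
    then show ?thesis
      by (simp add: sum_distrib_left[symmetric])
  qed
  finally have "(\<Sum>j=1..n. kernel_weight \<eta> \<epsilon> (norm (z - x j)) *
      (max_op x n (k * \<epsilon>) N (x j) powr a + min_op x n (k * \<epsilon>) N (x j) powr a - 2 * N z powr a)) / n
    \<le> 4 * X * card J / n"
    by (intro divide_right_mono) auto
  also have "\<dots> = 4 * X * (card J / n)"
    by simp
  also have "\<dots> \<le> 4 * X * (\<rho>M * (unit_ball_vol DIM('a) * (2 * \<epsilon>) ^ DIM('a)))"
    using fraction_upper[of z] by (intro mult_left_mono) (auto simp: J_def X_def)
  also have "X = (2 * (K + 1 + k)) powr a * \<epsilon> powr a"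
    unfolding X_def using K k \<epsilon> by (subst powr_mult) auto
  finally show ?thesis
    by (simp add: mult.assoc)
qed

text \<open>The profile is increasing, so the step sum splits into the power part \<open>S1\<close>
  and the micro part \<open>S2\<close>. The latter is never positive. From distance
  \<open>K * \<epsilon>\<close> on, \<open>S1\<close> alone is negative; below it, \<open>S1\<close>
  is merely bounded and \<open>B\<close> is chosen to make \<open>S2\<close> win.\<close>

lemma barrier_step:
  fixes x0 z e :: 'a and a s k r \<delta>0 R K \<tau> lam \<kappa> B c r0 :: real
  assumes a: "0 < a" "a < 1" and s: "0 < s" "s \<le> 1/8" and k: "0 < k"
    and x0: "x0 \<in> x ` {1..n}" and z: "z \<in> x ` {1..n}" "z \<noteq> x0" and e: "norm e = 1"
    and flat: "flat_at \<Omega> \<delta>0 x0 r e" and \<delta>0: "0 < \<delta>0" "\<delta>0 \<le> s / 16"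
    and r0: "norm (z - x0) < r0" "r0 \<le> 1" "r0 + (5 + k) * \<epsilon> < r"
    and small: "8 * \<delta> \<le> s\<^sup>2 * \<epsilon>\<^sup>2" "2 * \<delta> < k * \<epsilon>" "\<delta> \<le> \<kappa> * \<epsilon> / 2"
    and K: "16 * (1 + k) \<le> s * K"
    and cap: "\<And>(D::'a set) m R'. D \<in> sets borel \<Longrightarrow> D \<subseteq> ball 0 1 \<Longrightarrow> 0 \<notin> D \<Longrightarrow> norm m = 1 \<Longrightarrow>
      (D \<noteq> {} \<longrightarrow> m \<bullet> e \<le> - (s / 2)) \<Longrightarrow>
      (\<forall>b\<in>D. \<forall>a\<in>ball 0 1 - D. (b - a) \<bullet> e \<le> \<delta>0 * norm (b - a)) \<Longrightarrow> K \<le> R' \<Longrightarrow> 0 \<le> R' \<Longrightarrow>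
      (2 + k\<^sup>2) * (LINT v:D|lborel. \<eta> (norm v)) - R' * (LINT v:D|lborel. \<eta> (norm v) * (m \<bullet> v)) \<le> \<tau>"
    and \<kappa>: "\<kappa> = min 1 k / 32"
    and lam: "0 \<le> lam" "5 * \<rho>M * 2 ^ DIM('a) \<le> \<rho>m * (\<kappa> / 2) ^ DIM('a) * exp (10 * \<kappa> * lam)"
    and B: "B = 5 * (2 * (K + 1 + k)) powr a * exp (2 * lam * K)"
    and c: "0 < c" "(DIM('a) - (2 - a)) * (2 * sigma1 TYPE('a) \<eta>)
      - ((1 - a) * k\<^sup>2 - (204 + 50 * k\<^sup>2) * s) * (2 * sigma2 TYPE('a) \<eta>) + \<tau> \<le> - (2 * c)"
    and C: "C = 7 + k\<^sup>2 + (204 + 50 * k\<^sup>2) * s"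
    and err: "unit_ball_vol DIM('a) * 2 ^ DIM('a) * (10 * G * C * r0 + \<rho>M * (\<delta> / \<epsilon>\<^sup>2) * (L * C + 20 + 2 * real DIM('a) * C))
      < 2 * c * \<rho>m"
  shows "step_sum \<eta> (k * \<epsilon>) \<epsilon> x n (\<lambda>q. barrier_profile a B lam \<epsilon> (tilted_norm s e (q - x0))) z < 0"
proof -
  define N where "N q = tilted_norm s e (q - x0)" for q
  define R where "R = norm (z - x0)"
  define V where "V = unit_ball_vol (real DIM('a))"
  have V: "0 < V"
    by (simp add: V_def unit_ball_vol_pos)
  have s2: "0 \<le> s" "s \<le> 1"
    using s by auto
  note nn = nonneg_constants
  have k\<epsilon>: "0 \<le> k * \<epsilon>"
    using k \<epsilon> by simp
  have in\<Omega>: "x0 \<in> \<Omega>" "z \<in> \<Omega>"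
    using x0 z S by auto
  have \<rho>M0: "0 < \<rho>M"
    using \<rho>_bounds[OF in\<Omega>(1)] \<rho>m by linarith
  have R: "0 < R" "R < r0" "R \<le> 1"
    using z r0 by (auto simp: R_def)
  have "0 < s * K"
    using K k by (smt (verit))
  then have K0: "0 < K"
    using s by (simp add: zero_less_mult_iff)
  have B0: "0 < B"
    using K0 k by (simp add: B)
  have N0: "0 \<le> N q" for q
    unfolding N_def using tilted_norm_bounds(3)[OF s2 e] .
  define wt where "wt j = kernel_weight \<eta> \<epsilon> (norm (z - x j))" for j
  define S1 where "S1 = (\<Sum>j=1..n. wt j *
      (max_op x n (k * \<epsilon>) N (x j) powr a + min_op x n (k * \<epsilon>) N (x j) powr a - 2 * N z powr a))"
  define S2 where "S2 = (\<Sum>j=1..n. wt j *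
      (micro_jump lam \<epsilon> (max_op x n (k * \<epsilon>) N (x j)) + micro_jump lam \<epsilon> (min_op x n (k * \<epsilon>) N (x j))
        - 2 * micro_jump lam \<epsilon> (N z)))"
  have mono: "barrier_profile a B lam \<epsilon> (N p) \<le> barrier_profile a B lam \<epsilon> (N q)" if "N p \<le> N q" for p q
    using a B0 lam \<epsilon> N0 that by (intro barrier_profile_mono) auto
  have split: "step_sum \<eta> (k * \<epsilon>) \<epsilon> x n (\<lambda>q. barrier_profile a B lam \<epsilon> (N q)) z = S1 + B * \<epsilon> powr a * S2"
    unfolding S1_def S2_def step_sum_def sum_distrib_left sum.distrib[symmetric]
  proof (rule sum.cong)
    fix j assume j: "j \<in> {1..n}"
    have mx: "max_op x n (k * \<epsilon>) (\<lambda>q. barrier_profile a B lam \<epsilon> (N q)) (x j)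
        = barrier_profile a B lam \<epsilon> (max_op x n (k * \<epsilon>) N (x j))"
      by (rule max_op_comp[where F = "barrier_profile a B lam \<epsilon>" and w = N, OF j k\<epsilon>]) (rule mono)
    have mi: "min_op x n (k * \<epsilon>) (\<lambda>q. barrier_profile a B lam \<epsilon> (N q)) (x j)
        = barrier_profile a B lam \<epsilon> (min_op x n (k * \<epsilon>) N (x j))"
      by (rule min_op_comp[where F = "barrier_profile a B lam \<epsilon>" and w = N, OF j k\<epsilon>]) (rule mono)
    show "kernel_weight \<eta> \<epsilon> (norm (z - x j)) *
        (max_op x n (k * \<epsilon>) (\<lambda>q. barrier_profile a B lam \<epsilon> (N q)) (x j)
          + min_op x n (k * \<epsilon>) (\<lambda>q. barrier_profile a B lam \<epsilon> (N q)) (x j) - 2 * barrier_profile a B lam \<epsilon> (N z))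
      = wt j * (max_op x n (k * \<epsilon>) N (x j) powr a + min_op x n (k * \<epsilon>) N (x j) powr a - 2 * N z powr a)
        + B * \<epsilon> powr a * (wt j * (micro_jump lam \<epsilon> (max_op x n (k * \<epsilon>) N (x j))
          + micro_jump lam \<epsilon> (min_op x n (k * \<epsilon>) N (x j)) - 2 * micro_jump lam \<epsilon> (N z)))"
      unfolding mx mi by (simp add: barrier_profile_def wt_def algebra_simps)
  qed simp
  define E where "E = exp (- (lam * N z / \<epsilon>))"
  have rad: "r0 + (5 * \<epsilon> + k * \<epsilon>) < r"
    using r0(3) by (simp add: algebra_simps)
  have "S2 / n \<le> E * (V * \<epsilon> ^ DIM('a) * (4 * \<rho>M * 2 ^ DIM('a) - \<rho>m * (\<kappa> / 2) ^ DIM('a) * exp (10 * \<kappa> * lam)))"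
    unfolding S2_def E_def V_def wt_def N_def
  proof (rule micro_sum[OF s k x0 z e flat \<delta>0 _ lam(1) \<kappa> small(3)])
    show "norm (z - x0) + \<epsilon> < r"
      using R rad k\<epsilon> \<epsilon> unfolding R_def by linarith
  qed
  \<comment> \<open>The 5 in the choice of \<open>lam\<close> against the 4 of
    \<open>micro_sum\<close> leaves a definite negative multiple of \<open>\<rho>M\<close>.\<close>
  also have "\<dots> \<le> E * (V * \<epsilon> ^ DIM('a) * (- (\<rho>M * 2 ^ DIM('a))))"
    using lam(2) V \<epsilon> by (intro mult_left_mono) (auto simp: E_def)
  finally have S2: "S2 / n \<le> - (E * (V * \<epsilon> ^ DIM('a) * (\<rho>M * 2 ^ DIM('a))))"
    by simp
  have "(S1 + B * \<epsilon> powr a * S2) / n < 0"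
  proof (cases "K * \<epsilon> \<le> R")
    case True
    have "S1 / n \<le> a * R powr (a - 2) * (\<epsilon> ^ (DIM('a) + 2) *
      (\<rho> z * ((DIM('a) - (2 - a)) * (2 * sigma1 TYPE('a) \<eta>) - ((1 - a) * k\<^sup>2 - (204 + 50 * k\<^sup>2) * s) * (2 * sigma2 TYPE('a) \<eta>) + \<tau>)
       + unit_ball_vol DIM('a) * 2 ^ DIM('a) * (10 * G * (7 + k\<^sup>2 + (204 + 50 * k\<^sup>2) * s) * R
         + \<rho>M * R * (\<delta> / \<epsilon>\<^sup>2) * (L * (7 + k\<^sup>2 + (204 + 50 * k\<^sup>2) * s) + 20 + 2 * real DIM('a) * (7 + k\<^sup>2 + (204 + 50 * k\<^sup>2) * s)))))"
      unfolding S1_def wt_def N_def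
    proof (rule far_sum[OF a s k in\<Omega> R_def e flat \<delta>0 _ R(3) _ small(1,2) True cap])
      have "16 * (1 + k) * \<epsilon> \<le> s * K * \<epsilon>"
        using K \<epsilon> by (intro mult_right_mono) auto
      also have "\<dots> \<le> s * R"
        using True s by (simp add: mult.assoc)
      finally show "16 * (1 + k) * \<epsilon> \<le> s * R" .
      show "R + (5 + k) * \<epsilon> < r"
        using R r0 by linarith
    qed
    also have "\<dots> < 0"
    proof -
      define Y where "Y = (DIM('a) - (2 - a)) * (2 * sigma1 TYPE('a) \<eta>) - ((1 - a) * k\<^sup>2 - (204 + 50 * k\<^sup>2) * s) * (2 * sigma2 TYPE('a) \<eta>) + \<tau>"
      have "Y \<le> - (2 * c)"
        using c by (simp add: Y_def)
      then have "\<rho> z * Y \<le> \<rho> z * (- (2 * c))"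
        using \<rho>_bounds(1)[OF in\<Omega>(2)] \<rho>m by (intro mult_left_mono) auto
      also have "\<dots> \<le> \<rho>m * (- (2 * c))"
        using \<rho>_bounds(1)[OF in\<Omega>(2)] c by (intro mult_right_mono_neg) auto
      finally have 1: "\<rho> z * Y \<le> - (2 * c * \<rho>m)"
        by (simp add: mult_ac)
      have C0: "0 \<le> C"
        using s by (simp add: C)
      have "10 * G * C * R + \<rho>M * R * (\<delta> / \<epsilon>\<^sup>2) * (L * C + 20 + 2 * real DIM('a) * C)
          \<le> 10 * G * C * r0 + \<rho>M * 1 * (\<delta> / \<epsilon>\<^sup>2) * (L * C + 20 + 2 * real DIM('a) * C)"
        using R C0 nn \<delta> \<epsilon> by (intro add_mono mult_left_mono mult_right_mono mult_nonneg_nonneg add_nonneg_nonneg) auto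
      then have "unit_ball_vol DIM('a) * 2 ^ DIM('a) * (10 * G * C * R + \<rho>M * R * (\<delta> / \<epsilon>\<^sup>2) * (L * C + 20 + 2 * real DIM('a) * C))
          \<le> unit_ball_vol DIM('a) * 2 ^ DIM('a) * (10 * G * C * r0 + \<rho>M * (\<delta> / \<epsilon>\<^sup>2) * (L * C + 20 + 2 * real DIM('a) * C))"
        by (intro mult_left_mono) auto
      then have "\<rho> z * Y + unit_ball_vol DIM('a) * 2 ^ DIM('a) * (10 * G * C * R
          + \<rho>M * R * (\<delta> / \<epsilon>\<^sup>2) * (L * C + 20 + 2 * real DIM('a) * C)) < 0"
        using 1 err by linarith
      then show ?thesis
        unfolding Y_def C using a R \<epsilon> by (intro mult_pos_neg) auto
    qed
    finally have "S1 / n < 0" .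
    moreover have "B * \<epsilon> powr a * (S2 / n) \<le> 0"
    proof (rule mult_nonneg_nonpos)
      have "0 \<le> E * (V * \<epsilon> ^ DIM('a) * (\<rho>M * 2 ^ DIM('a)))"
        using V \<epsilon> \<rho>M0 by (simp add: E_def)
      then show "S2 / n \<le> 0"
        using S2 by linarith
    qed (use B0 in simp)
    ultimately show ?thesis
      by (simp add: add_divide_distrib)
  next
    case False
    define Q where "Q = \<epsilon> powr a * (V * \<epsilon> ^ DIM('a) * (\<rho>M * 2 ^ DIM('a)))"
    define X where "X = (2 * (K + 1 + k)) powr a"
    have Q: "0 < Q"
      using V \<epsilon> \<rho>M0 by (simp add: Q_def)
    have X: "0 < X"
      using K0 k by (simp add: X_def)
    have "S1 / n \<le> 4 * X * \<epsilon> powr a * (\<rho>M * (V * (2 * \<epsilon>) ^ DIM('a)))"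
      unfolding S1_def wt_def N_def X_def V_def
      using False by (intro near_sum[OF a(1) s2 k e]) (simp add: R_def)
    also have "\<dots> = 4 * X * Q"
      by (simp add: Q_def power_mult_distrib mult_ac)
    finally have 1: "S1 / n \<le> 4 * X * Q" .
    \<comment> \<open>At this distance the exponential has decayed at most to
      \<open>exp (- (2 * lam * K))\<close>; the reciprocal factor in \<open>B\<close> undoes that,
      so \<open>5 * X\<close> stands against \<open>4 * X\<close>.\<close>
    have "N z \<le> (1 + s) * R"
      using tilted_norm_bounds(2)[OF s2 e] by (simp add: N_def R_def)
    also have "\<dots> \<le> 2 * (K * \<epsilon>)"
      using s False R by (intro mult_mono) auto
    finally have "lam * N z / \<epsilon> \<le> lam * (2 * (K * \<epsilon>)) / \<epsilon>"
      using lam \<epsilon> by (intro divide_right_mono mult_left_mono) auto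
    then have E: "exp (- (2 * lam * K)) \<le> E"
      using \<epsilon> by (simp add: E_def mult_ac)
    have "5 * X = B * exp (- (2 * lam * K))"
      by (simp add: B X_def exp_minus)
    also have "\<dots> \<le> B * E"
      using E B0 by (intro mult_left_mono) auto
    finally have "5 * X * Q \<le> B * E * Q"
      using Q by (intro mult_right_mono) auto
    moreover have "B * \<epsilon> powr a * (S2 / n) \<le> B * \<epsilon> powr a * (- (E * (V * \<epsilon> ^ DIM('a) * (\<rho>M * 2 ^ DIM('a)))))"
      using S2 B0 by (intro mult_left_mono) auto
    moreover have "B * \<epsilon> powr a * (- (E * (V * \<epsilon> ^ DIM('a) * (\<rho>M * 2 ^ DIM('a))))) = - (B * E * Q)"
      by (simp add: Q_def)
    moreover have "0 < X * Q"
      using X Q by simp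
    ultimately have "S1 / n + B * \<epsilon> powr a * (S2 / n) < 0"
      using 1 by linarith
    then show ?thesis
      by (simp add: add_divide_distrib)
  qed
  then have "S1 + B * \<epsilon> powr a * S2 < 0"
    using n by (simp add: divide_less_0_iff)
  then show ?thesis
    using split by (simp add: N_def)
qed

end

context cloud
begin

subsection \<open>Comparison\<close>

lemma graph_connected:
  assumes conn: "connected \<Omega>" and small: "4 * \<delta> \<le> \<epsilon>"
    and A: "A \<subseteq> x ` {1..n}" "A \<noteq> {}"
    and closed: "\<And>a b. a \<in> A \<Longrightarrow> b \<in> x ` {1..n} \<Longrightarrow> norm (a - b) < \<epsilon> \<Longrightarrow> b \<in> A"
  shows "A = x ` {1..n}"
proof (rule cover_connected[OF conn S _ A closed])
  show "\<exists>q\<in>x ` {1..n}. norm (y - q) < \<epsilon> / 2" if y: "y \<in> \<Omega>" for y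
  proof -
    obtain q where "q \<in> x ` {1..n}" "norm (y - q) < 2 * \<delta>"
      using cover[OF y] by blast
    then show ?thesis
      using small by (intro bexI[of _ q]) auto
  qed
qed

text \<open>Adding \<open>A * (B * \<epsilon> powr a * exp lam)\<close> makes the barrier vanish at
  its pole. Because of the jump, every other point then has the surplus
  \<open>micro_jump + exp lam\<close> available in \<open>bdry\<close>; the same constant is the
  error of order \<open>\<epsilon> powr a\<close> in the conclusion.\<close>

lemma cone_comparison:
  fixes a B lam s A r r0 :: real and u :: "'a \<Rightarrow> real" and e x0 :: 'a and Lb :: "'a set"
  assumes a: "0 < a" and B: "0 \<le> B" and r: "0 \<le> r" and A: "0 < A"
    and zero: "\<And>z. z \<in> x ` {1..n} - Lb \<Longrightarrow> step_sum \<eta> r \<epsilon> x n u z = 0"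
    and bar: "\<And>z. z \<in> x ` {1..n} \<Longrightarrow> z \<noteq> x0 \<Longrightarrow> norm (z - x0) < r0 \<Longrightarrow>
      step_sum \<eta> r \<epsilon> x n (\<lambda>q. barrier_profile a B lam \<epsilon> (tilted_norm s e (q - x0))) z < 0"
    and bdry: "\<And>z. z \<in> x ` {1..n} \<Longrightarrow> z \<noteq> x0 \<Longrightarrow> z \<in> Lb \<or> r0 \<le> norm (z - x0) \<Longrightarrow>
      u z - u x0 \<le> A * (tilted_norm s e (z - x0) powr a
        + B * \<epsilon> powr a * (micro_jump lam \<epsilon> (tilted_norm s e (z - x0)) + exp lam))"
    and z: "z \<in> x ` {1..n}"
  shows "u z - u x0 \<le> A * (tilted_norm s e (z - x0) powr a + B * \<epsilon> powr a * exp lam)"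
proof -
  define N where "N q = tilted_norm s e (q - x0)" for q
  define W where "W q = A * barrier_profile a B lam \<epsilon> (N q)" for q
  have W: "W q = A * (N q powr a + B * \<epsilon> powr a * (micro_jump lam \<epsilon> (N q) + exp lam)) - A * (B * \<epsilon> powr a * exp lam)" for q
    by (simp add: W_def barrier_profile_def algebra_simps)
  have "u z - W z \<le> u x0 + A * (B * \<epsilon> powr a * exp lam)"
  proof (rule step_sum_comparison[OF \<eta> \<epsilon> r _ _ z, where A = "{q. q = x0 \<or> q \<in> Lb \<or> r0 \<le> norm (q - x0)}"])
    fix q assume q: "q \<in> x ` {1..n} - {q. q = x0 \<or> q \<in> Lb \<or> r0 \<le> norm (q - x0)}"
    then have "step_sum \<eta> r \<epsilon> x n (\<lambda>q. barrier_profile a B lam \<epsilon> (N q)) q < 0"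
      unfolding N_def by (intro bar) auto
    then have "A * step_sum \<eta> r \<epsilon> x n (\<lambda>q. barrier_profile a B lam \<epsilon> (N q)) q < 0"
      using A by (simp add: mult_less_0_iff)
    then have "step_sum \<eta> r \<epsilon> x n W q < 0"
      unfolding W_def using step_sum_scale[of A r \<eta> \<epsilon> x n "\<lambda>q. barrier_profile a B lam \<epsilon> (N q)" q] A r by simp
    then show "step_sum \<eta> r \<epsilon> x n W q < step_sum \<eta> r \<epsilon> x n u q"
      using zero[of q] q by simp
  next
    fix q assume q: "q \<in> x ` {1..n} \<inter> {q. q = x0 \<or> q \<in> Lb \<or> r0 \<le> norm (q - x0)}"
    show "u q - W q \<le> u x0 + A * (B * \<epsilon> powr a * exp lam)"
    proof (cases "q = x0")
      case True
      then show ?thesis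
        by (simp add: W N_def tilted_norm_def micro_jump_def)
    next
      case False
      then have "u q - u x0 \<le> A * (N q powr a + B * \<epsilon> powr a * (micro_jump lam \<epsilon> (N q) + exp lam))"
        unfolding N_def using q by (intro bdry) auto
      then show ?thesis
        unfolding W by linarith
    qed
  qed
  moreover have "W z \<le> A * N z powr a"
  proof -
    have "B * \<epsilon> powr a * micro_jump lam \<epsilon> (N z) \<le> 0"
      using B by (intro mult_nonneg_nonpos micro_jump_nonpos) auto
    then show ?thesis
      unfolding W_def barrier_profile_def using A by (intro mult_left_mono) auto
  qed
  ultimately show ?thesis
    by (simp add: N_def distrib_left)
qed

text \<open>\<open>A\<close> is chosen so that the power term alone exceeds the oscillation
  \<open>2 * Y\<close> at distance \<open>r0\<close>, which settles the outer boundary in both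
  rounds. In the round \<open>label\<close> no other label is nearer than \<open>r0\<close>. In the
  round \<open>pair\<close> a label near the pole is handled by \<open>label\<close> for
  \<open>- u\<close>. The axes of the two barriers differ, so the transfer goes through the
  Euclidean norm.\<close>

lemma holder_estimate:
  fixes a B lam s r r0 Y :: real and u :: "'a \<Rightarrow> real" and Lb :: "'a set"
  assumes a: "0 < a" "a < 1" and B: "0 \<le> B" and r: "0 \<le> r" and s: "0 < s" "s \<le> 1/8" and lam: "1 \<le> lam"
    and r0: "0 < r0" and Y: "0 < Y" and conn: "connected \<Omega>" and small: "4 * \<delta> \<le> \<epsilon>"
    and bar: "\<And>x0. x0 \<in> x ` {1..n} \<Longrightarrow> \<exists>e. norm e = 1 \<and> (\<forall>z\<in>x ` {1..n}. z \<noteq> x0 \<longrightarrow> norm (z - x0) < r0 \<longrightarrow>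
      step_sum \<eta> r \<epsilon> x n (\<lambda>q. barrier_profile a B lam \<epsilon> (tilted_norm s e (q - x0))) z < 0)"
    and Lb: "Lb \<subseteq> x ` {1..n}" "Lb \<noteq> {}" "\<And>p q. p \<in> Lb \<Longrightarrow> q \<in> Lb \<Longrightarrow> p \<noteq> q \<Longrightarrow> r0 \<le> norm (p - q)"
    and uL: "\<And>p. p \<in> Lb \<Longrightarrow> \<bar>u p\<bar> \<le> Y"
    and zero: "\<And>z. z \<in> x ` {1..n} - Lb \<Longrightarrow> step_sum \<eta> r \<epsilon> x n u z = 0"
    and p: "p \<in> x ` {1..n}" and q: "q \<in> x ` {1..n}"
  defines "A \<equiv> 2 * Y / ((7/8) * r0) powr a"
  shows "\<bar>u p - u q\<bar> \<le> 4 * A * ((2 * norm (p - q)) powr a + B * \<epsilon> powr a * exp lam)"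
proof -
  have A0: "0 < A"
    using Y r0 by (simp add: A_def)
  have s2: "0 \<le> s" "s \<le> 1"
    using s by auto
  define E where "E = exp lam"
  have E: "2 \<le> E"
    using lam exp_ge_add_one_self[of lam] unfolding E_def by linarith
  have zero': "step_sum \<eta> r \<epsilon> x n (\<lambda>q. - u q) z = 0" if "z \<in> x ` {1..n} - Lb" for z
    using zero[OF that] step_sum_uminus[OF r, of \<eta> \<epsilon> x n u z] by simp
  have max: "u z \<le> Y" "- u z \<le> Y" if z: "z \<in> x ` {1..n}" for z
  proof -
    show "u z \<le> Y"
      by (rule step_sum_maximum_principle[OF \<eta> \<epsilon> r graph_connected[OF conn small] zero _ _ z])
         (use Lb uL in \<open>auto simp: abs_le_iff\<close>)
    show "- u z \<le> Y"
      by (rule step_sum_maximum_principle[OF \<eta> \<epsilon> r graph_connected[OF conn small] zero' _ _ z])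
         (use Lb uL in \<open>auto simp: abs_le_iff\<close>)
  qed
  have N_bounds: "(7/8) * norm v \<le> tilted_norm s e v" "tilted_norm s e v \<le> 2 * norm v" "0 \<le> tilted_norm s e v"
    if e: "norm e = 1" for e v :: 'a
  proof -
    have "(7/8) * norm v \<le> (1 - s) * norm v" "(1 + s) * norm v \<le> 2 * norm v"
      using s by (intro mult_right_mono; simp)+
    then show "(7/8) * norm v \<le> tilted_norm s e v" "tilted_norm s e v \<le> 2 * norm v" "0 \<le> tilted_norm s e v"
      using tilted_norm_bounds[OF s2 e, of v] by linarith+
  qed
  have far: "2 * Y \<le> A * tilted_norm s e v powr a" if "norm e = 1" "r0 \<le> norm v" for e v :: 'a
  proof -
    have "((7/8) * r0) powr a \<le> tilted_norm s e v powr a"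
      using N_bounds(1)[OF that(1), of v] that(2) r0 a by (intro powr_mono2) auto
    then have "A * ((7/8) * r0) powr a \<le> A * tilted_norm s e v powr a"
      using A0 by (intro mult_left_mono) auto
    then show ?thesis
      using r0 by (simp add: A_def)
  qed
  have jump: "micro_jump lam \<epsilon> (tilted_norm s e v) + E \<ge> E - 1" "0 \<le> micro_jump lam \<epsilon> (tilted_norm s e v) + E"
    if e: "norm e = 1" and "v \<noteq> 0" for e v :: 'a
  proof -
    have "0 < (7/8) * norm v"
      using \<open>v \<noteq> 0\<close> by simp
    then have "0 < tilted_norm s e v"
      using N_bounds(1)[OF e, of v] by linarith
    moreover from this have "0 \<le> lam * tilted_norm s e v / \<epsilon>"
      using lam \<epsilon> by simp
    ultimately have "- 1 \<le> micro_jump lam \<epsilon> (tilted_norm s e v)"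
      by (simp add: micro_jump_def)
    then show "micro_jump lam \<epsilon> (tilted_norm s e v) + E \<ge> E - 1" "0 \<le> micro_jump lam \<epsilon> (tilted_norm s e v) + E"
      using E by auto
  qed
  have label: "w z - w l \<le> A * ((2 * norm (z - l)) powr a + B * \<epsilon> powr a * E)"
    if l: "l \<in> Lb" and z: "z \<in> x ` {1..n}"
      and w0: "\<And>z. z \<in> x ` {1..n} - Lb \<Longrightarrow> step_sum \<eta> r \<epsilon> x n w z = 0"
      and wb: "\<And>z. z \<in> x ` {1..n} \<Longrightarrow> \<bar>w z\<bar> \<le> Y" for w z l
  proof -
    have lS: "l \<in> x ` {1..n}"
      using l Lb by auto
    obtain e where e: "norm e = 1" and be: "\<And>z. z \<in> x ` {1..n} \<Longrightarrow> z \<noteq> l \<Longrightarrow> norm (z - l) < r0 \<Longrightarrow>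
        step_sum \<eta> r \<epsilon> x n (\<lambda>q. barrier_profile a B lam \<epsilon> (tilted_norm s e (q - l))) z < 0"
      using bar[OF lS] by auto
    have "w z - w l \<le> A * (tilted_norm s e (z - l) powr a + B * \<epsilon> powr a * exp lam)"
    proof (rule cone_comparison[OF a(1) B r A0 w0 be _ z])
      fix z assume z: "z \<in> x ` {1..n}" "z \<noteq> l" "z \<in> Lb \<or> r0 \<le> norm (z - l)"
      then have "r0 \<le> norm (z - l)"
        using Lb(3)[OF _ l] by auto
      then have "2 * Y \<le> A * tilted_norm s e (z - l) powr a"
        by (rule far[OF e])
      moreover have "w z - w l \<le> 2 * Y"
        using wb[OF z(1)] wb[OF lS] by linarith
      moreover have "0 \<le> A * (B * \<epsilon> powr a * (micro_jump lam \<epsilon> (tilted_norm s e (z - l)) + exp lam))"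
        using A0 B jump(2)[OF e, of "z - l"] z by (simp add: E_def)
      ultimately show "w z - w l \<le> A * (tilted_norm s e (z - l) powr a
          + B * \<epsilon> powr a * (micro_jump lam \<epsilon> (tilted_norm s e (z - l)) + exp lam))"
        by (simp add: distrib_left)
    qed
    also have "\<dots> \<le> A * ((2 * norm (z - l)) powr a + B * \<epsilon> powr a * E)"
      using N_bounds[OF e, of "z - l"] a A0 unfolding E_def
      by (intro mult_left_mono add_right_mono powr_mono2) auto
    finally show ?thesis .
  qed
  have pair: "u z - u x0 \<le> 4 * A * ((2 * norm (z - x0)) powr a + B * \<epsilon> powr a * E)"
    if x0: "x0 \<in> x ` {1..n}" and z: "z \<in> x ` {1..n}" for x0 z
  proof -
    obtain e where e: "norm e = 1" and be: "\<And>z. z \<in> x ` {1..n} \<Longrightarrow> z \<noteq> x0 \<Longrightarrow> norm (z - x0) < r0 \<Longrightarrow>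
        step_sum \<eta> r \<epsilon> x n (\<lambda>q. barrier_profile a B lam \<epsilon> (tilted_norm s e (q - x0))) z < 0"
      using bar[OF x0] by auto
    have "u z - u x0 \<le> (4 * A) * (tilted_norm s e (z - x0) powr a + B * \<epsilon> powr a * exp lam)"
    proof (rule cone_comparison[OF a(1) B r _ zero be _ z])
      show "0 < 4 * A"
        using A0 by simp
      fix z assume z: "z \<in> x ` {1..n}" "z \<noteq> x0" "z \<in> Lb \<or> r0 \<le> norm (z - x0)"
      define M where "M = tilted_norm s e (z - x0)"
      define h where "h = micro_jump lam \<epsilon> M + exp lam"
      have h: "E - 1 \<le> h" "0 \<le> h"
        using jump[OF e, of "z - x0"] z by (auto simp: h_def M_def E_def)
      have B\<epsilon>: "0 \<le> B * \<epsilon> powr a"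
        using B by simp
      show "u z - u x0 \<le> (4 * A) * (M powr a + B * \<epsilon> powr a * h)"
      proof (cases "r0 \<le> norm (z - x0)")
        case True
        then have "2 * Y \<le> A * M powr a"
          unfolding M_def by (rule far[OF e])
        moreover have "u z - u x0 \<le> 2 * Y"
          using max[OF z(1)] max[OF x0] by linarith
        moreover have "0 \<le> 4 * A * (B * \<epsilon> powr a * h)" "0 \<le> A * M powr a"
          using A0 B\<epsilon> h by auto
        moreover have "(4 * A) * (M powr a + B * \<epsilon> powr a * h) = 4 * (A * M powr a) + 4 * A * (B * \<epsilon> powr a * h)"
          by (simp add: distrib_left)
        ultimately show ?thesis
          by linarith
      next
        case False
        then have zL: "z \<in> Lb"
          using z by auto
        have "(- u x0) - (- u z) \<le> A * ((2 * norm (x0 - z)) powr a + B * \<epsilon> powr a * E)"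
        proof (rule label[OF zL x0 zero'])
          show "\<bar>- u z\<bar> \<le> Y" if "z \<in> x ` {1..n}" for z
            using max[OF that] by (simp add: abs_le_iff)
        qed
        \<comment> \<open>Origin of the 4: \<open>norm (x0 - z)\<close> is at most
          \<open>(8/7) * M\<close>, which gives \<open>(16/7) powr a \<le> 4\<close>; and
          \<open>h \<ge> E - 1\<close> is at least half of \<open>E\<close> because
          \<open>E \<ge> 2\<close>.\<close>
        also have "\<dots> \<le> A * (4 * M powr a + B * \<epsilon> powr a * (4 * h))"
        proof (intro mult_left_mono add_mono)
          have "(2 * norm (x0 - z)) powr a \<le> ((16/7) * M) powr a"
            using N_bounds(1)[OF e, of "z - x0"] a by (intro powr_mono2) (auto simp: M_def norm_minus_commute)
          also have "\<dots> = (16/7) powr a * M powr a"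
            using N_bounds(3)[OF e, of "z - x0"] by (subst powr_mult) (auto simp: M_def)
          also have "\<dots> \<le> (16/7) powr 1 * M powr a"
            using a by (intro mult_right_mono powr_mono) auto
          also have "\<dots> \<le> 4 * M powr a"
            by (intro mult_right_mono) auto
          finally show "(2 * norm (x0 - z)) powr a \<le> 4 * M powr a" .
          show "E \<le> 4 * h"
            using h E by linarith
        qed (use A0 B\<epsilon> in auto)
        finally show ?thesis
          by (simp add: algebra_simps)
      qed
    qed
    also have "\<dots> \<le> 4 * A * ((2 * norm (z - x0)) powr a + B * \<epsilon> powr a * E)"
      using N_bounds[OF e, of "z - x0"] a A0 unfolding E_def
      by (intro mult_left_mono add_right_mono powr_mono2) auto
    finally show ?thesis .
  qed
  show ?thesis
    using pair[OF p q] pair[OF q p] unfolding E_def by (simp add: norm_minus_commute abs_le_iff)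
qed

end

text \<open>
  The constants are chosen in the order \<open>s\<close>, \<open>\<delta>0\<close> and \<open>K\<close> (from the cap estimate), the flatness radius \<open>r\<close>,
  \<open>r0\<close>, \<open>lam\<close>, \<open>B\<close>, and finally the smallness of \<open>\<epsilon>\<close> and of \<open>\<delta> / \<epsilon>\<^sup>2\<close>.
\<close>

lemma uniform_barrier:
  fixes \<Omega> :: "'a::euclidean_space set" and a k c \<rho>m \<rho>M G L rs :: real
  assumes C1: "C1_boundary \<Omega>" and bdd: "bounded \<Omega>" and \<eta>: "admissible_kernel \<eta>"
    and a: "0 < a" "a < 1" and k: "0 < k" and \<rho>: "0 < \<rho>m" "0 < \<rho>M" and G: "0 \<le> G" and L: "0 \<le> L" and rs: "0 < rs"
    and c: "0 < c" "(DIM('a) - (2 - a)) * (2 * sigma1 TYPE('a) \<eta>) - (1 - a) * k\<^sup>2 * (2 * sigma2 TYPE('a) \<eta>) \<le> - (4 * c)"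
  shows "\<exists>s lam B r0 t \<epsilon>1. 0 < s \<and> s \<le> 1/8 \<and> 1 \<le> lam \<and> 0 \<le> B \<and> 0 < r0 \<and> r0 \<le> rs \<and> 0 < t \<and> 0 < \<epsilon>1 \<and>
    (\<forall>\<rho> g x n T \<epsilon> \<delta>. cloud \<Omega> \<rho> g x n T \<eta> \<epsilon> \<delta> \<rho>m \<rho>M G L \<longrightarrow> \<epsilon> \<le> \<epsilon>1 \<longrightarrow> \<delta> \<le> t * \<epsilon>\<^sup>2 \<longrightarrow>
      (\<forall>x0\<in>x ` {1..n}. \<exists>e. norm e = 1 \<and> (\<forall>z\<in>x ` {1..n}. z \<noteq> x0 \<longrightarrow> norm (z - x0) < r0 \<longrightarrow>
        step_sum \<eta> (k * \<epsilon>) \<epsilon> x n (\<lambda>q. barrier_profile a B lam \<epsilon> (tilted_norm s e (q - x0))) z < 0)))"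
proof -
  define d where "d = DIM('a)"
  define \<beta> where "\<beta> = unit_ball_vol (real DIM('a))"
  have \<beta>: "0 < \<beta>"
    by (simp add: \<beta>_def unit_ball_vol_pos)
  define \<sigma>2 where "\<sigma>2 = sigma2 TYPE('a) \<eta>"
  have \<sigma>2: "0 < \<sigma>2"
    using sigma2_pos[OF \<eta>] by (simp add: \<sigma>2_def)
  define A where "A = (204 + 50 * k\<^sup>2) * (2 * \<sigma>2)"
  have A: "0 < A"
    using \<sigma>2 by (auto simp: A_def intro!: mult_pos_pos add_pos_nonneg)
  \<comment> \<open>The total error caused by the tilt,
    \<open>(204 + 50 * k^2) * s * (2 * \<sigma>2)\<close>, has to stay below
    \<open>c\<close>.\<close>
  define s where "s = min (1/8) (c / A)"
  have s: "0 < s" "s \<le> 1/8" "s \<le> c / A"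
  proof -
    have "0 < c / A"
      using c A by simp
    then show "0 < s" "s \<le> 1/8" "s \<le> c / A"
      unfolding s_def by linarith+
  qed
  then have sA: "(204 + 50 * k\<^sup>2) * s * (2 * \<sigma>2) \<le> c"
    using A by (simp add: A_def pos_le_divide_eq mult_ac)
  have s': "0 < s / 2" "s / 2 \<le> 1"
    using s by auto
  have "0 \<le> 2 + k\<^sup>2"
    by simp
  then have "\<exists>\<delta>1>0. \<exists>K0. \<forall>(D::'a set) e m R.
     D \<in> sets borel \<longrightarrow> D \<subseteq> ball 0 1 \<longrightarrow> 0 \<notin> D \<longrightarrow> norm e = 1 \<longrightarrow> norm m = 1 \<longrightarrow>
     (D \<noteq> {} \<longrightarrow> m \<bullet> e \<le> - (s / 2)) \<longrightarrow>
     (\<forall>b\<in>D. \<forall>a\<in>ball 0 1 - D. (b - a) \<bullet> e \<le> \<delta>1 * norm (b - a)) \<longrightarrow> K0 \<le> R \<longrightarrow> 0 \<le> R \<longrightarrow>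
     (2 + k\<^sup>2) * (LINT v:D|lborel. \<eta> (norm v)) - R * (LINT v:D|lborel. \<eta> (norm v) * (m \<bullet> v)) \<le> c"
    by (rule cap_integral[OF \<eta> s' c(1)])
  then obtain \<delta>1 K0 where \<delta>1: "0 < \<delta>1" and cap: "\<forall>(D::'a set) e m R.
     D \<in> sets borel \<longrightarrow> D \<subseteq> ball 0 1 \<longrightarrow> 0 \<notin> D \<longrightarrow> norm e = 1 \<longrightarrow> norm m = 1 \<longrightarrow>
     (D \<noteq> {} \<longrightarrow> m \<bullet> e \<le> - (s / 2)) \<longrightarrow>
     (\<forall>b\<in>D. \<forall>a\<in>ball 0 1 - D. (b - a) \<bullet> e \<le> \<delta>1 * norm (b - a)) \<longrightarrow> K0 \<le> R \<longrightarrow> 0 \<le> R \<longrightarrow>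
     (2 + k\<^sup>2) * (LINT v:D|lborel. \<eta> (norm v)) - R * (LINT v:D|lborel. \<eta> (norm v) * (m \<bullet> v)) \<le> c"
    by (elim exE conjE) (rule that)
  define K where "K = max K0 (16 * (1 + k) / s)"
  have K: "K0 \<le> K" "16 * (1 + k) \<le> s * K"
  proof -
    have "16 * (1 + k) / s \<le> K"
      by (simp add: K_def)
    then show "16 * (1 + k) \<le> s * K"
      using s by (simp add: pos_divide_le_eq mult.commute)
  qed (simp add: K_def)
  define \<delta>0 where "\<delta>0 = min \<delta>1 (s / 16)"
  have \<delta>0: "0 < \<delta>0" "\<delta>0 \<le> s / 16" "\<delta>0 \<le> \<delta>1"
    unfolding \<delta>0_def using \<delta>1 s by linarith+
  obtain r where r: "0 < r" and flat: "\<And>x. x \<in> \<Omega> \<Longrightarrow> \<exists>e. norm e = 1 \<and> flat_at \<Omega> \<delta>0 x r e"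
    using C1_boundary_uniform_cone[OF C1 bdd \<delta>0(1)] unfolding flat_at_def by blast
  define C where "C = 7 + k\<^sup>2 + (204 + 50 * k\<^sup>2) * s"
  have C: "0 \<le> C"
    using s by (simp add: C_def)
  define X1 where "X1 = \<beta> * 2 ^ d * (10 * G * C)"
  define X2 where "X2 = \<beta> * 2 ^ d * (\<rho>M * (L * C + 20 + 2 * real d * C))"
  have X: "0 \<le> X1" "0 \<le> X2"
    using \<beta> G C L \<rho> by (auto simp: X1_def X2_def)
  define \<kappa> where "\<kappa> = min 1 k / 32"
  have \<kappa>: "0 < \<kappa>"
    using k by (simp add: \<kappa>_def)
  \<comment> \<open>Besides staying below 1, the label distance and the radius of flatness,
    \<open>r0\<close> keeps the density error \<open>X1 * r0\<close> below
    \<open>c * \<rho>m / 2\<close>. The summand 1 in \<open>X1 + 1\<close> guards against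
    \<open>X1 = 0\<close>.\<close>
  define r0 where "r0 = min (min 1 rs) (min (r / 2) (c * \<rho>m / (2 * (X1 + 1))))"
  have pos: "0 < c * \<rho>m / (2 * (X1 + 1))" "0 < c * \<rho>m / (2 * (X2 + 1))"
    using c \<rho> X by (auto intro!: divide_pos_pos mult_pos_pos)
  have r0: "0 < r0" "r0 \<le> 1" "r0 \<le> rs" "r0 \<le> r / 2" "r0 \<le> c * \<rho>m / (2 * (X1 + 1))"
    unfolding r0_def using rs r pos by linarith+
  define t where "t = min (min (s\<^sup>2 / 8) (k / 4)) (min (\<kappa> / 2) (c * \<rho>m / (2 * (X2 + 1))))"
  have t: "0 < t" "t \<le> s\<^sup>2 / 8" "t \<le> k / 4" "t \<le> \<kappa> / 2" "t \<le> c * \<rho>m / (2 * (X2 + 1))"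
  proof -
    have "0 < s\<^sup>2 / 8"
      using s by simp
    then show "0 < t" "t \<le> s\<^sup>2 / 8" "t \<le> k / 4" "t \<le> \<kappa> / 2" "t \<le> c * \<rho>m / (2 * (X2 + 1))"
      unfolding t_def using k \<kappa> pos by linarith+
  qed
  define \<epsilon>1 where "\<epsilon>1 = min 1 (r / (4 * (5 + k)))"
  have \<epsilon>1: "0 < \<epsilon>1" "\<epsilon>1 \<le> 1" "\<epsilon>1 \<le> r / (4 * (5 + k))"
  proof -
    have "0 < r / (4 * (5 + k))"
      using r k by simp
    then show "0 < \<epsilon>1" "\<epsilon>1 \<le> 1" "\<epsilon>1 \<le> r / (4 * (5 + k))"
      unfolding \<epsilon>1_def by linarith+
  qed
  have half: "X * y \<le> c * \<rho>m / 2" if "0 \<le> X" "0 \<le> y" "y \<le> c * \<rho>m / (2 * (X + 1))" for X y :: real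
  proof -
    have "X * y \<le> (X + 1) * y"
      using that by (intro mult_right_mono) auto
    also have "\<dots> \<le> (X + 1) * (c * \<rho>m / (2 * (X + 1)))"
      using that by (intro mult_left_mono) auto
    also have "\<dots> = c * \<rho>m / 2"
      using that by (simp add: field_simps)
    finally show ?thesis .
  qed
  define Z where "Z = 5 * \<rho>M * 2 ^ d / (\<rho>m * (\<kappa> / 2) ^ d)"
  \<comment> \<open>By \<open>exp y \<ge> 1 + y\<close>, it suffices that
    \<open>10 * \<kappa> * lam\<close> reaches \<open>Z\<close>. The lower bound 1 serves
    \<open>E \<ge> 2\<close> in \<open>holder_estimate\<close>.\<close>
  define lam where "lam = max 1 (Z / (10 * \<kappa>))"
  have lam: "1 \<le> lam" "5 * \<rho>M * 2 ^ d \<le> \<rho>m * (\<kappa> / 2) ^ d * exp (10 * \<kappa> * lam)"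
  proof -
    have "Z / (10 * \<kappa>) \<le> lam"
      by (simp add: lam_def)
    then have "Z \<le> 10 * \<kappa> * lam"
      using \<kappa> by (simp add: pos_divide_le_eq mult.commute)
    also have "\<dots> \<le> exp (10 * \<kappa> * lam)"
      using exp_ge_add_one_self[of "10 * \<kappa> * lam"] by linarith
    finally show "5 * \<rho>M * 2 ^ d \<le> \<rho>m * (\<kappa> / 2) ^ d * exp (10 * \<kappa> * lam)"
      using \<rho> \<kappa> by (simp add: Z_def pos_divide_le_eq mult.commute)
  qed (simp add: lam_def)
  define B where "B = 5 * (2 * (K + 1 + k)) powr a * exp (2 * lam * K)"
  have B: "0 \<le> B"
    by (simp add: B_def)
  show ?thesis
  proof (rule exI[of _ s], rule exI[of _ lam], rule exI[of _ B], rule exI[of _ r0], rule exI[of _ t],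
      rule exI[of _ \<epsilon>1], intro conjI allI impI ballI)
    show "0 < s" "s \<le> 1/8" "1 \<le> lam" "0 \<le> B" "0 < r0" "r0 \<le> rs" "0 < t" "0 < \<epsilon>1"
      using s lam B r0 t \<epsilon>1 by auto
    fix \<rho> :: "'a \<Rightarrow> real" and g x n T \<epsilon> \<delta> x0
    assume cl: "cloud \<Omega> \<rho> g x n T \<eta> \<epsilon> \<delta> \<rho>m \<rho>M G L" and \<epsilon>le: "\<epsilon> \<le> \<epsilon>1" and \<delta>le: "\<delta> \<le> t * \<epsilon>\<^sup>2"
      and x0: "x0 \<in> x ` {1..n}"
    interpret cloud \<Omega> \<rho> g x n T \<eta> \<epsilon> \<delta> \<rho>m \<rho>M G L
      by (rule cl)
    have "x0 \<in> \<Omega>"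
      using x0 S by auto
    then obtain e where e: "norm e = 1" and fl: "flat_at \<Omega> \<delta>0 x0 r e"
      using flat by blast
    have \<epsilon>sq: "\<epsilon>\<^sup>2 \<le> \<epsilon>"
      using \<epsilon> \<epsilon>le \<epsilon>1 by (simp add: power2_eq_square mult_left_le)
    have sm1: "8 * \<delta> \<le> s\<^sup>2 * \<epsilon>\<^sup>2"
    proof -
      have "t * \<epsilon>\<^sup>2 \<le> s\<^sup>2 / 8 * \<epsilon>\<^sup>2"
        using t by (intro mult_right_mono) auto
      then show ?thesis
        using \<delta>le by simp
    qed
    have sm2: "2 * \<delta> < k * \<epsilon>"
    proof -
      have "t * \<epsilon>\<^sup>2 \<le> k / 4 * \<epsilon>"
        using t \<epsilon>sq k by (intro mult_mono) auto
      moreover have "0 < k * \<epsilon>"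
        using k \<epsilon> by simp
      ultimately show ?thesis
        using \<delta>le by simp
    qed
    have sm3: "\<delta> \<le> \<kappa> * \<epsilon> / 2"
    proof -
      have "t * \<epsilon>\<^sup>2 \<le> \<kappa> / 2 * \<epsilon>"
        using t \<epsilon>sq \<kappa> by (intro mult_mono) auto
      then show ?thesis
        using \<delta>le by simp
    qed
    have rad: "r0 + (5 + k) * \<epsilon> < r"
    proof -
      have "(5 + k) * \<epsilon> \<le> (5 + k) * (r / (4 * (5 + k)))"
        using \<epsilon>le \<epsilon>1 k by (intro mult_left_mono) auto
      also have "\<dots> = r / 4"
        using k by (simp add: field_simps)
      finally show ?thesis
        using r0 r by linarith
    qed
    have err: "unit_ball_vol DIM('a) * 2 ^ DIM('a) * (10 * G * C * r0 + \<rho>M * (\<delta> / \<epsilon>\<^sup>2) * (L * C + 20 + 2 * real DIM('a) * C))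
      < 2 * c * \<rho>m"
    proof -
      have "\<delta> / \<epsilon>\<^sup>2 \<le> t"
        using \<delta>le \<epsilon> by (simp add: pos_divide_le_eq)
      then have "X2 * (\<delta> / \<epsilon>\<^sup>2) \<le> c * \<rho>m / 2"
        using half[OF X(2), of "\<delta> / \<epsilon>\<^sup>2"] t \<delta> by simp
      moreover have "X1 * r0 \<le> c * \<rho>m / 2"
        using half[OF X(1), of r0] r0 by simp
      moreover have "0 < c * \<rho>m"
        using c \<rho>m by simp
      moreover have "unit_ball_vol DIM('a) * 2 ^ DIM('a) * (10 * G * C * r0 + \<rho>M * (\<delta> / \<epsilon>\<^sup>2) * (L * C + 20 + 2 * real DIM('a) * C))
          = X1 * r0 + X2 * (\<delta> / \<epsilon>\<^sup>2)"
        by (simp add: X1_def X2_def \<beta>_def d_def algebra_simps)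
      ultimately show ?thesis
        by linarith
    qed
    \<comment> \<open>Of the margin \<open>4 * c\<close>, the tilt takes \<open>c\<close> and the
      missing cap takes \<open>c\<close>; the remaining \<open>2 * c\<close> exceeds the density and
      transport errors bounded in \<open>err\<close>.\<close>
    have c': "(DIM('a) - (2 - a)) * (2 * sigma1 TYPE('a) \<eta>)
      - ((1 - a) * k\<^sup>2 - (204 + 50 * k\<^sup>2) * s) * (2 * sigma2 TYPE('a) \<eta>) + c \<le> - (2 * c)"
      using c(2) sA unfolding \<sigma>2_def left_diff_distrib by linarith
    have cap': "(2 + k\<^sup>2) * (LINT v:D|lborel. \<eta> (norm v)) - R' * (LINT v:D|lborel. \<eta> (norm v) * (m \<bullet> v)) \<le> c"
      if "D \<in> sets borel" "D \<subseteq> ball 0 1" "0 \<notin> D" "norm m = 1" "D \<noteq> {} \<longrightarrow> m \<bullet> e \<le> - (s / 2)"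
        and fl': "\<forall>b\<in>D. \<forall>a\<in>ball 0 1 - D. (b - a) \<bullet> e \<le> \<delta>0 * norm (b - a)" and "K \<le> R'" "0 \<le> R'"
      for D :: "'a set" and m R'
    proof (rule cap[THEN spec, THEN spec, THEN spec, THEN spec, THEN mp, THEN mp, THEN mp, THEN mp, THEN mp,
          THEN mp, THEN mp, THEN mp, THEN mp, OF that(1-3) e that(4,5) _ _ that(8)])
      show "\<forall>b\<in>D. \<forall>a\<in>ball 0 1 - D. (b - a) \<bullet> e \<le> \<delta>1 * norm (b - a)"
      proof (intro ballI)
        fix b a assume "b \<in> D" "a \<in> ball 0 1 - D"
        then have "(b - a) \<bullet> e \<le> \<delta>0 * norm (b - a)"
          using fl' by blast
        also have "\<dots> \<le> \<delta>1 * norm (b - a)"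
          using \<delta>0 by (intro mult_right_mono) auto
        finally show "(b - a) \<bullet> e \<le> \<delta>1 * norm (b - a)" .
      qed
      show "K0 \<le> R'"
        using that(7) K by linarith
    qed
    show "\<exists>e. norm e = 1 \<and> (\<forall>z\<in>x ` {1..n}. z \<noteq> x0 \<longrightarrow> norm (z - x0) < r0 \<longrightarrow>
        step_sum \<eta> (k * \<epsilon>) \<epsilon> x n (\<lambda>q. barrier_profile a B lam \<epsilon> (tilted_norm s e (q - x0))) z < 0)"
    proof (intro exI[of _ e] conjI ballI impI e)
      fix z assume z: "z \<in> x ` {1..n}" "z \<noteq> x0" "norm (z - x0) < r0"
      show "step_sum \<eta> (k * \<epsilon>) \<epsilon> x n (\<lambda>q. barrier_profile a B lam \<epsilon> (tilted_norm s e (q - x0))) z < 0"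
        by (rule barrier_step[OF a s(1,2) k x0 z(1,2) e fl \<delta>0(1,2) z(3) r0(2) rad sm1 sm2 sm3 K(2) cap' \<kappa>_def
              _ lam(2)[unfolded d_def] B_def c(1) c' C_def err]) (use lam in auto)
    qed
  qed
qed

section \<open>From the asymptotic assumptions to a single large \<open>n\<close>\<close>

lemma transport_rate_pos:
  assumes "2 \<le> n"
  shows "0 < transport_rate d n"
  using assms by (simp add: transport_rate_def)

text \<open>Doubling \<open>C0\<close> turns the bound on the upper limit into a strict one, which
  then holds for all large \<open>n\<close>; the extended real displacement is thereby bounded by a
  real number.\<close>

lemma displacement_bound:
  assumes "0 < C0" and lim: "limsup (\<lambda>n. Linf_displacement \<Omega> (T n) / ereal (transport_rate d n)) \<le> ereal C0"
  shows "\<forall>\<^sub>F n in sequentially. Linf_displacement \<Omega> (T n) \<le> ereal (2 * C0 * transport_rate d n)"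
proof -
  have "limsup (\<lambda>n. Linf_displacement \<Omega> (T n) / ereal (transport_rate d n)) < ereal (2 * C0)"
    using lim assms(1) by (intro le_less_trans[OF lim]) simp
  then have "\<forall>\<^sub>F n in sequentially. Linf_displacement \<Omega> (T n) / ereal (transport_rate d n) < ereal (2 * C0)"
    by (rule Limsup_lessD)
  then show ?thesis
    using eventually_ge_at_top[of 2]
  proof eventually_elim
    case (elim n)
    have pos: "0 < transport_rate d n"
      by (rule transport_rate_pos) (use elim in simp)
    show ?case
    proof (cases "Linf_displacement \<Omega> (T n)")
      case (real v)
      then show ?thesis
        using elim(1) pos by (simp add: divide_less_eq)
    next
      case PInf
      then show ?thesis
        using elim(1) pos by simp
    qed simp
  qed
qed

lemma rate_tendsto:
  assumes lim: "(\<lambda>n. sqrt (transport_rate d n) / \<epsilon> n) \<longlonglongrightarrow> 0"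
  shows "(\<lambda>n. transport_rate d n / (\<epsilon> n)\<^sup>2) \<longlonglongrightarrow> 0"
proof -
  have "(\<lambda>n. (sqrt (transport_rate d n) / \<epsilon> n)\<^sup>2) \<longlonglongrightarrow> 0\<^sup>2"
    by (intro tendsto_intros lim)
  then have "(\<lambda>n. (sqrt (transport_rate d n) / \<epsilon> n)\<^sup>2) \<longlonglongrightarrow> 0"
    by (simp only: zero_power2)
  moreover have "\<forall>\<^sub>F n in sequentially. (sqrt (transport_rate d n) / \<epsilon> n)\<^sup>2 = transport_rate d n / (\<epsilon> n)\<^sup>2"
    using eventually_ge_at_top[of 2]
  proof eventually_elim
    case (elim n)
    then show ?case
      using transport_rate_pos[of n d] by (simp add: power_divide)
  qed
  ultimately show ?thesis
    by (rule Lim_transform_eventually)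
qed

theorem proposition13:
  fixes \<Omega> :: "'a::euclidean_space set"
    and \<rho> :: "'a \<Rightarrow> real"
    and P :: "'w measure" and X :: "nat \<Rightarrow> 'w \<Rightarrow> 'a" and \<omega> :: 'w
    and x :: "nat \<Rightarrow> 'a" and y :: "nat \<Rightarrow> real" and N :: nat
    and T :: "nat \<Rightarrow> 'a \<Rightarrow> 'a" and c0 C0 :: real
    and \<eta> :: "real \<Rightarrow> real" and \<epsilon> :: "nat \<Rightarrow> real" and p \<alpha> :: real
  assumes dim: "2 \<le> DIM('a)"
    and domain: "open \<Omega>" "connected \<Omega>" "bounded \<Omega>" "\<Omega> \<noteq> {}" "C1_boundary \<Omega>"
    and density: "C2_on_closure \<Omega> \<rho>" "\<forall>z \<in> closure \<Omega>. 0 < \<rho> z"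
      "prob_space (density_measure \<Omega> \<rho>)"
    and labeled: "1 \<le> N" "\<forall>i \<in> {1..N}. x i \<in> \<Omega>"
    and samples: "prob_space P"
      "prob_space.indep_vars P (\<lambda>_. density_measure \<Omega> \<rho>) X {N<..}"
      "\<forall>i > N. distr P (density_measure \<Omega> \<rho>) (X i) = density_measure \<Omega> \<rho>"
    and realization: "\<omega> \<in> space P" "\<forall>i > N. x i = X i \<omega>"
    and transport: "\<forall>n > N. transport_map \<Omega> \<rho> x n (T n)"
    and transport_bounds: "0 < c0" "0 < C0"
      "ereal c0 \<le> liminf (\<lambda>n. Linf_displacement \<Omega> (T n) / ereal (transport_rate DIM('a) n))"
      "limsup (\<lambda>n. Linf_displacement \<Omega> (T n) / ereal (transport_rate DIM('a) n)) \<le> ereal C0"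
    and kernel: "admissible_kernel \<eta>"
    and eps: "\<forall>n > N. 0 < \<epsilon> n" "\<epsilon> \<longlonglongrightarrow> 0"
      "(\<lambda>n. sqrt (transport_rate DIM('a) n) / \<epsilon> n) \<longlonglongrightarrow> 0"
    and exponents: "real DIM('a) < p" "0 < \<alpha>" "\<alpha> < (p - real DIM('a)) / (p - 1)"
  shows "\<exists>C > 0. \<forall>\<^sub>F n in sequentially. \<forall>u :: 'a \<Rightarrow> real.
           is_solution \<eta> p (\<epsilon> n) x N y n u \<longrightarrow>
           (\<forall>i \<in> {1..n}. \<forall>j \<in> {1..n}.
              \<bar>u (x i) - u (x j)\<bar> \<le> C * norm (x i - x j) powr \<alpha> + C * \<epsilon> n powr \<alpha>)"
proof -
  obtain g :: "'a \<Rightarrow> 'a" and H :: "'a \<Rightarrow> 'a \<Rightarrow>\<^sub>L 'a" where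
    g: "\<And>z. z \<in> \<Omega> \<Longrightarrow> GDERIV \<rho> z :> g z" "continuous_on (closure \<Omega>) \<rho>" "continuous_on (closure \<Omega>) g"
    using density(1) unfolding C2_on_closure_def by blast
  have comp: "compact (closure \<Omega>)" and ne: "closure \<Omega> \<noteq> {}"
    using domain by (auto simp: compact_closure)
  have sub: "\<Omega> \<subseteq> closure \<Omega>"
    by (rule closure_subset)
  obtain z1 where z1: "z1 \<in> closure \<Omega>" "\<And>z. z \<in> closure \<Omega> \<Longrightarrow> \<rho> z1 \<le> \<rho> z"
    using continuous_attains_inf[OF comp ne g(2)] by blast
  obtain z2 where z2: "z2 \<in> closure \<Omega>" "\<And>z. z \<in> closure \<Omega> \<Longrightarrow> \<rho> z \<le> \<rho> z2"
    using continuous_attains_sup[OF comp ne g(2)] by blast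
  have \<rho>pos: "0 < \<rho> z1" "0 < \<rho> z2"
    using density(2) z1 z2 by auto
  obtain G where G: "0 < G" "\<And>z. z \<in> closure \<Omega> \<Longrightarrow> norm (g z) \<le> G"
    using compact_imp_bounded[OF compact_continuous_image[OF g(3) comp]] unfolding bounded_pos by auto
  obtain L where L: "L-lipschitz_on {0..} \<eta>"
    using kernel by (auto simp: admissible_kernel_def)
  have L0: "0 \<le> L"
    using L by (rule lipschitz_on_nonneg)
  \<comment> \<open>A random sample lies in \<open>\<Omega>\<close> for every outcome:
    \<open>X i\<close> is measurable into a measure whose space is \<open>\<Omega>\<close>.\<close>
  have in\<Omega>: "x i \<in> \<Omega>" if i: "1 \<le> i" for i
  proof (cases "i \<le> N")
    case True
    then show ?thesis
      using labeled i by simp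
  next
    case False
    interpret prob_space P
      by (rule samples(1))
    have "X i \<in> measurable P (density_measure \<Omega> \<rho>)"
      using samples(2) False unfolding indep_vars_def by auto
    then have "X i \<omega> \<in> space (density_measure \<Omega> \<rho>)"
      using realization(1) by (rule measurable_space)
    then show ?thesis
      using realization(2) False by (simp add: density_measure_def space_restrict_space)
  qed

  define d where "d = real DIM('a)"
  define k where "k = radius_factor TYPE('a) \<eta> p"
  define \<sigma>1 \<sigma>2 where "\<sigma>1 = sigma1 TYPE('a) \<eta>" and "\<sigma>2 = sigma2 TYPE('a) \<eta>"
  have \<sigma>: "0 < \<sigma>1" "0 < \<sigma>2"
    using sigma1_pos[OF kernel] sigma2_pos[OF kernel] by (auto simp: \<sigma>1_def \<sigma>2_def)
  have d2: "2 \<le> d" "2 < p"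
    using dim exponents by (auto simp: d_def)
  have k: "0 < k" "k\<^sup>2 * \<sigma>2 = (p - 2) * \<sigma>1"
    using d2 \<sigma> by (auto simp: k_def radius_factor_def \<sigma>1_def[symmetric] \<sigma>2_def[symmetric])
  \<comment> \<open>The margin in the exponent condition. With
    \<open>k^2 * \<sigma>2 = (p - 2) * \<sigma>1\<close> the leading coefficient of the barrier
    equals \<open>- 2 * \<sigma>1 * \<gamma>\<close>, that is \<open>- 4 * c\<close>.\<close>
  define \<gamma> where "\<gamma> = p - d - \<alpha> * (p - 1)"
  have \<gamma>: "0 < \<gamma>"
    using exponents(3) d2 by (simp add: \<gamma>_def d_def pos_less_divide_eq)
  have "(p - d) / (p - 1) < 1"
    using d2 by (simp add: divide_less_eq)
  then have \<alpha>: "0 < \<alpha>" "\<alpha> < 1"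
    using exponents by (auto simp: d_def)
  define c where "c = \<sigma>1 * \<gamma> / 2"
  have c: "0 < c"
    using \<sigma> \<gamma> by (simp add: c_def)
  have ineq: "(DIM('a) - (2 - \<alpha>)) * (2 * sigma1 TYPE('a) \<eta>) - (1 - \<alpha>) * k\<^sup>2 * (2 * sigma2 TYPE('a) \<eta>) \<le> - (4 * c)"
  proof -
    have "(1 - \<alpha>) * k\<^sup>2 * (2 * \<sigma>2) = (1 - \<alpha>) * (2 * (k\<^sup>2 * \<sigma>2))"
      by simp
    also have "\<dots> = (1 - \<alpha>) * (2 * ((p - 2) * \<sigma>1))"
      unfolding k(2) ..
    finally have k_eq: "(1 - \<alpha>) * k\<^sup>2 * (2 * \<sigma>2) = (1 - \<alpha>) * (2 * ((p - 2) * \<sigma>1))" .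
    have "4 * c = 2 * \<sigma>1 * \<gamma>"
      by (simp add: c_def)
    then have "(d - (2 - \<alpha>)) * (2 * \<sigma>1) - (1 - \<alpha>) * k\<^sup>2 * (2 * \<sigma>2) = - (4 * c)"
      unfolding k_eq by (simp add: \<gamma>_def algebra_simps)
    then show ?thesis
      by (simp add: d_def \<sigma>1_def \<sigma>2_def)
  qed

  define Lb where "Lb = x ` {1..N}"
  \<comment> \<open>Removing 0 discards pairs of equal labeled points, and inserting 1 keeps
    \<open>Min\<close> meaningful when there is only one labeled point.\<close>
  define D where "D = (\<lambda>(p, q). norm (p - q)) ` (Lb \<times> Lb) - {0}"
  define rs where "rs = Min (insert 1 D)"
  have finD: "finite D"
    by (simp add: D_def Lb_def)
  have rs: "0 < rs" "\<And>p q. p \<in> Lb \<Longrightarrow> q \<in> Lb \<Longrightarrow> p \<noteq> q \<Longrightarrow> rs \<le> norm (p - q)"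
  proof -
    have "\<forall>t\<in>insert 1 D. 0 < t"
      by (auto simp: D_def)
    then show "0 < rs"
      unfolding rs_def using finD by (subst Min_gr_iff) auto
    fix p q assume "p \<in> Lb" "q \<in> Lb" "p \<noteq> q"
    then have "norm (p - q) \<in> insert 1 D"
      by (auto simp: D_def)
    then show "rs \<le> norm (p - q)"
      unfolding rs_def using finD by (intro Min_le) auto
  qed
  \<comment> \<open>The summand 1 makes \<open>Y\<close> positive even if all labels are
    zero.\<close>
  define Y where "Y = 1 + (\<Sum>i=1..N. \<bar>y i\<bar>)"
  have Y0: "0 < Y"
    by (auto simp: Y_def intro!: add_pos_nonneg sum_nonneg)
  have Y: "\<bar>y i\<bar> \<le> Y" if "i \<in> {1..N}" for i
    using member_le_sum[OF that, of "\<lambda>i. \<bar>y i\<bar>"] by (simp add: Y_def)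

  obtain s lam B r0 t \<epsilon>1 where s: "0 < s" "s \<le> 1/8" and lam: "1 \<le> lam" and B: "0 \<le> B"
    and r0: "0 < r0" "r0 \<le> rs" and t: "0 < t" and \<epsilon>1: "0 < \<epsilon>1"
    and bar: "\<forall>\<rho>' g' x n T \<epsilon> \<delta>. cloud \<Omega> \<rho>' g' x n T \<eta> \<epsilon> \<delta> (\<rho> z1) (\<rho> z2) G L \<longrightarrow> \<epsilon> \<le> \<epsilon>1 \<longrightarrow> \<delta> \<le> t * \<epsilon>\<^sup>2 \<longrightarrow>
      (\<forall>x0\<in>x ` {1..n}. \<exists>e. norm e = 1 \<and> (\<forall>z\<in>x ` {1..n}. z \<noteq> x0 \<longrightarrow> norm (z - x0) < r0 \<longrightarrow>
        step_sum \<eta> (k * \<epsilon>) \<epsilon> x n (\<lambda>q. barrier_profile \<alpha> B lam \<epsilon> (tilted_norm s e (q - x0))) z < 0))"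
    using uniform_barrier[OF domain(5,3) kernel \<alpha> k(1) \<rho>pos less_imp_le[OF G(1)] L0 rs(1) c ineq]
    by (elim exE conjE) (rule that)

  define A where "A = 2 * Y / ((7/8) * r0) powr \<alpha>"
  have A0: "0 < A"
    using Y0 r0 by (simp add: A_def)
  define E where "E = B * exp lam"
  have E0: "0 \<le> E"
    using B by (simp add: E_def)
  \<comment> \<open>\<open>2 powr \<alpha> \<le> 2\<close> turns the factor \<open>4 * A\<close> of
    the distance term into \<open>8 * A\<close>; the other part is the coefficient of
    \<open>\<epsilon> n powr \<alpha>\<close>.\<close>
  define C where "C = 8 * A + 4 * A * E"
  have C: "0 < C" "8 * A \<le> C" "4 * A * E \<le> C"
    using A0 E0 by (auto simp: C_def intro!: add_pos_nonneg)

  \<comment> \<open>With \<open>\<epsilon> n \<le> 1\<close> the value 1/4 yields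
    \<open>4 * \<delta> n \<le> \<epsilon> n\<close>, which the connectedness of the cloud at scale
    \<open>\<epsilon> n\<close> requires.\<close>
  define t' where "t' = min t (1/4)"
  define \<delta> where "\<delta> n = 2 * C0 * transport_rate DIM('a) n" for n
  have \<delta>_lim: "(\<lambda>n. \<delta> n / (\<epsilon> n)\<^sup>2) \<longlonglongrightarrow> 0"
    using tendsto_mult_left[OF rate_tendsto[OF eps(3)], of "2 * C0"] by (simp add: \<delta>_def)
  have ev1: "\<forall>\<^sub>F n in sequentially. \<delta> n / (\<epsilon> n)\<^sup>2 < t'"
    using \<delta>_lim t by (intro order_tendstoD(2)) (auto simp: t'_def)
  have ev2: "\<forall>\<^sub>F n in sequentially. \<epsilon> n < min \<epsilon>1 1"
    using eps(2) \<epsilon>1 by (intro order_tendstoD(2)) auto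
  have ev3: "\<forall>\<^sub>F n in sequentially. Linf_displacement \<Omega> (T n) \<le> ereal (\<delta> n)"
    unfolding \<delta>_def by (rule displacement_bound[OF transport_bounds(2,4)])
  show ?thesis
  proof (intro exI conjI)
    show "0 < C" by fact
    show "\<forall>\<^sub>F n in sequentially. \<forall>u :: 'a \<Rightarrow> real. is_solution \<eta> p (\<epsilon> n) x N y n u \<longrightarrow>
           (\<forall>i \<in> {1..n}. \<forall>j \<in> {1..n}.
              \<bar>u (x i) - u (x j)\<bar> \<le> C * norm (x i - x j) powr \<alpha> + C * \<epsilon> n powr \<alpha>)"
      using ev1 ev2 ev3 eventually_ge_at_top[of 2] eventually_gt_at_top[of N]
    proof eventually_elim
      case (elim n)
      have \<epsilon>n: "0 < \<epsilon> n" "\<epsilon> n \<le> \<epsilon>1" "\<epsilon> n \<le> 1"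
        using eps(1) elim by auto
      have \<delta>n: "0 < \<delta> n"
        unfolding \<delta>_def using transport_rate_pos[of n "DIM('a)"] transport_bounds elim by simp
      have "\<delta> n < t' * (\<epsilon> n)\<^sup>2"
        using elim(1) \<epsilon>n by (simp add: pos_divide_less_eq)
      moreover have "t' * (\<epsilon> n)\<^sup>2 \<le> t * (\<epsilon> n)\<^sup>2" "t' * (\<epsilon> n)\<^sup>2 \<le> 1/4 * (\<epsilon> n)\<^sup>2"
        by (intro mult_right_mono; simp add: t'_def)+
      moreover have "(\<epsilon> n)\<^sup>2 \<le> \<epsilon> n"
        using \<epsilon>n by (simp add: power2_eq_square mult_left_le)
      ultimately have sm: "\<delta> n \<le> t * (\<epsilon> n)\<^sup>2" "4 * \<delta> n \<le> \<epsilon> n" "\<delta> n \<le> \<epsilon> n"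
        using \<delta>n by linarith+
      have cl: "cloud \<Omega> \<rho> g x n (T n) \<eta> (\<epsilon> n) (\<delta> n) (\<rho> z1) (\<rho> z2) G L"
      proof
        show "transport_map \<Omega> \<rho> x n (T n)" "0 < n"
          using transport elim by auto
        show "x ` {1..n} \<subseteq> \<Omega>"
          using in\<Omega> by auto
        show "AE y in lborel. y \<in> \<Omega> \<longrightarrow> norm (y - T n y) \<le> \<delta> n"
          using domain(1) elim(3) by (rule displacement_AE)
      qed (use domain g G z1 z2 sub \<rho>pos \<delta>n sm \<epsilon>n kernel L in \<open>auto intro: continuous_on_subset\<close>)
      interpret cloud \<Omega> \<rho> g x n "T n" \<eta> "\<epsilon> n" "\<delta> n" "\<rho> z1" "\<rho> z2" G L
        by (rule cl)
      show ?case
      proof (intro allI impI ballI)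
        fix u :: "'a \<Rightarrow> real" and i j
        assume sol: "is_solution \<eta> p (\<epsilon> n) x N y n u" and i: "i \<in> {1..n}" and j: "j \<in> {1..n}"
        have zero: "step_sum \<eta> (k * \<epsilon> n) (\<epsilon> n) x n u z = 0" if "z \<in> x ` {1..n} - Lb" for z
        proof -
          have "hypergraph_op \<eta> p (\<epsilon> n) x n u z = 0"
            using sol that unfolding is_solution_def Lb_def by blast
          then show ?thesis
            using \<epsilon>n n unfolding hypergraph_op_eq_step_sum k_def by auto
        qed
        have "\<bar>u (x i) - u (x j)\<bar> \<le> 4 * A * ((2 * norm (x i - x j)) powr \<alpha> + B * \<epsilon> n powr \<alpha> * exp lam)"
          unfolding A_def
        proof (rule holder_estimate[OF \<alpha> B _ s lam r0(1) Y0 domain(2) sm(2) _ _ _ _ _ zero])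
          show "0 \<le> k * \<epsilon> n"
            using k \<epsilon>n by simp
          show "\<exists>e. norm e = 1 \<and> (\<forall>z\<in>x ` {1..n}. z \<noteq> x0 \<longrightarrow> norm (z - x0) < r0 \<longrightarrow>
              step_sum \<eta> (k * \<epsilon> n) (\<epsilon> n) x n (\<lambda>q. barrier_profile \<alpha> B lam (\<epsilon> n) (tilted_norm s e (q - x0))) z < 0)"
            if "x0 \<in> x ` {1..n}" for x0
            using bar[rule_format, OF cl \<epsilon>n(2) sm(1) that] by blast
          show "Lb \<subseteq> x ` {1..n}" "Lb \<noteq> {}"
            using elim labeled by (auto simp: Lb_def)
          show "r0 \<le> norm (p - q)" if "p \<in> Lb" "q \<in> Lb" "p \<noteq> q" for p q
            using rs(2)[OF that] r0 by simp
          show "\<bar>u p\<bar> \<le> Y" if "p \<in> Lb" for p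
          proof -
            obtain i where "i \<in> {1..N}" "p = x i"
              using \<open>p \<in> Lb\<close> by (auto simp: Lb_def)
            then show ?thesis
              using Y sol unfolding is_solution_def by auto
          qed
        qed (use i j in auto)
        also have "\<dots> = 4 * A * (2 powr \<alpha> * norm (x i - x j) powr \<alpha>) + 4 * A * E * \<epsilon> n powr \<alpha>"
          by (simp add: E_def powr_mult algebra_simps)
        also have "\<dots> \<le> 4 * A * (2 * norm (x i - x j) powr \<alpha>) + C * \<epsilon> n powr \<alpha>"
        proof (intro add_mono mult_left_mono mult_right_mono)
          have "2 powr \<alpha> \<le> 2 powr 1"
            using \<alpha> by (intro powr_mono) auto
          then show "2 powr \<alpha> \<le> (2::real)"
            by simp
        qed (use A0 C in auto)
        also have "\<dots> \<le> C * norm (x i - x j) powr \<alpha> + C * \<epsilon> n powr \<alpha>"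
        proof -
          have "8 * A * norm (x i - x j) powr \<alpha> \<le> C * norm (x i - x j) powr \<alpha>"
            using C by (intro mult_right_mono) auto
          then show ?thesis
            by simp
        qed
        finally show "\<bar>u (x i) - u (x j)\<bar> \<le> C * norm (x i - x j) powr \<alpha> + C * \<epsilon> n powr \<alpha>" .
      qed
    qed
  qed
qed

end
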